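(* Let $(p_n)_{n=1}^\infty$ be a sequence in $[1,\infty)$ such that $\lim_n p_n=1$ and \[ \sum_{n=1}^\infty r^{1/|p_n-1|}=\infty\quad\text{for all } 0<r<1 \] (terms with $p_n=1$ being interpreted as $0$). Then the Nakano space $\ell_{(p_n)}$ does not have a greedy basis.
   Context: Nakano space: for a sequence $(p_n)_{n=1}^\infty$ in $[1,\infty)$ and a real sequence $\alpha=(a_n)_{n=1}^\infty$ put $m_{(p_n)}(\alpha)=\sum_{n=1}^\infty |a_n|^{p_n}$ and $\|\alpha\|_{(p_n)}=\inf\{t>0 : m_{(p_n)}(\alpha/t)\le 1\}$; $\ell_{(p_n)}$ is the Banach space of all real sequences $\alpha$ with $m_{(p_n)}(\alpha/t)<\infty$ for some $t>0$, with norm $\|\cdot\|_{(p_n)}$. Bases: a basis is a Schauder basis $(x_n)_{n=1}^\infty$, and all bases are assumed semi-normalized, i.e. $0<\inf_n\|x_n\|\le\sup_n\|x_n\|<\infty$. A basis $(x_n)$ of $X$ with biorthogonal functionals $(x_n^* )$ is greedy if there is a constant $C$ such that for every $x\in X$, every $N\in\mathbb{N}$, and every set $\Lambda\subseteq\mathbb{N}$ with $|\Lambda|=N$ and $\min_{n\in\Lambda}|x_n^*(x)|\ge\max_{n\notin\Lambda}|x_n^*(x)|$, one has $\|x-\sum_{n\in\Lambda}x_n^*(x)x_n\|\le C\inf\{\|x-\sum_{n\in A}\alpha_n x_n\| : |A|=N,\ \alpha_n\in\mathbb{R}\}$. *)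

theory Defs
  imports "HOL-Analysis.Analysis" "HOL-Library.Function_Algebras"
begin

text \<open>The pointwise real vector space structure on functions; the additive part comes from
  \<^theory>\<open>HOL-Library.Function_Algebras\<close>.\<close>

instantiation "fun" :: (type, real_vector) real_vector
begin

definition scaleR_fun :: "real \<Rightarrow> ('a \<Rightarrow> 'b) \<Rightarrow> 'a \<Rightarrow> 'b"
  where "scaleR_fun c f = (\<lambda>x. c *\<^sub>R f x)"

instance
  by standard (simp_all add: scaleR_fun_def fun_eq_iff scaleR_add_right scaleR_add_left)

end

text \<open>Sequences are indexed from \<open>0\<close> throughout.\<close>

definition nakano_modular :: "(nat \<Rightarrow> real) \<Rightarrow> (nat \<Rightarrow> real) \<Rightarrow> ennreal"
  where "nakano_modular p a = (\<Sum>n. ennreal (\<bar>a n\<bar> powr p n))"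

definition nakano_space :: "(nat \<Rightarrow> real) \<Rightarrow> (nat \<Rightarrow> real) set"
  where "nakano_space p = {a. \<exists>t>0. nakano_modular p (\<lambda>n. a n / t) < \<infinity>}"

text \<open>Only meaningful on \<^term>\<open>nakano_space p\<close>: elsewhere the set is empty and its real
  infimum is unspecified.\<close>

definition nakano_norm :: "(nat \<Rightarrow> real) \<Rightarrow> (nat \<Rightarrow> real) \<Rightarrow> real"
  where "nakano_norm p a = Inf {t. t > 0 \<and> nakano_modular p (\<lambda>n. a n / t) \<le> 1}"

text \<open>A Banach space is given below by a linear subspace \<open>X\<close> of a real vector space and a norm
  \<open>nrm\<close> on \<open>X\<close>, since the norm of a Nakano space depends on the term \<open>p\<close> and cannot be
  a type class instance.\<close>

definition expansion :: "('a::real_vector \<Rightarrow> real) \<Rightarrow> (nat \<Rightarrow> 'a) \<Rightarrow> 'a \<Rightarrow> (nat \<Rightarrow> real) \<Rightarrow> bool"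
  where "expansion nrm x v a \<longleftrightarrow>
    (\<lambda>N. nrm (v - (\<Sum>n<N. a n *\<^sub>R x n))) \<longlonglongrightarrow> 0"

definition schauder_basis ::
    "'a::real_vector set \<Rightarrow> ('a \<Rightarrow> real) \<Rightarrow> (nat \<Rightarrow> 'a) \<Rightarrow> bool"
  where "schauder_basis X nrm x \<longleftrightarrow>
    range x \<subseteq> X \<and> (\<forall>v\<in>X. \<exists>!a. expansion nrm x v a)"

definition semi_normalized :: "('a \<Rightarrow> real) \<Rightarrow> (nat \<Rightarrow> 'a) \<Rightarrow> bool"
  where "semi_normalized nrm x \<longleftrightarrow>
    0 < (INF n. nrm (x n)) \<and> bdd_above (range (\<lambda>n. nrm (x n)))"

text \<open>The biorthogonal functionals of a Schauder basis are its coordinate functionals: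
  \<open>coord nrm x n v\<close> is the \<open>n\<close>-th coefficient of the expansion of \<open>v\<close>.\<close>

definition coord :: "('a::real_vector \<Rightarrow> real) \<Rightarrow> (nat \<Rightarrow> 'a) \<Rightarrow> nat \<Rightarrow> 'a \<Rightarrow> real"
  where "coord nrm x n v = (THE a. expansion nrm x v a) n"

definition best_approx_error ::
    "('a::real_vector \<Rightarrow> real) \<Rightarrow> (nat \<Rightarrow> 'a) \<Rightarrow> nat \<Rightarrow> 'a \<Rightarrow> real"
  where "best_approx_error nrm x N v =
    Inf {nrm (v - (\<Sum>n\<in>A. \<alpha> n *\<^sub>R x n)) | A \<alpha>. finite A \<and> card A = N}"

text \<open>\<open>greedy_set nrm x v \<Lambda>\<close> says
  \<open>min\<^bsub>n \<in> \<Lambda>\<^esub> \<bar>x\<^sub>n\<^sup>*(v)\<bar> \<ge> max\<^bsub>n \<notin> \<Lambda>\<^esub> \<bar>x\<^sub>n\<^sup>*(v)\<bar>\<close>.\<close>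

definition greedy_set ::
    "('a::real_vector \<Rightarrow> real) \<Rightarrow> (nat \<Rightarrow> 'a) \<Rightarrow> 'a \<Rightarrow> nat set \<Rightarrow> bool"
  where "greedy_set nrm x v \<Lambda> \<longleftrightarrow>
    (\<forall>i\<in>\<Lambda>. \<forall>j. j \<notin> \<Lambda> \<longrightarrow> \<bar>coord nrm x j v\<bar> \<le> \<bar>coord nrm x i v\<bar>)"

definition greedy_basis ::
    "'a::real_vector set \<Rightarrow> ('a \<Rightarrow> real) \<Rightarrow> (nat \<Rightarrow> 'a) \<Rightarrow> bool"
  where "greedy_basis X nrm x \<longleftrightarrow>
    schauder_basis X nrm x \<and> semi_normalized nrm x \<and>
    (\<exists>C. \<forall>v\<in>X. \<forall>N \<Lambda>. finite \<Lambda> \<and> card \<Lambda> = N \<and> greedy_set nrm x v \<Lambda> \<longrightarrow>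
      nrm (v - (\<Sum>n\<in>\<Lambda>. coord nrm x n v *\<^sub>R x n)) \<le> C * best_approx_error nrm x N v)"

end

theory Submission
  imports Defs
begin

text \<open>A greedy basis \<open>(x\<^sub>n)\<close> of the Nakano space is unconditional and democratic, and since \<open>p\<^sub>n\<close> tends
  to \<open>1\<close> a gliding hump argument shows that \<open>\<parallel>\<Sum>\<^bsub>n \<in> A\<^esub> x\<^sub>n\<parallel>\<close> is of order \<open>|A|\<close>. The heart of the
  proof is that such a basis is equivalent to the unit vector basis of \<open>\<ell>\<^sub>1\<close>. Let
  \<open>a\<^sub>n\<^sub>l = x\<^sub>n(l)\<close>, \<open>b\<^sub>n\<^sub>l = x\<^sub>n\<^sup>*(e\<^sub>l)\<close>, and let \<open>\<Lambda>\<close> be the best constant in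
  \<open>\<Sum> c\<^sub>n \<le> \<Lambda> \<parallel>\<Sum> c\<^sub>n x\<^sub>n\<parallel>\<close> over a finite set of indices. Expanding
  \<open>\<Sum>\<^sub>n c\<^sub>n = \<Sum>\<^sub>n c\<^sub>n \<Sum>\<^sub>l a\<^sub>n\<^sub>l b\<^sub>n\<^sub>l\<close>, one separates, for each \<open>l\<close>, the boundedly many \<open>n\<close> for which
  \<open>b\<^sub>n\<^sub>l\<close> is a fixed fraction of \<open>\<tau>\<^sub>l = (\<Sum>\<^sub>n b\<^sub>n\<^sub>l\<^sup>2)\<^sup>1\<^sup>/\<^sup>2\<close>. On the others, random signs weighted by Riesz
  products (which are harmless when \<open>p\<^sub>l\<close> is close to \<open>1\<close>) gain a large factor, so their
  contribution is at most \<open>\<Lambda> / 4\<close>. The remaining pieces of the \<open>x\<^sub>n\<close> have bounded overlap, so there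
  the norm is of Musielak-Orlicz type and democracy forces it to be of \<open>\<ell>\<^sub>1\<close> type. Hence
  \<open>\<Lambda> \<le> \<Lambda> / 2 + const\<close>. Grothendieck's averaging argument transfers the \<open>\<ell>\<^sub>1\<close> estimate to the unit
  vectors \<open>e\<^sub>l\<close>, and testing it on indicator functions makes the series in the hypothesis converge
  for some \<open>r\<close>.\<close>

section \<open>Nakano spaces\<close>

lemma sum_fun_apply: "(\<Sum>i\<in>A. f i) k = (\<Sum>i\<in>A. f i k)"
  for f :: "'i \<Rightarrow> 'b \<Rightarrow> 'c::comm_monoid_add"
  by (induction A rule: infinite_finite_induct) auto

lemma scaleR_fun_apply: "(c *\<^sub>R f) k = c *\<^sub>R f k"
  by (simp add: scaleR_fun_def)

lemma diff_fun_apply: "(f - g) k = f k - g k"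
  for f g :: "'b \<Rightarrow> 'c::group_add"
  by (simp add: fun_diff_def)

lemmas fun_vector_apply = sum_fun_apply scaleR_fun_apply diff_fun_apply

text \<open>Convexity of the power on the open half-line, extended to zero arguments, where the
  claim reduces to \<open>\<gamma> powr p \<le> \<gamma>\<close> for \<open>\<gamma>\<close> in
  [0, 1].\<close>

lemma powr_convex_combination:
  fixes a b \<alpha> \<beta> p :: real
  assumes "1 \<le> p" "0 \<le> a" "0 \<le> b" "0 \<le> \<alpha>" "0 \<le> \<beta>" "\<alpha> + \<beta> = 1"
  shows "(\<alpha> * a + \<beta> * b) powr p \<le> \<alpha> * a powr p + \<beta> * b powr p"
proof -
  have shrink: "(\<gamma> * c) powr p \<le> \<gamma> * c powr p" if "0 \<le> \<gamma>" "\<gamma> \<le> 1" "0 \<le> c" for \<gamma> c :: real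
  proof (cases "\<gamma> = 0")
    case False
    then have "\<gamma> powr p \<le> \<gamma> powr 1" using that assms(1) by (intro powr_mono') auto
    then show ?thesis using that by (simp add: powr_mult mult_right_mono)
  qed simp
  consider "a = 0" | "b = 0" | "a > 0" "b > 0" using assms by linarith
  then show ?thesis
  proof cases
    case 3
    then show ?thesis
      using powr_convex[OF assms(1)] assms unfolding convex_on_def by auto
  qed (use shrink[of \<alpha> a] shrink[of \<beta> b] assms in auto)
qed

section \<open>The modular and its Luxemburg norm\<close>

locale nakano =
  fixes p :: "nat \<Rightarrow> real"
  assumes p_ge1: "\<And>k. 1 \<le> p k"
begin

abbreviation X :: "(nat \<Rightarrow> real) set" where "X \<equiv> nakano_space p"
abbreviation N :: "(nat \<Rightarrow> real) \<Rightarrow> real" where "N \<equiv> nakano_norm p"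

lemma modular_mono:
  assumes "\<And>k. \<bar>u k\<bar> \<le> \<bar>v k\<bar>"
  shows "nakano_modular p u \<le> nakano_modular p v"
  unfolding nakano_modular_def
proof (intro suminf_le ennreal_leI powr_mono2)
  show "0 \<le> p k" for k using p_ge1[of k] by linarith
qed (use assms in auto)

lemma modular_scale:
  assumes "0 \<le> c" "c \<le> 1"
  shows "nakano_modular p (\<lambda>k. c * v k) \<le> ennreal c * nakano_modular p v"
proof -
  have "ennreal (\<bar>c * v k\<bar> powr p k) \<le> ennreal c * ennreal (\<bar>v k\<bar> powr p k)" for k
  proof -
    have "(c * \<bar>v k\<bar> + (1 - c) * 0) powr p k \<le> c * \<bar>v k\<bar> powr p k + (1 - c) * 0 powr p k"
      using assms p_ge1[of k] by (intro powr_convex_combination) auto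
    then show ?thesis using assms by (simp add: abs_mult flip: ennreal_mult)
  qed
  then show ?thesis unfolding nakano_modular_def
    by (subst ennreal_suminf_cmult[symmetric]) (rule suminf_le, auto)
qed

lemma modular_convex:
  assumes "0 \<le> \<alpha>" "0 \<le> \<beta>" "\<alpha> + \<beta> = 1"
  shows "nakano_modular p (\<lambda>k. \<alpha> * u k + \<beta> * v k)
    \<le> ennreal \<alpha> * nakano_modular p u + ennreal \<beta> * nakano_modular p v"
proof -
  have "ennreal (\<bar>\<alpha> * u k + \<beta> * v k\<bar> powr p k)
     \<le> ennreal \<alpha> * ennreal (\<bar>u k\<bar> powr p k) + ennreal \<beta> * ennreal (\<bar>v k\<bar> powr p k)" for k
  proof -
    have "\<bar>\<alpha> * u k + \<beta> * v k\<bar> \<le> \<alpha> * \<bar>u k\<bar> + \<beta> * \<bar>v k\<bar>"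
      using assms abs_triangle_ineq[of "\<alpha> * u k" "\<beta> * v k"] by (simp add: abs_mult)
    then have "\<bar>\<alpha> * u k + \<beta> * v k\<bar> powr p k \<le> (\<alpha> * \<bar>u k\<bar> + \<beta> * \<bar>v k\<bar>) powr p k"
      using p_ge1[of k] by (intro powr_mono2) auto
    also have "\<dots> \<le> \<alpha> * \<bar>u k\<bar> powr p k + \<beta> * \<bar>v k\<bar> powr p k"
      using assms p_ge1[of k] by (intro powr_convex_combination) auto
    finally show ?thesis using assms by (simp flip: ennreal_mult ennreal_plus)
  qed
  then have "nakano_modular p (\<lambda>k. \<alpha> * u k + \<beta> * v k) \<le>
      (\<Sum>k. ennreal \<alpha> * ennreal (\<bar>u k\<bar> powr p k) + ennreal \<beta> * ennreal (\<bar>v k\<bar> powr p k))"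
    unfolding nakano_modular_def by (rule suminf_le) auto
  also have "\<dots> = (\<Sum>k. ennreal \<alpha> * ennreal (\<bar>u k\<bar> powr p k)) +
      (\<Sum>k. ennreal \<beta> * ennreal (\<bar>v k\<bar> powr p k))"
    by (rule suminf_add[symmetric]) (rule summableI)+
  finally show ?thesis by (simp only: ennreal_suminf_cmult nakano_modular_def)
qed

text \<open>This makes the set in the definition of the norm nonempty. By convexity, shrinking a
  vector by \<open>c \<le> 1\<close> multiplies its modular by at most \<open>c\<close>, so a finite
  modular \<open>M\<close> is brought below one by \<open>c = 1 / (M + 1)\<close>.\<close>

lemma exists_modular_le_1:
  assumes "v \<in> X"
  obtains t where "t > 0" "nakano_modular p (\<lambda>k. v k / t) \<le> 1"
proof -
  from assms obtain s where s: "s > 0" "nakano_modular p (\<lambda>k. v k / s) < \<infinity>"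
    by (auto simp: nakano_space_def)
  define M where "M = enn2real (nakano_modular p (\<lambda>k. v k / s))"
  have M: "nakano_modular p (\<lambda>k. v k / s) = ennreal M" "M \<ge> 0"
    using s by (auto simp: M_def)
  define c where "c = 1 / (M + 1)"
  have c: "0 < c" "c \<le> 1" "c * M \<le> 1" using M by (auto simp: c_def field_simps)
  have "nakano_modular p (\<lambda>k. v k / (s / c)) = nakano_modular p (\<lambda>k. c * (v k / s))"
    by (simp add: mult.commute)
  also have "\<dots> \<le> ennreal c * ennreal M" using modular_scale[of c "\<lambda>k. v k / s"] c M by simp
  also have "\<dots> \<le> 1" using c M by (simp flip: ennreal_mult add: ennreal_le_1)
  finally show ?thesis using that[of "s / c"] s c by simp
qed

lemma norm_set_upward:
  assumes "0 < s" "s \<le> t" "nakano_modular p (\<lambda>k. v k / s) \<le> 1"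
  shows "nakano_modular p (\<lambda>k. v k / t) \<le> 1"
proof -
  have "nakano_modular p (\<lambda>k. v k / t) \<le> nakano_modular p (\<lambda>k. v k / s)"
    using assms by (intro modular_mono) (simp add: divide_left_mono)
  then show ?thesis using assms by simp
qed

lemma norm_le:
  assumes "0 < t" "nakano_modular p (\<lambda>k. v k / t) \<le> 1"
  shows "N v \<le> t"
  unfolding nakano_norm_def using assms by (intro cInf_lower bdd_belowI[of _ 0]) auto

text \<open>The strict inequality yields an admissible scale below \<open>t\<close> directly from
  the infimum, so that attainment of the infimum need not be discussed. Later bounds such as
  \<open>K_x\<close> are kept strict for this reason.\<close>

lemma modular_le_1:
  assumes "v \<in> X" "N v < t"
  shows "nakano_modular p (\<lambda>k. v k / t) \<le> 1"
proof -
  obtain t0 where "t0 > 0" "nakano_modular p (\<lambda>k. v k / t0) \<le> 1"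
    using exists_modular_le_1 assms by blast
  then have "{t. t > 0 \<and> nakano_modular p (\<lambda>k. v k / t) \<le> 1} \<noteq> {}" by auto
  from cInf_lessD[OF this assms(2)[unfolded nakano_norm_def]]
  obtain s where "s < t" "s > 0" "nakano_modular p (\<lambda>k. v k / s) \<le> 1" by auto
  then show ?thesis using norm_set_upward[of s t] by simp
qed

lemma N_nonneg: "v \<in> X \<Longrightarrow> 0 \<le> N v"
  unfolding nakano_norm_def
  by (rule cInf_greatest) (use exists_modular_le_1[of v] in auto)

lemma finite_support_in_X:
  assumes "finite D" "\<And>k. k \<notin> D \<Longrightarrow> v k = 0"
  shows "v \<in> X"
proof -
  have "nakano_modular p v = (\<Sum>k\<in>D. ennreal (\<bar>v k\<bar> powr p k))"
    unfolding nakano_modular_def using assms by (intro suminf_finite) auto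
  then have "nakano_modular p v < \<infinity>" by simp
  then show ?thesis by (auto simp: nakano_space_def intro!: exI[of _ 1])
qed

lemma zero_in_X: "0 \<in> X"
  by (rule finite_support_in_X[of "{}"]) auto

lemma scale_in_X: "c *\<^sub>R v \<in> X" if v: "v \<in> X"
proof (cases "c = 0")
  case True then show ?thesis using zero_in_X by (simp only: scaleR_zero_left)
next
  case False
  obtain t where "t > 0" "nakano_modular p (\<lambda>k. v k / t) \<le> 1"
    using exists_modular_le_1[OF v] by blast
  moreover have "nakano_modular p (\<lambda>k. (c *\<^sub>R v) k / (\<bar>c\<bar> * t)) = nakano_modular p (\<lambda>k. v k / t)"
    using False by (intro antisym modular_mono) (auto simp: fun_vector_apply abs_mult)
  ultimately show ?thesis using False unfolding nakano_space_def
    by (auto intro!: exI[of _ "\<bar>c\<bar> * t"] simp: order_le_less_trans[of _ 1])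
qed

text \<open>The normalised sum is the convex combination of \<open>u / s\<close> and
  \<open>v / t\<close> with weights \<open>s / (s + t)\<close> and \<open>t / (s + t)\<close>; the
  triangle inequality follows by letting \<open>s\<close> and \<open>t\<close> decrease to the
  norms.\<close>

lemma add_modular:
  assumes "0 < s" "0 < t" "nakano_modular p (\<lambda>k. u k / s) \<le> 1" "nakano_modular p (\<lambda>k. v k / t) \<le> 1"
  shows "nakano_modular p (\<lambda>k. (u + v) k / (s + t)) \<le> 1"
proof -
  define \<alpha> \<beta> where "\<alpha> = s / (s + t)" and "\<beta> = t / (s + t)"
  have ab: "0 \<le> \<alpha>" "0 \<le> \<beta>" "\<alpha> + \<beta> = 1"
    using assms by (auto simp: \<alpha>_def \<beta>_def simp flip: add_divide_distrib)
  have "(\<lambda>k. (u + v) k / (s + t)) = (\<lambda>k. \<alpha> * (u k / s) + \<beta> * (v k / t))"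
    using assms by (auto simp: \<alpha>_def \<beta>_def add_divide_distrib)
  then have "nakano_modular p (\<lambda>k. (u + v) k / (s + t)) \<le>
      ennreal \<alpha> * nakano_modular p (\<lambda>k. u k / s) + ennreal \<beta> * nakano_modular p (\<lambda>k. v k / t)"
    using modular_convex[OF ab, of "\<lambda>k. u k / s" "\<lambda>k. v k / t"] by (simp only:)
  also have "\<dots> \<le> ennreal \<alpha> * 1 + ennreal \<beta> * 1"
    using assms by (intro add_mono mult_left_mono) auto
  also have "\<dots> = 1" using ab by (simp flip: ennreal_plus)
  finally show ?thesis .
qed

lemma add_in_X: "u + v \<in> X" if uv: "u \<in> X" "v \<in> X"
proof -
  obtain s t where "s > 0" "nakano_modular p (\<lambda>k. u k / s) \<le> 1"
    "t > 0" "nakano_modular p (\<lambda>k. v k / t) \<le> 1"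
    using exists_modular_le_1[OF uv(1)] exists_modular_le_1[OF uv(2)] by metis
  then show ?thesis using add_modular[of s t u v] unfolding nakano_space_def
    by (auto intro!: exI[of _ "s + t"] simp: order_le_less_trans[of _ 1])
qed

lemma N_triangle: "N (u + v) \<le> N u + N v" if "u \<in> X" "v \<in> X"
proof (rule field_le_epsilon)
  fix e :: real assume "e > 0"
  then have "nakano_modular p (\<lambda>k. u k / (N u + e / 2)) \<le> 1"
    "nakano_modular p (\<lambda>k. v k / (N v + e / 2)) \<le> 1"
    using that by (auto intro!: modular_le_1)
  then have "nakano_modular p (\<lambda>k. (u + v) k / ((N u + e / 2) + (N v + e / 2))) \<le> 1"
    using \<open>e > 0\<close> N_nonneg that by (intro add_modular) (auto intro: add_nonneg_pos)
  then have "N (u + v) \<le> (N u + e / 2) + (N v + e / 2)"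
    using \<open>e > 0\<close> N_nonneg[of u] N_nonneg[of v] that by (intro norm_le) auto
  then show "N (u + v) \<le> N u + N v + e" by simp
qed

lemma N_mono: "N u \<le> N v" if "v \<in> X" "\<And>k. \<bar>u k\<bar> \<le> \<bar>v k\<bar>"
proof (rule field_le_epsilon)
  fix e :: real assume "e > 0"
  then have "nakano_modular p (\<lambda>k. v k / (N v + e)) \<le> 1"
    using that by (auto intro!: modular_le_1)
  moreover have "nakano_modular p (\<lambda>k. u k / (N v + e)) \<le> nakano_modular p (\<lambda>k. v k / (N v + e))"
    using that \<open>e > 0\<close> N_nonneg[of v] by (intro modular_mono) (auto intro: divide_right_mono)
  ultimately show "N u \<le> N v + e"
    using \<open>e > 0\<close> N_nonneg[of v] that by (intro norm_le) auto
qed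

lemma N_scale_le: "N (c *\<^sub>R v) \<le> \<bar>c\<bar> * N v" if "v \<in> X"
proof (cases "c = 0")
  case True
  have "N 0 \<le> e" if "e > 0" for e
    using that by (intro norm_le) (auto simp: nakano_modular_def)
  then have "N 0 \<le> 0" by (meson field_le_epsilon add_0 dense_ge)
  then show ?thesis using True by (simp add: scaleR_zero_left)
next
  case False
  have "N (c *\<^sub>R v) / \<bar>c\<bar> \<le> N v"
  proof (rule field_le_epsilon)
    fix e :: real assume "e > 0"
    then have "nakano_modular p (\<lambda>k. v k / (N v + e)) \<le> 1"
      using that by (auto intro!: modular_le_1)
    moreover have "nakano_modular p (\<lambda>k. (c *\<^sub>R v) k / (\<bar>c\<bar> * (N v + e)))
        \<le> nakano_modular p (\<lambda>k. v k / (N v + e))"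
      using False by (intro modular_mono) (auto simp: fun_vector_apply abs_mult)
    ultimately have "N (c *\<^sub>R v) \<le> \<bar>c\<bar> * (N v + e)"
      using \<open>e > 0\<close> N_nonneg[of v] that False by (intro norm_le) auto
    then show "N (c *\<^sub>R v) / \<bar>c\<bar> \<le> N v + e" using False by (simp add: field_simps)
  qed
  then show ?thesis using False by (simp add: field_simps)
qed

lemma N_scale: "N (c *\<^sub>R v) = \<bar>c\<bar> * N v" if "v \<in> X"
proof (cases "c = 0")
  case True
  then show ?thesis using N_scale_le[OF that, of 0] N_nonneg[OF zero_in_X]
    by (simp add: scaleR_zero_left)
next
  case False
  have "N (inverse c *\<^sub>R (c *\<^sub>R v)) \<le> \<bar>inverse c\<bar> * N (c *\<^sub>R v)"
    by (intro N_scale_le scale_in_X that)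
  moreover have "inverse c *\<^sub>R (c *\<^sub>R v) = v" using False by simp
  ultimately have "N v \<le> \<bar>inverse c\<bar> * N (c *\<^sub>R v)" by simp
  then have "\<bar>c\<bar> * N v \<le> N (c *\<^sub>R v)" using False by (simp add: field_simps)
  then show ?thesis using N_scale_le[OF that, of c] by simp
qed

lemma ennreal_modular_sum:
  assumes "t > 0"
  shows "(\<Sum>k\<in>D. ennreal (\<bar>v k / t\<bar> powr p k)) = ennreal (\<Sum>k\<in>D. (\<bar>v k\<bar> / t) powr p k)"
proof -
  have "\<bar>v k / t\<bar> = \<bar>v k\<bar> / t" for k using assms by simp
  then show ?thesis by (simp only: sum_ennreal powr_ge_zero)
qed

lemma finite_modular_le_1:
  assumes "v \<in> X" "N v < t" "finite D"
  shows "(\<Sum>k\<in>D. (\<bar>v k\<bar> / t) powr p k) \<le> 1"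
proof -
  have t: "t > 0" using assms(2) N_nonneg[OF assms(1)] by linarith
  have "ennreal (\<Sum>k\<in>D. (\<bar>v k\<bar> / t) powr p k) = (\<Sum>k\<in>D. ennreal (\<bar>v k / t\<bar> powr p k))"
    using ennreal_modular_sum[OF t] by (simp only:)
  also have "\<dots> \<le> nakano_modular p (\<lambda>k. v k / t)"
    unfolding nakano_modular_def using assms by (intro sum_le_suminf) auto
  also have "\<dots> \<le> 1" using modular_le_1 assms by blast
  finally show ?thesis by (simp add: ennreal_le_1)
qed

lemma N_leI:
  assumes "t > 0" "\<And>D. finite D \<Longrightarrow> (\<Sum>k\<in>D. (\<bar>v k\<bar> / t) powr p k) \<le> 1"
  shows "N v \<le> t"
proof (rule norm_le[OF assms(1)])
  have "(\<Sum>k<n. ennreal (\<bar>v k / t\<bar> powr p k)) \<le> 1" for n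
  proof -
    have "(\<Sum>k<n. ennreal (\<bar>v k / t\<bar> powr p k)) = ennreal (\<Sum>k<n. (\<bar>v k\<bar> / t) powr p k)"
      using ennreal_modular_sum[OF assms(1)] by (simp only:)
    also have "\<dots> \<le> 1" using assms(2)[of "{..<n}"] by (simp add: ennreal_le_1)
    finally show ?thesis .
  qed
  then show "nakano_modular p (\<lambda>k. v k / t) \<le> 1"
    unfolding nakano_modular_def by (intro suminf_le_const) auto
qed

lemma abs_le_N: "\<bar>v k\<bar> \<le> N v" if "v \<in> X"
proof (rule field_le_epsilon)
  fix e :: real assume e: "e > 0"
  then have t: "N v + e > 0" using N_nonneg[OF that] by simp
  have "(\<bar>v k\<bar> / (N v + e)) powr p k \<le> 1"
    using finite_modular_le_1[of v "N v + e" "{k}"] that e by simp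
  moreover have "1 < (\<bar>v k\<bar> / (N v + e)) powr p k" if "1 < \<bar>v k\<bar> / (N v + e)"
    using that p_ge1[of k] by (intro gr_one_powr) auto
  ultimately have "\<bar>v k\<bar> / (N v + e) \<le> 1" by linarith
  then show "\<bar>v k\<bar> \<le> N v + e" using t by (simp add: field_simps)
qed

section \<open>Finite restrictions, unit vectors and tails\<close>

definition restr :: "nat set \<Rightarrow> (nat \<Rightarrow> real) \<Rightarrow> nat \<Rightarrow> real"
  where "restr D v = (\<lambda>k. if k \<in> D then v k else 0)"

lemma restr_in_X: "finite D \<Longrightarrow> restr D v \<in> X"
  by (rule finite_support_in_X[of D]) (auto simp: restr_def)

lemma N_restr_le:
  assumes "finite D" "t > 0" "(\<Sum>k\<in>D. (\<bar>v k\<bar> / t) powr p k) \<le> 1"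
  shows "N (restr D v) \<le> t"
proof (rule N_leI[OF assms(2)])
  fix E :: "nat set" assume "finite E"
  then have "(\<Sum>k\<in>E. (\<bar>restr D v k\<bar> / t) powr p k) = (\<Sum>k\<in>E \<inter> D. (\<bar>v k\<bar> / t) powr p k)"
    by (intro sum.mono_neutral_cong_right) (auto simp: restr_def)
  also have "\<dots> \<le> (\<Sum>k\<in>D. (\<bar>v k\<bar> / t) powr p k)"
    using assms by (intro sum_mono2) auto
  finally show "(\<Sum>k\<in>E. (\<bar>restr D v k\<bar> / t) powr p k) \<le> 1" using assms by linarith
qed

definition unit :: "nat \<Rightarrow> nat \<Rightarrow> real" where "unit k = (\<lambda>j. if j = k then 1 else 0)"

lemma unit_in_X: "unit k \<in> X"
  by (rule finite_support_in_X[of "{k}"]) (auto simp: unit_def)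

lemma N_unit_le: "N (unit k) \<le> 1"
  using N_restr_le[of "{k}" 1 "\<lambda>_. 1"] by (simp add: restr_def unit_def)

lemma restr_eq_sum: "finite D \<Longrightarrow> restr D v = (\<Sum>k\<in>D. v k *\<^sub>R unit k)"
  by (auto simp: fun_eq_iff fun_vector_apply restr_def unit_def if_distrib[of "(*) _"] cong: if_cong)

text \<open>Bounded exponents give the Delta-2 condition: passing from a scale \<open>t\<close> with
  finite modular to an arbitrary scale \<open>e\<close> costs at most the factor
  \<open>c powr P\<close>. The modular series therefore converges at every scale, and its tails at
  scale \<open>e\<close> drop below one.\<close>

lemma tail_small:
  assumes "v \<in> X" "bdd_above (range p)" "e > 0"
  shows "\<exists>L0. \<forall>L\<ge>L0. N (v - restr {..<L} v) \<le> e"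
proof -
  obtain t where t: "t > 0" "nakano_modular p (\<lambda>k. v k / t) \<le> 1"
    using exists_modular_le_1 assms by blast
  obtain P where P: "\<And>k. p k \<le> P" using assms(2) by (auto simp: bdd_above_def)
  define c where "c = max 1 (t / e)"
  have c: "c \<ge> 1" "t / e \<le> c" by (auto simp: c_def)
  have "summable (\<lambda>k. \<bar>v k / t\<bar> powr p k)"
    using t unfolding nakano_modular_def
    by (intro summable_suminf_not_top) (auto simp: top_unique)
  then have "summable (\<lambda>k. c powr P * \<bar>v k / t\<bar> powr p k)" by (rule summable_mult)
  then have sm: "summable (\<lambda>k. (\<bar>v k\<bar> / e) powr p k)"
  proof (rule summable_comparison_test')
    fix k
    have "(\<bar>v k\<bar> / e) powr p k = (t / e) powr p k * \<bar>v k / t\<bar> powr p k"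
      using assms t by (simp flip: powr_mult)
    also have "\<dots> \<le> c powr P * \<bar>v k / t\<bar> powr p k"
    proof (intro mult_right_mono)
      have "(t / e) powr p k \<le> c powr p k"
        using t assms c p_ge1[of k] by (intro powr_mono2) auto
      also have "\<dots> \<le> c powr P" using c P by (intro powr_mono) auto
      finally show "(t / e) powr p k \<le> c powr P" .
    qed auto
    finally show "norm ((\<bar>v k\<bar> / e) powr p k) \<le> c powr P * \<bar>v k / t\<bar> powr p k" by simp
  qed
  obtain L0 where L0: "\<And>m n. m \<ge> L0 \<Longrightarrow> norm (\<Sum>k\<in>{m..<n}. (\<bar>v k\<bar> / e) powr p k) < 1"
    using sm[unfolded summable_Cauchy] by (metis zero_less_one)
  show ?thesis
  proof (intro exI allI impI N_leI assms)
    fix L D assume L: "L \<ge> L0" and D: "finite (D :: nat set)"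
    then obtain n where n: "D \<subseteq> {..<n}" using finite_nat_iff_bounded by blast
    have "(\<Sum>k\<in>D. (\<bar>(v - restr {..<L} v) k\<bar> / e) powr p k) = (\<Sum>k\<in>D - {..<L}. (\<bar>v k\<bar> / e) powr p k)"
      using D by (intro sum.mono_neutral_cong_right) (auto simp: restr_def fun_vector_apply)
    also have "\<dots> \<le> (\<Sum>k\<in>{L..<n}. (\<bar>v k\<bar> / e) powr p k)"
      using n by (intro sum_mono2) auto
    also have "\<dots> \<le> 1" using L0[of L n] L by (auto dest: abs_less_iff[THEN iffD1])
    finally show "(\<Sum>k\<in>D. (\<bar>(v - restr {..<L} v) k\<bar> / e) powr p k) \<le> 1" .
  qed
qed

end

section \<open>Rademacher averages and Riesz products\<close>

definition sg :: "'i set \<Rightarrow> 'i \<Rightarrow> real" where "sg A i = (if i \<in> A then 1 else -1)"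

text \<open>Expectation over independent uniform signs, where a sign pattern is encoded by the set
  of indices with sign +1. The target is a general vector space because real numbers, complex
  numbers and sequences are all averaged.\<close>

definition rad :: "'i set \<Rightarrow> ('i set \<Rightarrow> 'a) \<Rightarrow> 'a::real_vector"
  where "rad G f = (1 / 2 ^ card G) *\<^sub>R (\<Sum>A\<in>Pow G. f A)"

lemma abs_sg [simp]: "\<bar>sg A i\<bar> = 1" and sg_squared [simp]: "sg A i * sg A i = 1"
  by (auto simp: sg_def)

lemma rad_const: "finite G \<Longrightarrow> rad G (\<lambda>A. c) = c"
  by (simp add: rad_def sum_constant_scaleR card_Pow)

lemma rad_sum: "rad G (\<lambda>A. \<Sum>i\<in>I. f i A) = (\<Sum>i\<in>I. rad G (f i))"
  unfolding rad_def by (subst sum.swap) (simp add: scaleR_sum_right)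

lemma rad_add: "rad G (\<lambda>A. f A + g A) = rad G f + rad G g"
  by (simp add: rad_def sum.distrib scaleR_add_right)

lemma rad_cmult: "rad G (\<lambda>A. c * f A) = c * rad G f" for f :: "_ \<Rightarrow> real"
  by (simp add: rad_def sum_distrib_left)

lemma rad_mult_left: "rad G (\<lambda>A. c * f A) = c * rad G f" for f :: "_ \<Rightarrow> 'a::real_algebra"
  by (simp add: rad_def sum_distrib_left)

lemma rad_mono: "(\<And>A. A \<subseteq> G \<Longrightarrow> f A \<le> g A) \<Longrightarrow> rad G f \<le> rad G g" for f :: "_ \<Rightarrow> real"
  by (auto simp: rad_def intro!: sum_mono divide_right_mono)

lemma rad_le_const:
  "finite G \<Longrightarrow> (\<And>A. A \<subseteq> G \<Longrightarrow> f A \<le> c) \<Longrightarrow> rad G f \<le> c" for f :: "_ \<Rightarrow> real"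
  using rad_mono[of G f "\<lambda>_. c"] by (simp add: rad_const)

lemma norm_rad_le: "norm (rad G f) \<le> rad G (\<lambda>A. norm (f A))"
  by (auto simp: rad_def intro!: norm_sum divide_right_mono)

text \<open>Independence of the signs: the mean of the product is the product of the means. Summing
  over all patterns is the binomial expansion of the product of
  \<open>(\<alpha> i + \<beta> i) + (\<alpha> i - \<beta> i)\<close>. The orthogonality and Riesz
  product identities below are instances.\<close>

lemma rad_prod:
  fixes \<alpha> \<beta> :: "'i \<Rightarrow> 'a::{comm_ring_1,real_algebra_1}"
  assumes "finite G"
  shows "rad G (\<lambda>A. \<Prod>i\<in>G. \<alpha> i + sg A i *\<^sub>R \<beta> i) = (\<Prod>i\<in>G. \<alpha> i)"
proof -
  have "(\<Prod>i\<in>G. \<alpha> i + sg A i *\<^sub>R \<beta> i) = (\<Prod>i\<in>A. \<alpha> i + \<beta> i) * (\<Prod>i\<in>G - A. \<alpha> i - \<beta> i)"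
    if "A \<subseteq> G" for A
  proof -
    have "(\<Prod>i\<in>G. \<alpha> i + sg A i *\<^sub>R \<beta> i)
        = (\<Prod>i\<in>G - A. \<alpha> i + sg A i *\<^sub>R \<beta> i) * (\<Prod>i\<in>A. \<alpha> i + sg A i *\<^sub>R \<beta> i)"
      by (rule prod.subset_diff[OF that assms])
    then show ?thesis by (simp add: sg_def mult.commute)
  qed
  then have "rad G (\<lambda>A. \<Prod>i\<in>G. \<alpha> i + sg A i *\<^sub>R \<beta> i) =
      (1 / 2 ^ card G) *\<^sub>R (\<Sum>A\<in>Pow G. (\<Prod>i\<in>A. \<alpha> i + \<beta> i) * (\<Prod>i\<in>G - A. \<alpha> i - \<beta> i))"
    by (simp add: rad_def)
  also have "\<dots> = (1 / 2 ^ card G) *\<^sub>R (\<Prod>i\<in>G. (\<alpha> i + \<beta> i) + (\<alpha> i - \<beta> i))"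
    by (subst prod_add[OF assms]) simp
  also have "(\<Prod>i\<in>G. (\<alpha> i + \<beta> i) + (\<alpha> i - \<beta> i)) = (\<Prod>i\<in>G. 2 *\<^sub>R \<alpha> i)"
    by (simp add: scaleR_2)
  also have "\<dots> = 2 ^ card G *\<^sub>R (\<Prod>i\<in>G. \<alpha> i)"
    by (simp add: scaleR_conv_of_real prod.distrib del: of_real_numeral)
  finally show ?thesis by simp
qed

lemma rad_sg_sg:
  assumes "finite G" "i \<in> G" "j \<in> G"
  shows "rad G (\<lambda>A. sg A i * sg A j) = (if i = j then 1 else 0)"
proof (cases "i = j")
  case False
  define \<alpha> \<beta> :: "_ \<Rightarrow> real" where "\<alpha> = (\<lambda>k. if k \<in> {i, j} then 0 else 1)"
    and "\<beta> = (\<lambda>k. if k \<in> {i, j} then 1 else 0)"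
  have "(\<Prod>k\<in>G. \<alpha> k + sg A k *\<^sub>R \<beta> k) = (\<Prod>k\<in>{i, j}. sg A k)" for A
    using assms by (intro prod.mono_neutral_cong_right) (auto simp: \<alpha>_def \<beta>_def)
  then have "rad G (\<lambda>A. sg A i * sg A j) = (\<Prod>k\<in>G. \<alpha> k)"
    using False rad_prod[OF assms(1), of \<alpha> \<beta>] by simp
  also have "\<dots> = 0" using assms by (auto simp: \<alpha>_def)
  finally show ?thesis using False by simp
qed (use assms in \<open>simp add: rad_const\<close>)

text \<open>Since the sign squares to one, multiplying by \<open>sg A i\<close> turns the factor
  \<open>1 + sg A i *\<^sub>R w i\<close> into \<open>w i + sg A i\<close>, whose mean is
  \<open>w i\<close>. Riesz products thus read off first-order coefficients.\<close>

lemma rad_sg_riesz: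
  fixes w :: "'i \<Rightarrow> 'a::{comm_ring_1,real_algebra_1}"
  assumes "finite G" "i \<in> G"
  shows "rad G (\<lambda>A. sg A i *\<^sub>R (\<Prod>k\<in>G. 1 + sg A k *\<^sub>R w k)) = w i"
proof -
  define \<alpha> \<beta> where "\<alpha> = (\<lambda>k. if k = i then w k else 1)" and "\<beta> = (\<lambda>k. if k = i then 1 else w k)"
  have "sg A i *\<^sub>R (\<Prod>k\<in>G. 1 + sg A k *\<^sub>R w k) = (\<Prod>k\<in>G. \<alpha> k + sg A k *\<^sub>R \<beta> k)" for A
  proof -
    have "sg A i *\<^sub>R (\<Prod>k\<in>G. 1 + sg A k *\<^sub>R w k)
        = (sg A i *\<^sub>R (1 + sg A i *\<^sub>R w i)) * (\<Prod>k\<in>G - {i}. 1 + sg A k *\<^sub>R w k)"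
      by (simp only: prod.remove[OF assms] mult_scaleR_left)
    also have "sg A i *\<^sub>R (1 + sg A i *\<^sub>R w i) = \<alpha> i + sg A i *\<^sub>R \<beta> i"
      by (simp add: \<alpha>_def \<beta>_def scaleR_add_right)
    also have "(\<Prod>k\<in>G - {i}. 1 + sg A k *\<^sub>R w k) = (\<Prod>k\<in>G - {i}. \<alpha> k + sg A k *\<^sub>R \<beta> k)"
      by (intro prod.cong) (auto simp: \<alpha>_def \<beta>_def)
    finally show ?thesis by (simp only: prod.remove[OF assms])
  qed
  then have "rad G (\<lambda>A. sg A i *\<^sub>R (\<Prod>k\<in>G. 1 + sg A k *\<^sub>R w k)) = (\<Prod>k\<in>G. \<alpha> k)"
    using rad_prod[OF assms(1), of \<alpha> \<beta>] by simp
  also have "\<dots> = w i" by (subst prod.remove[OF assms]) (simp add: \<alpha>_def)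
  finally show ?thesis .
qed

lemma rad_sum_riesz:
  fixes w z :: "'i \<Rightarrow> 'a::{comm_ring_1,real_algebra_1}"
  assumes "finite G"
  shows "rad G (\<lambda>A. (\<Sum>i\<in>G. sg A i *\<^sub>R z i) * (\<Prod>k\<in>G. 1 + sg A k *\<^sub>R w k)) = (\<Sum>i\<in>G. z i * w i)"
proof -
  have "rad G (\<lambda>A. (\<Sum>i\<in>G. sg A i *\<^sub>R z i) * (\<Prod>k\<in>G. 1 + sg A k *\<^sub>R w k))
     = rad G (\<lambda>A. \<Sum>i\<in>G. z i * (sg A i *\<^sub>R (\<Prod>k\<in>G. 1 + sg A k *\<^sub>R w k)))"
    by (simp add: sum_distrib_right)
  also have "\<dots> = (\<Sum>i\<in>G. z i * w i)"
    by (simp add: rad_sum rad_mult_left rad_sg_riesz assms del: mult_scaleR_right)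
  finally show ?thesis .
qed

lemma rad_riesz:
  fixes w :: "'i \<Rightarrow> 'a::{comm_ring_1,real_algebra_1}"
  assumes "finite G"
  shows "rad G (\<lambda>A. \<Prod>k\<in>G. 1 + sg A k *\<^sub>R w k) = 1"
  using rad_prod[OF assms, of "\<lambda>_. 1" w] by simp

section \<open>Riesz product estimates and Khinchin's inequality\<close>

lemma prod_1_plus_le_exp: "(\<Prod>k\<in>G. 1 + y k) \<le> exp (\<Sum>k\<in>G. y k)"
  if "finite G" "\<And>k. k \<in> G \<Longrightarrow> 0 \<le> y k" for y :: "'i \<Rightarrow> real"
  unfolding exp_sum[OF that(1)] by (intro prod_mono) (use that in \<open>auto simp: exp_ge_add_one_self\<close>)

lemma rad_riesz_squared:
  fixes w :: "'i \<Rightarrow> real"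
  assumes "finite G"
  shows "rad G (\<lambda>A. (\<Prod>k\<in>G. 1 + sg A k * w k)\<^sup>2) = (\<Prod>k\<in>G. 1 + (w k)\<^sup>2)"
proof -
  have "(\<Prod>k\<in>G. 1 + sg A k * w k)\<^sup>2 = (\<Prod>k\<in>G. (1 + (w k)\<^sup>2) + sg A k *\<^sub>R (2 * w k))" for A
    unfolding prod_power_distrib
    by (intro prod.cong) (auto simp: sg_def power2_eq_square algebra_simps)
  then show ?thesis using rad_prod[OF assms, of "\<lambda>k. 1 + (w k)\<^sup>2" "\<lambda>k. 2 * w k"] by simp
qed

text \<open>Testing against the complex Riesz product \<open>\<Prod>\<^sub>k (1 + \<i> \<epsilon>\<^sub>k z\<^sub>k / \<parallel>z\<parallel>)\<close>, whose modulus is at most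
  \<open>exp (1/2)\<close>, gives the \<open>L\<^sub>1\<close> Khinchin inequality without fourth moments.\<close>

lemma khinchin:
  fixes z :: "'i \<Rightarrow> real"
  assumes "finite G"
  shows "sqrt (\<Sum>i\<in>G. (z i)\<^sup>2) \<le> 2 * rad G (\<lambda>A. \<bar>\<Sum>i\<in>G. sg A i * z i\<bar>)"
proof -
  define \<tau> where "\<tau> = sqrt (\<Sum>i\<in>G. (z i)\<^sup>2)"
  have \<tau>2: "\<tau>\<^sup>2 = (\<Sum>i\<in>G. (z i)\<^sup>2)" and \<tau>0: "0 \<le> \<tau>" by (auto simp: \<tau>_def sum_nonneg)
  have nonneg: "0 \<le> rad G (\<lambda>A. \<bar>\<Sum>i\<in>G. sg A i * z i\<bar>)" by (simp add: rad_def sum_nonneg)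
  show ?thesis
  proof (cases "\<tau> = 0")
    case False
    then have "\<tau> > 0" using \<tau>0 by simp
    define w where "w = (\<lambda>i. \<i> * complex_of_real (z i / \<tau>))"
    define R where "R = (\<lambda>A. \<Prod>k\<in>G. 1 + sg A k *\<^sub>R w k)"
    have R: "norm (R A) \<le> 2" for A
    proof -
      have "(norm (1 + sg A k *\<^sub>R w k))\<^sup>2 = 1 + (z k / \<tau>)\<^sup>2" for k
        by (auto simp: w_def cmod_power2 sg_def)
      then have "(norm (R A))\<^sup>2 = (\<Prod>k\<in>G. 1 + (z k / \<tau>)\<^sup>2)"
        unfolding R_def prod_norm[symmetric] prod_power_distrib by simp
      also have "\<dots> \<le> exp (\<Sum>k\<in>G. (z k / \<tau>)\<^sup>2)" using assms by (intro prod_1_plus_le_exp) auto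
      also have "(\<Sum>k\<in>G. (z k / \<tau>)\<^sup>2) = 1"
        using \<open>\<tau> > 0\<close> by (simp add: power_divide \<tau>2[symmetric] flip: sum_divide_distrib)
      also have "exp (1 :: real) \<le> 2\<^sup>2" using exp_le by simp
      finally show ?thesis by (rule power2_le_imp_le) simp
    qed
    have "\<i> * complex_of_real \<tau> = (\<Sum>i\<in>G. complex_of_real (z i) * w i)"
    proof -
      have "(\<Sum>i\<in>G. complex_of_real (z i) * w i) = \<i> * complex_of_real ((\<Sum>i\<in>G. (z i)\<^sup>2) / \<tau>)"
        by (simp add: w_def sum_distrib_left sum_divide_distrib power2_eq_square mult_ac)
      also have "(\<Sum>i\<in>G. (z i)\<^sup>2) / \<tau> = \<tau>"
        unfolding \<tau>2[symmetric] using \<open>\<tau> > 0\<close> by (simp add: power2_eq_square)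
      finally show ?thesis by simp
    qed
    also have "\<dots> = rad G (\<lambda>A. (\<Sum>i\<in>G. sg A i *\<^sub>R complex_of_real (z i)) * R A)"
      unfolding R_def by (rule rad_sum_riesz[symmetric, OF assms])
    finally have "\<tau> = norm (rad G (\<lambda>A. (\<Sum>i\<in>G. sg A i *\<^sub>R complex_of_real (z i)) * R A))"
      using \<tau>0 by (metis norm_ii norm_mult mult_1 norm_of_real abs_of_nonneg)
    also have "\<dots> \<le> rad G (\<lambda>A. norm ((\<Sum>i\<in>G. sg A i *\<^sub>R complex_of_real (z i)) * R A))"
      by (rule norm_rad_le)
    also have "\<dots> \<le> rad G (\<lambda>A. 2 * \<bar>\<Sum>i\<in>G. sg A i * z i\<bar>)"
    proof (rule rad_mono)
      fix A
      have "(\<Sum>i\<in>G. sg A i *\<^sub>R complex_of_real (z i)) = of_real (\<Sum>i\<in>G. sg A i * z i)"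
        by (simp add: scaleR_conv_of_real)
      then have "norm (\<Sum>i\<in>G. sg A i *\<^sub>R complex_of_real (z i)) = \<bar>\<Sum>i\<in>G. sg A i * z i\<bar>"
        by (simp only: norm_of_real)
      then show "norm ((\<Sum>i\<in>G. sg A i *\<^sub>R complex_of_real (z i)) * R A) \<le> 2 * \<bar>\<Sum>i\<in>G. sg A i * z i\<bar>"
        using mult_left_mono[OF R[of A], of "\<bar>\<Sum>i\<in>G. sg A i * z i\<bar>"] by (simp add: norm_mult mult.commute)
    qed
    finally show ?thesis by (simp add: rad_cmult \<tau>_def)
  qed (use nonneg in \<open>simp add: \<tau>_def\<close>)
qed

text \<open>The right-hand side is the tangent at \<open>T\<close> of the concave function
  \<open>h powr s\<close>. Multiplied by \<open>h\<close>, it bounds \<open>h powr (1 + s)\<close>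
  by a combination of \<open>h\<close> and its square, both of which have computable means for Riesz
  products.\<close>

lemma powr_le_tangent:
  fixes h T s :: real
  assumes "0 \<le> h" "0 < T" "0 \<le> s" "s \<le> 1"
  shows "h powr s \<le> T powr s * (1 - s + s * h / T)"
proof (cases "h = 0")
  case False
  have "(h / T) powr s * 1 powr (1 - s) \<le> s * (h / T) + (1 - s) * 1"
    using assms False by (intro Youngs_inequality_0) auto
  then have "T powr s * (h / T) powr s \<le> T powr s * (s * (h / T) + (1 - s))"
    by (intro mult_left_mono) auto
  then show ?thesis using assms by (simp add: powr_divide add.commute)
qed (use assms in auto)

text \<open>Interpolation between two moments: the Riesz product is nonnegative, has mean one and
  second moment at most \<open>exp S\<close>, so its moment of order \<open>q\<close> is at most
  \<open>exp S powr (q - 1)\<close>.\<close>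

lemma rad_riesz_powr:
  fixes w :: "'i \<Rightarrow> real"
  assumes "finite G" and w: "\<And>k. k \<in> G \<Longrightarrow> \<bar>w k\<bar> \<le> 1" and S: "(\<Sum>k\<in>G. (w k)\<^sup>2) \<le> S"
    and q: "1 \<le> q" "q \<le> 2" and small: "exp S powr (q - 1) \<le> 2"
  shows "rad G (\<lambda>A. (\<Prod>k\<in>G. 1 + sg A k * w k) powr q) \<le> 2"
proof -
  define h where "h = (\<lambda>A. \<Prod>k\<in>G. 1 + sg A k * w k)"
  \<comment> \<open>Taking the tangent at the second moment bound makes the averaged tangent factor
    equal to \<open>(1 - s) + s = 1\<close>, which leaves just \<open>T powr s\<close>.\<close>
  define T where "T = exp S"
  define s where "s = q - 1"
  have T: "T > 0" and s: "0 \<le> s" "s \<le> 1" using q by (auto simp: T_def s_def)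
  have h0: "0 \<le> h A" for A
    unfolding h_def
  proof (rule prod_nonneg)
    fix k assume "k \<in> G"
    then have "\<bar>sg A k * w k\<bar> \<le> 1" using w[of k] by (simp add: abs_mult)
    then show "0 \<le> 1 + sg A k * w k" by linarith
  qed
  have h1: "rad G h = 1" using rad_riesz[OF assms(1), of w] by (simp add: h_def)
  have h2: "rad G (\<lambda>A. (h A)\<^sup>2) \<le> T"
  proof -
    have "rad G (\<lambda>A. (h A)\<^sup>2) = (\<Prod>k\<in>G. 1 + (w k)\<^sup>2)"
      unfolding h_def by (rule rad_riesz_squared[OF assms(1)])
    also have "\<dots> \<le> exp (\<Sum>k\<in>G. (w k)\<^sup>2)" using assms(1) by (intro prod_1_plus_le_exp) auto
    finally show ?thesis using S by (simp add: T_def order_trans)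
  qed
  have "rad G (\<lambda>A. h A powr q) \<le> rad G (\<lambda>A. T powr s * ((1 - s) * h A + s / T * (h A)\<^sup>2))"
  proof (rule rad_mono)
    fix A
    have "h A powr q = h A * h A powr s"
      using h0[of A] by (cases "h A = 0") (auto simp: s_def powr_diff)
    also have "\<dots> \<le> h A * (T powr s * (1 - s + s * h A / T))"
      using powr_le_tangent[OF h0 T s] h0 by (intro mult_left_mono) auto
    also have "\<dots> = T powr s * ((1 - s) * h A + s / T * (h A)\<^sup>2)"
      by (simp add: algebra_simps power2_eq_square)
    finally show "h A powr q \<le> T powr s * ((1 - s) * h A + s / T * (h A)\<^sup>2)" .
  qed
  also have "\<dots> = T powr s * ((1 - s) * rad G h + s / T * rad G (\<lambda>A. (h A)\<^sup>2))"
    by (simp only: rad_add rad_cmult)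
  also have "\<dots> \<le> T powr s * ((1 - s) * 1 + s / T * T)"
    using h1 h2 s T by (intro mult_left_mono add_mono) auto
  also have "\<dots> = T powr s" using T by simp
  also have "\<dots> \<le> 2" using small by (simp add: T_def s_def)
  finally show ?thesis by (simp add: h_def)
qed

section \<open>Greedy bases\<close>

locale seminormed_subspace =
  fixes S :: "'a::real_vector set" and nrm :: "'a \<Rightarrow> real"
  assumes zero_in: "0 \<in> S"
    and add_in: "\<And>u v. u \<in> S \<Longrightarrow> v \<in> S \<Longrightarrow> u + v \<in> S"
    and scale_in: "\<And>c v. v \<in> S \<Longrightarrow> c *\<^sub>R v \<in> S"
    and nrm_nonneg: "\<And>v. v \<in> S \<Longrightarrow> 0 \<le> nrm v"
    and nrm_add: "\<And>u v. u \<in> S \<Longrightarrow> v \<in> S \<Longrightarrow> nrm (u + v) \<le> nrm u + nrm v"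
    and nrm_scale: "\<And>c v. v \<in> S \<Longrightarrow> nrm (c *\<^sub>R v) = \<bar>c\<bar> * nrm v"
begin

lemma nrm_zero: "nrm 0 = 0"
  using nrm_scale[OF zero_in, of 0] by simp

lemma minus_in: "v \<in> S \<Longrightarrow> - v \<in> S"
  using scale_in[of v "-1"] by simp

lemma nrm_minus: "v \<in> S \<Longrightarrow> nrm (- v) = nrm v"
  using nrm_scale[of v "-1"] by simp

lemma diff_in: "u \<in> S \<Longrightarrow> v \<in> S \<Longrightarrow> u - v \<in> S"
  using add_in[of u "- v"] minus_in by simp

lemma nrm_diff: "u \<in> S \<Longrightarrow> v \<in> S \<Longrightarrow> nrm (u - v) \<le> nrm u + nrm v"
  using nrm_add[of u "- v"] minus_in[of v] nrm_minus[of v] by simp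

lemma sum_in: "(\<And>i. i \<in> A \<Longrightarrow> f i \<in> S) \<Longrightarrow> (\<Sum>i\<in>A. f i) \<in> S"
  by (induction A rule: infinite_finite_induct) (auto simp: zero_in add_in)

lemma nrm_sum: "(\<And>i. i \<in> A \<Longrightarrow> f i \<in> S) \<Longrightarrow> nrm (\<Sum>i\<in>A. f i) \<le> (\<Sum>i\<in>A. nrm (f i))"
proof (induction A rule: infinite_finite_induct)
  case (insert a A)
  then show ?case using nrm_add[of "f a" "\<Sum>i\<in>A. f i"] sum_in[of A f] by auto
qed (auto simp: nrm_zero)

lemma rad_in: "(\<And>A. A \<subseteq> G \<Longrightarrow> f A \<in> S) \<Longrightarrow> rad G f \<in> S"
  unfolding rad_def by (intro scale_in sum_in) auto

lemma nrm_rad: "(\<And>A. A \<subseteq> G \<Longrightarrow> f A \<in> S) \<Longrightarrow> nrm (rad G f) \<le> rad G (\<lambda>A. nrm (f A))"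
proof -
  assume f: "\<And>A. A \<subseteq> G \<Longrightarrow> f A \<in> S"
  have "nrm (rad G f) = 1 / 2 ^ card G * nrm (\<Sum>A\<in>Pow G. f A)"
    unfolding rad_def using f by (subst nrm_scale) (auto intro!: sum_in)
  also have "\<dots> \<le> 1 / 2 ^ card G * (\<Sum>A\<in>Pow G. nrm (f A))"
    using f by (intro mult_left_mono nrm_sum) auto
  finally show ?thesis by (simp add: rad_def)
qed

end

section \<open>Coordinates, unconditionality and democracy of greedy bases\<close>

locale greedy_system = seminormed_subspace S nrm
  for S :: "'a::real_vector set" and nrm :: "'a \<Rightarrow> real" +
  fixes x :: "nat \<Rightarrow> 'a" and C \<kappa> :: real
  assumes schauder: "schauder_basis S nrm x"
    and \<kappa>: "0 < \<kappa>" "\<And>n. \<kappa> \<le> nrm (x n)"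
    and C: "1 \<le> C"
    and greedy: "\<And>v \<Lambda>. v \<in> S \<Longrightarrow> finite \<Lambda> \<Longrightarrow> greedy_set nrm x v \<Lambda> \<Longrightarrow>
      nrm (v - (\<Sum>n\<in>\<Lambda>. coord nrm x n v *\<^sub>R x n)) \<le> C * best_approx_error nrm x (card \<Lambda>) v"
begin

abbreviation cf :: "nat \<Rightarrow> 'a \<Rightarrow> real" where "cf \<equiv> coord nrm x"

lemma x_in: "x n \<in> S"
  using schauder by (auto simp: schauder_basis_def)

lemma combination_in: "(\<Sum>n\<in>A. c n *\<^sub>R x n) \<in> S"
  by (intro sum_in scale_in x_in)

lemma expansion_cf: "v \<in> S \<Longrightarrow> expansion nrm x v (\<lambda>n. cf n v)"
  using schauder theI'[of "expansion nrm x v"] by (auto simp: schauder_basis_def coord_def)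

lemma cf_eqI: "v \<in> S \<Longrightarrow> expansion nrm x v a \<Longrightarrow> cf n v = a n"
  using schauder the1_equality[of "expansion nrm x v" a] by (auto simp: schauder_basis_def coord_def)

lemma cf_add: "cf n (u + v) = cf n u + cf n v" if "u \<in> S" "v \<in> S"
proof (rule cf_eqI[OF add_in[OF that]])
  let ?u = "\<lambda>N. u - (\<Sum>n<N. cf n u *\<^sub>R x n)" and ?v = "\<lambda>N. v - (\<Sum>n<N. cf n v *\<^sub>R x n)"
  have in_S: "?u N \<in> S" "?v N \<in> S" for N using that by (auto intro!: diff_in combination_in)
  have lim: "(\<lambda>N. nrm (?u N) + nrm (?v N)) \<longlonglongrightarrow> 0"
    using tendsto_add[OF expansion_cf[OF that(1), unfolded expansion_def]
        expansion_cf[OF that(2), unfolded expansion_def]] by simp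
  have eq: "u + v - (\<Sum>n<N. (cf n u + cf n v) *\<^sub>R x n) = ?u N + ?v N" for N
    by (simp add: scaleR_add_left sum.distrib)
  show "expansion nrm x (u + v) (\<lambda>n. cf n u + cf n v)"
    unfolding expansion_def eq
    by (rule tendsto_sandwich[OF _ _ tendsto_const lim])
      (intro always_eventually allI nrm_nonneg nrm_add add_in in_S)+
qed

lemma cf_scale: "cf n (c *\<^sub>R v) = c * cf n v" if "v \<in> S"
proof (rule cf_eqI[OF scale_in[OF that]])
  let ?v = "\<lambda>N. v - (\<Sum>n<N. cf n v *\<^sub>R x n)"
  have in_S: "?v N \<in> S" for N using that by (auto intro!: diff_in combination_in)
  have eq: "c *\<^sub>R v - (\<Sum>n<N. (c * cf n v) *\<^sub>R x n) = c *\<^sub>R ?v N" for N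
    by (simp add: scaleR_diff_right scaleR_sum_right)
  show "expansion nrm x (c *\<^sub>R v) (\<lambda>n. c * cf n v)"
    unfolding expansion_def eq nrm_scale[OF in_S]
    using tendsto_mult_right_zero[OF expansion_cf[OF that, unfolded expansion_def]] .
qed

lemma cf_combination:
  assumes "finite A"
  shows "cf n (\<Sum>i\<in>A. c i *\<^sub>R x i) = (if n \<in> A then c n else 0)"
proof -
  let ?v = "\<Sum>i\<in>A. c i *\<^sub>R x i" and ?a = "\<lambda>n. if n \<in> A then c n else 0"
  obtain M where M: "A \<subseteq> {..<M}" using assms finite_nat_iff_bounded by blast
  have "nrm (?v - (\<Sum>i<N. ?a i *\<^sub>R x i)) = 0" if "N \<ge> M" for N
  proof -
    have "(\<Sum>i<N. ?a i *\<^sub>R x i) = ?v"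
      using M that by (intro sum.mono_neutral_cong_right) auto
    then show ?thesis by (simp add: nrm_zero)
  qed
  then have "expansion nrm x ?v ?a" unfolding expansion_def
    by (intro tendsto_eventually) (auto simp: eventually_sequentially)
  then show ?thesis by (intro cf_eqI combination_in)
qed

lemma cf_x: "cf n (x m) = (if n = m then 1 else 0)"
  using cf_combination[of "{m}" n "\<lambda>_. 1"] by simp

lemma cf_sum: "cf n (\<Sum>i\<in>I. f i) = (\<Sum>i\<in>I. cf n (f i))" if "\<And>i. i \<in> I \<Longrightarrow> f i \<in> S"
  using that
proof (induction I rule: infinite_finite_induct)
  case (insert i I)
  then show ?case by (simp add: cf_add sum_in)
qed (use cf_combination[of "{}"] in auto)

text \<open>Consecutive remainders of the expansion differ by \<open>cf n v *\<^sub>R x n\<close>,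
  and the remainders are bounded because they converge. The bound depends on \<open>v\<close>; it
  supplies the common value used in \<open>complement_projection_bound\<close>, from which the
  uniform estimate \<open>cf_bound\<close> follows.\<close>

lemma cf_bounded:
  assumes "v \<in> S"
  obtains M where "\<And>n. \<bar>cf n v\<bar> \<le> M"
proof -
  let ?r = "\<lambda>N. v - (\<Sum>n<N. cf n v *\<^sub>R x n)"
  have in_S: "?r N \<in> S" for N using assms by (auto intro!: diff_in combination_in)
  have "Bseq (\<lambda>N. nrm (?r N))"
    using expansion_cf[OF assms] unfolding expansion_def
    by (intro convergent_imp_Bseq convergentI)
  then obtain B where B: "\<And>N. \<bar>nrm (?r N)\<bar> \<le> B" unfolding Bseq_def by auto
  have "\<bar>cf n v\<bar> \<le> 2 * B / \<kappa>" for n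
  proof -
    have "\<bar>cf n v\<bar> * \<kappa> \<le> \<bar>cf n v\<bar> * nrm (x n)" using \<kappa> by (intro mult_left_mono) auto
    also have "\<dots> = nrm (cf n v *\<^sub>R x n)" by (simp add: nrm_scale x_in)
    also have "cf n v *\<^sub>R x n = ?r n - ?r (Suc n)" by simp
    also have "nrm (?r n - ?r (Suc n)) \<le> nrm (?r n) + nrm (?r (Suc n))" by (intro nrm_diff in_S)
    also have "\<dots> \<le> 2 * B" using B[of n] B[of "Suc n"] by simp
    finally show ?thesis using \<kappa> by (simp add: field_simps)
  qed
  then show ?thesis using that by blast
qed

lemma greedy_le:
  assumes "v \<in> S" "finite \<Lambda>" "greedy_set nrm x v \<Lambda>" "finite A" "card A = card \<Lambda>"
  shows "nrm (v - (\<Sum>n\<in>\<Lambda>. cf n v *\<^sub>R x n)) \<le> C * nrm (v - (\<Sum>n\<in>A. \<alpha> n *\<^sub>R x n))"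
proof -
  have "best_approx_error nrm x (card \<Lambda>) v \<le> nrm (v - (\<Sum>n\<in>A. \<alpha> n *\<^sub>R x n))"
    unfolding best_approx_error_def
  proof (rule cInf_lower)
    show "bdd_below {nrm (v - (\<Sum>n\<in>A. \<alpha> n *\<^sub>R x n)) | A \<alpha>. finite A \<and> card A = card \<Lambda>}"
      using assms(1) by (intro bdd_belowI[of _ 0]) (auto intro!: nrm_nonneg diff_in combination_in)
  qed (use assms in blast)
  then show ?thesis
    using greedy[OF assms(1-3)] C
      mult_left_mono[of "best_approx_error nrm x (card \<Lambda>) v" "nrm (v - (\<Sum>n\<in>A. \<alpha> n *\<^sub>R x n))" C]
    by linarith
qed

text \<open>Raising the coefficients of \<open>v\<close> on \<open>A\<close> to a large common value makes \<open>A\<close> a greedy set of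
  the modified vector, from which \<open>v\<close> itself is one \<open>card A\<close>-term approximation away.\<close>

lemma complement_projection_bound:
  assumes "v \<in> S" "finite A"
  shows "nrm (v - (\<Sum>n\<in>A. cf n v *\<^sub>R x n)) \<le> C * nrm v"
proof -
  obtain M where M: "\<And>n. \<bar>cf n v\<bar> \<le> M" using cf_bounded[OF assms(1)] by blast
  define y where "y = v + (\<Sum>n\<in>A. (M - cf n v) *\<^sub>R x n)"
  have y_in: "y \<in> S" unfolding y_def by (intro add_in assms combination_in)
  have cf_y: "cf n y = (if n \<in> A then M else cf n v)" for n
    using assms unfolding y_def by (simp add: cf_add combination_in cf_combination)
  have "greedy_set nrm x y A" unfolding greedy_set_def cf_y using M
    by (auto intro: order_trans[OF _ abs_ge_self])
  then have "nrm (y - (\<Sum>n\<in>A. cf n y *\<^sub>R x n)) \<le> C * nrm (y - (\<Sum>n\<in>A. (M - cf n v) *\<^sub>R x n))"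
    using assms y_in by (intro greedy_le) auto
  moreover have "y - (\<Sum>n\<in>A. cf n y *\<^sub>R x n) = v - (\<Sum>n\<in>A. cf n v *\<^sub>R x n)"
    unfolding cf_y by (simp add: y_def scaleR_diff_left sum_subtractf)
  moreover have "y - (\<Sum>n\<in>A. (M - cf n v) *\<^sub>R x n) = v" by (simp add: y_def)
  ultimately show ?thesis by simp
qed

lemma projection_bound:
  assumes "v \<in> S" "finite A"
  shows "nrm (\<Sum>n\<in>A. cf n v *\<^sub>R x n) \<le> 2 * C * nrm v"
proof -
  let ?P = "\<Sum>n\<in>A. cf n v *\<^sub>R x n"
  have "nrm (v - (v - ?P)) \<le> nrm v + nrm (v - ?P)"
    by (intro nrm_diff diff_in assms combination_in)
  also have "\<dots> \<le> C * nrm v + C * nrm v"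
    using complement_projection_bound[OF assms] C mult_right_mono[OF C nrm_nonneg[OF assms(1)]] by simp
  finally show ?thesis by simp
qed

text \<open>A change of signs is the difference of two coordinate projections, onto the indices with
  sign +1 and onto those with sign -1.\<close>

lemma unconditional:
  assumes "v \<in> S" "finite A" and s: "\<And>n. n \<in> A \<Longrightarrow> s n = 1 \<or> s n = -1"
  shows "nrm (\<Sum>n\<in>A. (s n * cf n v) *\<^sub>R x n) \<le> 4 * C * nrm v"
proof -
  let ?A1 = "{n\<in>A. s n = 1}" and ?A2 = "{n\<in>A. s n \<noteq> 1}"
  have "(\<Sum>n\<in>A. (s n * cf n v) *\<^sub>R x n) =
      (\<Sum>n\<in>?A1. (s n * cf n v) *\<^sub>R x n) + (\<Sum>n\<in>?A2. (s n * cf n v) *\<^sub>R x n)"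
    using assms by (subst sum.union_disjoint[symmetric]) (auto intro!: sum.cong)
  also have "\<dots> = (\<Sum>n\<in>?A1. cf n v *\<^sub>R x n) + (\<Sum>n\<in>?A2. - (cf n v *\<^sub>R x n))"
    using s by (intro arg_cong2[of _ _ _ _ "(+)"] sum.cong) (auto dest!: s)
  also have "\<dots> = (\<Sum>n\<in>?A1. cf n v *\<^sub>R x n) - (\<Sum>n\<in>?A2. cf n v *\<^sub>R x n)"
    by (simp add: sum_negf)
  also have "nrm \<dots> \<le> nrm (\<Sum>n\<in>?A1. cf n v *\<^sub>R x n) + nrm (\<Sum>n\<in>?A2. cf n v *\<^sub>R x n)"
    by (intro nrm_diff combination_in)
  also have "\<dots> \<le> 2 * C * nrm v + 2 * C * nrm v"
    using assms by (intro add_mono projection_bound) auto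
  finally show ?thesis by simp
qed

lemma cf_bound:
  assumes "v \<in> S"
  shows "\<bar>cf n v\<bar> \<le> 2 * C / \<kappa> * nrm v"
proof -
  have "\<bar>cf n v\<bar> * \<kappa> \<le> \<bar>cf n v\<bar> * nrm (x n)" using \<kappa> by (intro mult_left_mono) auto
  also have "\<dots> = nrm (\<Sum>n\<in>{n}. cf n v *\<^sub>R x n)" by (simp add: nrm_scale x_in)
  also have "\<dots> \<le> 2 * C * nrm v" by (intro projection_bound assms) auto
  finally show ?thesis using \<kappa> by (simp add: field_simps)
qed

text \<open>All nonzero coefficients of \<open>y\<close> have modulus one, so \<open>A\<close> is a
  greedy set of \<open>y\<close> while \<open>B\<close> is a competitor of the same size. Removing
  \<open>A\<close> leaves the sum over \<open>B\<close>, and removing \<open>B\<close> leaves the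
  sum over \<open>A\<close>.\<close>

lemma democracy:
  assumes "finite A" "finite B" "A \<inter> B = {}" "card A = card B"
    and "\<And>n. n \<in> A \<union> B \<Longrightarrow> \<bar>s n\<bar> = 1"
  shows "nrm (\<Sum>n\<in>B. s n *\<^sub>R x n) \<le> C * nrm (\<Sum>n\<in>A. s n *\<^sub>R x n)"
proof -
  define y where "y = (\<Sum>n\<in>A \<union> B. s n *\<^sub>R x n)"
  have y: "y = (\<Sum>n\<in>A. s n *\<^sub>R x n) + (\<Sum>n\<in>B. s n *\<^sub>R x n)"
    unfolding y_def using assms by (intro sum.union_disjoint) auto
  have cf_y: "cf n y = (if n \<in> A \<union> B then s n else 0)" for n
    unfolding y_def using assms by (intro cf_combination) auto
  have "nrm (y - (\<Sum>n\<in>A. cf n y *\<^sub>R x n)) \<le> C * nrm (y - (\<Sum>n\<in>B. s n *\<^sub>R x n))"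
    using assms by (intro greedy_le) (auto simp: greedy_set_def cf_y, simp add: y_def combination_in)
  moreover have "y - (\<Sum>n\<in>A. cf n y *\<^sub>R x n) = (\<Sum>n\<in>B. s n *\<^sub>R x n)"
    unfolding cf_y using y by simp
  moreover have "y - (\<Sum>n\<in>B. s n *\<^sub>R x n) = (\<Sum>n\<in>A. s n *\<^sub>R x n)" using y by simp
  ultimately show ?thesis by simp
qed

end

sublocale nakano \<subseteq> seminormed_subspace X N
  by unfold_locales (fact zero_in_X add_in_X scale_in_X N_nonneg N_triangle N_scale)+

section \<open>Democracy in Nakano spaces\<close>

lemma rad_fun_apply: "rad G f l = rad G (\<lambda>A. f A l)" for f :: "_ \<Rightarrow> 'b \<Rightarrow> 'c::real_vector"
  by (simp add: rad_def fun_vector_apply)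

context nakano
begin

text \<open>Khinchin's inequality in each coordinate dominates the square function by twice a mean
  of absolute values; monotonicity and convexity of the norm transfer this to norms. Restricting to
  the finite set \<open>D\<close> keeps the square function in the space.\<close>

lemma lattice_khinchin:
  assumes "finite G" "finite D" "\<And>n. n \<in> G \<Longrightarrow> u n \<in> X"
    and t: "\<And>A. A \<subseteq> G \<Longrightarrow> N (\<Sum>n\<in>G. sg A n *\<^sub>R u n) \<le> t"
  shows "N (restr D (\<lambda>l. sqrt (\<Sum>n\<in>G. (u n l)\<^sup>2))) \<le> 2 * t"
proof -
  define f where "f = (\<lambda>A. restr D (\<lambda>l. \<bar>\<Sum>n\<in>G. sg A n * u n l\<bar>))"
  have f_in: "f A \<in> X" for A unfolding f_def by (rule restr_in_X[OF assms(2)])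
  have f_le: "N (f A) \<le> t" if "A \<subseteq> G" for A
  proof -
    have "N (f A) \<le> N (\<Sum>n\<in>G. sg A n *\<^sub>R u n)"
    proof (rule N_mono)
      show "(\<Sum>n\<in>G. sg A n *\<^sub>R u n) \<in> X" using assms by (intro sum_in scale_in) auto
    qed (auto simp: f_def restr_def fun_vector_apply)
    then show ?thesis using t[OF that] by linarith
  qed
  have "N (restr D (\<lambda>l. sqrt (\<Sum>n\<in>G. (u n l)\<^sup>2))) \<le> N (2 *\<^sub>R rad G f)"
  proof (rule N_mono)
    show "2 *\<^sub>R rad G f \<in> X" by (intro scale_in rad_in f_in)
    fix l
    have "sqrt (\<Sum>n\<in>G. (u n l)\<^sup>2) \<le> 2 * rad G (\<lambda>A. \<bar>\<Sum>n\<in>G. sg A n * u n l\<bar>)"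
      by (rule khinchin[OF assms(1)])
    then show "\<bar>restr D (\<lambda>l. sqrt (\<Sum>n\<in>G. (u n l)\<^sup>2)) l\<bar> \<le> \<bar>(2 *\<^sub>R rad G f) l\<bar>"
      by (auto simp: restr_def fun_vector_apply rad_fun_apply f_def sum_nonneg)
  qed
  also have "\<dots> = 2 * N (rad G f)" by (simp add: nrm_scale rad_in f_in)
  also have "\<dots> \<le> 2 * rad G (\<lambda>A. N (f A))" using nrm_rad[of G f] f_in by simp
  also have "\<dots> \<le> 2 * t" using f_le by (intro mult_left_mono rad_le_const assms) auto
  finally show ?thesis .
qed

lemma N_restr_le_sum_abs:
  assumes "finite D"
  shows "N (restr D v) \<le> (\<Sum>l\<in>D. \<bar>v l\<bar>)"
proof -
  have "N (restr D v) \<le> (\<Sum>l\<in>D. N (v l *\<^sub>R unit l))"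
    unfolding restr_eq_sum[OF assms] by (intro nrm_sum scale_in unit_in_X)
  also have "\<dots> \<le> (\<Sum>l\<in>D. \<bar>v l\<bar>)"
    using N_unit_le by (intro sum_mono) (auto simp: nrm_scale unit_in_X intro!: mult_left_le)
  finally show ?thesis .
qed

end

section \<open>Gliding humps and linear growth of sums of basis vectors\<close>

locale nakano_greedy = nakano p + greedy_system "nakano_space p" "nakano_norm p" x C \<kappa>
  for p x C \<kappa> +
  fixes \<beta> :: real
  assumes p_lim: "p \<longlonglongrightarrow> 1" and \<beta>: "\<And>n. N (x n) \<le> \<beta>"
begin

text \<open>Otherwise all \<open>x n\<close> with \<open>n \<ge> n0\<close> have tails of norm at
  most \<open>\<delta>\<close> beyond \<open>m\<close>. A pigeonhole argument on their first
  \<open>m\<close> coordinates then gives two of them at distance at most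
  \<open>3 * \<delta>\<close>, whereas \<open>cf n (x n - x n') = 1\<close> forces distance at least
  \<open>1 / \<kappa>' = 4 * \<delta>\<close>.\<close>

lemma tail_large:
  obtains \<delta> where "\<delta> > 0" "\<And>m n0. \<exists>n\<ge>n0. \<exists>D. finite D \<and> D \<subseteq> {m..} \<and>
    1 < (\<Sum>l\<in>D. (\<bar>x n l\<bar> / \<delta>) powr p l)"
proof
  define \<kappa>' where "\<kappa>' = 2 * C / \<kappa>"
  have \<kappa>': "\<kappa>' > 0" using C \<kappa> by (auto simp: \<kappa>'_def)
  define \<delta> where "\<delta> = 1 / (4 * \<kappa>')"
  show \<delta>: "\<delta> > 0" using \<kappa>' by (simp add: \<delta>_def)
  fix m n0
  show "\<exists>n\<ge>n0. \<exists>D. finite D \<and> D \<subseteq> {m..} \<and> 1 < (\<Sum>l\<in>D. (\<bar>x n l\<bar> / \<delta>) powr p l)"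
  proof (rule ccontr)
    assume "\<not> ?thesis"
    then have small: "(\<Sum>l\<in>D. (\<bar>x n l\<bar> / \<delta>) powr p l) \<le> 1"
      if "n \<ge> n0" "finite D" "D \<subseteq> {m..}" for n D
      using that by (meson not_le)
    have tail: "N (x n - restr {..<m} (x n)) \<le> \<delta>" if "n \<ge> n0" for n
    proof (rule N_leI[OF \<delta>])
      fix D :: "nat set" assume "finite D"
      then have "(\<Sum>l\<in>D. (\<bar>(x n - restr {..<m} (x n)) l\<bar> / \<delta>) powr p l)
          = (\<Sum>l\<in>D \<inter> {m..}. (\<bar>x n l\<bar> / \<delta>) powr p l)"
        by (intro sum.mono_neutral_cong_right) (auto simp: restr_def fun_vector_apply)
      also have "\<dots> \<le> 1" using \<open>finite D\<close> by (intro small that) auto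
      finally show "(\<Sum>l\<in>D. (\<bar>(x n - restr {..<m} (x n)) l\<bar> / \<delta>) powr p l) \<le> 1" .
    qed
    \<comment> \<open>The mesh of the quantisation \<open>f\<close>: vectors with equal quantised
      heads differ there by at most \<open>m * \<epsilon> \<le> \<delta>\<close> in total.\<close>
    define \<epsilon> where "\<epsilon> = \<delta> / (m + 1)"
    have \<epsilon>: "\<epsilon> > 0" "m * \<epsilon> \<le> \<delta>" using \<delta> by (auto simp: \<epsilon>_def field_simps)
    define J where "J = \<lceil>\<beta> / \<epsilon>\<rceil> + 1"
    define f where "f = (\<lambda>n. restrict (\<lambda>l. \<lfloor>x n l / \<epsilon>\<rfloor>) {..<m})"
    have "f ` {n0..} \<subseteq> PiE {..<m} (\<lambda>_. {-J..J})"
    proof (rule image_subsetI)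
      fix n
      have "\<lfloor>x n l / \<epsilon>\<rfloor> \<in> {-J..J}" for l
      proof -
        have "\<bar>x n l\<bar> \<le> \<beta>" using abs_le_N[OF x_in[of n], of l] \<beta>[of n] by linarith
        then have "\<bar>x n l / \<epsilon>\<bar> \<le> \<beta> / \<epsilon>" using \<epsilon> by (simp add: divide_right_mono)
        then show ?thesis unfolding J_def atLeastAtMost_iff by linarith
      qed
      then show "f n \<in> PiE {..<m} (\<lambda>_. {-J..J})" by (auto simp: f_def PiE_iff)
    qed
    then have "finite (f ` {n0..})" by (rule finite_subset) (intro finite_PiE, auto)
    then have "\<not> inj_on f {n0..}" using infinite_Ici[of n0] finite_imageD by blast
    then obtain n n' where n: "n \<ge> n0" "n' \<ge> n0" "n \<noteq> n'" "f n = f n'"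
      by (auto simp: inj_on_def)
    have close: "\<bar>x n l - x n' l\<bar> \<le> \<epsilon>" if "l < m" for l
    proof -
      have "\<lfloor>x n l / \<epsilon>\<rfloor> = \<lfloor>x n' l / \<epsilon>\<rfloor>"
        using fun_cong[OF n(4), of l] that by (simp add: f_def)
      then have "\<bar>x n l / \<epsilon> - x n' l / \<epsilon>\<bar> \<le> 1" by linarith
      then have "\<bar>x n l - x n' l\<bar> / \<epsilon> \<le> 1"
        using \<epsilon> by (simp flip: diff_divide_distrib add: abs_divide)
      then show ?thesis using \<epsilon> by simp
    qed
    let ?t = "\<lambda>n. x n - restr {..<m} (x n)"
    have t_in: "?t n \<in> X" for n by (intro diff_in x_in restr_in_X) auto
    have "x n - x n' = (?t n - ?t n') + restr {..<m} (\<lambda>l. x n l - x n' l)"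
      by (auto simp: fun_eq_iff fun_vector_apply restr_def)
    then have "N (x n - x n') \<le> N (?t n - ?t n') + N (restr {..<m} (\<lambda>l. x n l - x n' l))"
      by (metis nrm_add diff_in t_in restr_in_X finite_lessThan)
    also have "\<dots> \<le> (\<delta> + \<delta>) + (\<Sum>l<m. \<bar>x n l - x n' l\<bar>)"
      using nrm_diff[OF t_in t_in, of n n'] tail[OF n(1)] tail[OF n(2)]
      by (intro add_mono N_restr_le_sum_abs) auto
    also have "(\<Sum>l<m. \<bar>x n l - x n' l\<bar>) \<le> (\<Sum>l<m. \<epsilon>)" using close by (intro sum_mono) auto
    also have "\<dots> \<le> \<delta>" using \<epsilon> by simp
    finally have "N (x n - x n') \<le> 3 * \<delta>" by simp
    moreover have "\<bar>cf n (x n - x n')\<bar> \<le> \<kappa>' * N (x n - x n')"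
      unfolding \<kappa>'_def by (intro cf_bound diff_in x_in)
    moreover have "cf n (x n - x n') = 1"
      using n cf_combination[of "{n, n'}" n "\<lambda>i. if i = n then 1 else -1"] by auto
    ultimately have "1 \<le> \<kappa>' * (3 * \<delta>)"
      using \<kappa>' by (smt (verit) mult_left_mono)
    then show False using \<kappa>' by (simp add: \<delta>_def)
  qed
qed

text \<open>Gliding hump: after a finite hump has been chosen, the next ones are sought beyond its
  support and beyond its index.\<close>

lemma disjoint_humps:
  assumes "\<And>m n0. \<exists>n\<ge>n0. \<exists>D. finite D \<and> D \<subseteq> {m..} \<and> 1 < (\<Sum>l\<in>D. (\<bar>x n l\<bar> / \<delta>) powr p l)"
  shows "\<exists>B W. finite B \<and> B \<subseteq> {n0..} \<and> card B = M \<and> disjoint_family_on W B \<and>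
    (\<forall>n\<in>B. finite (W n) \<and> W n \<subseteq> {m..} \<and> 1 < (\<Sum>l\<in>W n. (\<bar>x n l\<bar> / \<delta>) powr p l))"
proof (induction M arbitrary: n0 m)
  case 0
  show ?case by (intro exI[of _ "{}"]) (auto simp: disjoint_family_on_def)
next
  case (Suc M)
  obtain n D where n: "n \<ge> n0" "finite D" "D \<subseteq> {m..}" "1 < (\<Sum>l\<in>D. (\<bar>x n l\<bar> / \<delta>) powr p l)"
    using assms[of n0 m] by blast
  obtain m' where m': "D \<subseteq> {..<m'}" using n finite_nat_iff_bounded by blast
  obtain B W where BW: "finite B" "B \<subseteq> {Suc n..}" "card B = M" "disjoint_family_on W B"
    "\<And>k. k \<in> B \<Longrightarrow> finite (W k) \<and> W k \<subseteq> {max m m'..} \<and> 1 < (\<Sum>l\<in>W k. (\<bar>x k l\<bar> / \<delta>) powr p l)"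
    using Suc.IH[of "Suc n" "max m m'"] by blast
  have W_m: "l \<in> W k \<Longrightarrow> m \<le> l" if "k \<in> B" for k l using BW(5)[OF that] by auto
  have nB: "n \<notin> B" using BW by auto
  have dis: "D \<inter> W k = {}" if "k \<in> B" for k
    using BW(5)[OF that] m' by fastforce
  show ?case
  proof (intro exI[of _ "insert n B"] exI[of _ "W(n := D)"] conjI ballI)
    show "disjoint_family_on (W(n := D)) (insert n B)"
      using BW(4) dis nB unfolding disjoint_family_on_def by auto
    show "insert n B \<subseteq> {n0..}" using BW(2) n(1) by auto
  qed (use BW n nB W_m in auto)
qed

text \<open>By democracy it suffices to treat a set \<open>B\<close> of the same size
  \<open>M\<close> far beyond \<open>A\<close>. There the vectors carry disjoint humps in a region
  where the exponents are nearly one, so the square function has norm of order \<open>M\<close>, and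
  \<open>lattice_khinchin\<close> produces signs for which the sum is equally large.\<close>

lemma hump_lower_bound:
  obtains c :: real where "c > 0" "\<And>A. finite A \<Longrightarrow> c * card A \<le> N (\<Sum>n\<in>A. x n)"
proof -
  obtain \<delta> where \<delta>: "\<delta> > 0" and large: "\<And>m n0. \<exists>n\<ge>n0. \<exists>D. finite D \<and> D \<subseteq> {m..} \<and>
    1 < (\<Sum>l\<in>D. (\<bar>x n l\<bar> / \<delta>) powr p l)"
    using tail_large by blast
  have "\<delta> / (8 * C) * card A \<le> N (\<Sum>n\<in>A. x n)" if A: "finite A" for A
  proof (cases "A = {}")
    case True then show ?thesis by (simp add: nrm_zero)
  next
    case False
    define M where "M = card A"
    have M: "M > 0" using A False by (auto simp: M_def card_gt_0_iff)
    \<comment> \<open>The start \<open>m\<close> of the region may depend on \<open>M\<close>: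
      beyond it, rescaling by \<open>M\<close> costs only a factor two, and the final constant does
      not involve \<open>M\<close>.\<close>
    have "(\<lambda>l. real M powr (p l - 1)) \<longlonglongrightarrow> real M powr (1 - 1)"
      using M by (intro tendsto_intros p_lim) auto
    then have "\<forall>\<^sub>F l in sequentially. real M powr (p l - 1) < 2"
      by (rule order_tendstoD) (use M in auto)
    then obtain m where m: "\<And>l. l \<ge> m \<Longrightarrow> real M powr (p l - 1) < 2"
      by (auto simp: eventually_sequentially)
    obtain n0 where n0: "A \<subseteq> {..<n0}" using A finite_nat_iff_bounded by blast
    obtain B W where BW: "finite B" "B \<subseteq> {n0..}" "card B = M" "disjoint_family_on W B"
      "\<And>k. k \<in> B \<Longrightarrow> finite (W k) \<and> W k \<subseteq> {m..} \<and> 1 < (\<Sum>l\<in>W k. (\<bar>x k l\<bar> / \<delta>) powr p l)"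
      using disjoint_humps[OF large, of n0 M m] by blast
    have "\<exists>A'\<subseteq>B. \<delta> * M / 8 < N (\<Sum>n\<in>B. sg A' n *\<^sub>R x n)"
    proof (rule ccontr)
      assume "\<not> ?thesis"
      then have le: "N (\<Sum>n\<in>B. sg A' n *\<^sub>R x n) \<le> \<delta> * M / 8" if "A' \<subseteq> B" for A'
        using that by (meson not_le)
      define z where "z = (\<lambda>l. sqrt (\<Sum>n\<in>B. (x n l)\<^sup>2))"
      define D where "D = (\<Union>n\<in>B. W n)"
      have D: "finite D" using BW by (auto simp: D_def)
      have "N (restr D z) \<le> 2 * (\<delta> * M / 8)"
        unfolding z_def by (intro lattice_khinchin BW D x_in le)
      also have "\<dots> < \<delta> * M / 2" using \<delta> M by simp
      finally have "(\<Sum>l\<in>D. (\<bar>restr D z l\<bar> / (\<delta> * M / 2)) powr p l) \<le> 1"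
        by (intro finite_modular_le_1 restr_in_X D)
      also have "(\<Sum>l\<in>D. (\<bar>restr D z l\<bar> / (\<delta> * M / 2)) powr p l)
          = (\<Sum>n\<in>B. \<Sum>l\<in>W n. (z l / (\<delta> * M / 2)) powr p l)"
        unfolding D_def using BW
        by (subst sum.UNION_disjoint_family)
          (auto simp: restr_def z_def sum_nonneg intro!: sum.cong)
      finally have upper: "(\<Sum>n\<in>B. \<Sum>l\<in>W n. (z l / (\<delta> * M / 2)) powr p l) \<le> 1" .
      have "1 = (\<Sum>n\<in>B. 1 / M)" using BW M by simp
      also have "\<dots> < (\<Sum>n\<in>B. \<Sum>l\<in>W n. (z l / (\<delta> * M / 2)) powr p l)"
      proof (rule sum_strict_mono)
        fix n assume n: "n \<in> B"
        have "1 / M < (1 / M) * (\<Sum>l\<in>W n. (\<bar>x n l\<bar> / \<delta>) powr p l)"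
          using BW(5)[OF n] M by (simp add: divide_strict_right_mono)
        also have "\<dots> \<le> (\<Sum>l\<in>W n. (z l / (\<delta> * M / 2)) powr p l)"
          unfolding sum_distrib_left
        proof (rule sum_mono)
          fix l assume "l \<in> W n"
          then have l: "l \<ge> m" using BW(5)[OF n] by auto
          \<comment> \<open>Each hump contributes more than \<open>1 / M\<close> at scale
            \<open>\<delta> * M / 2\<close> because \<open>1 / M \<le> (2 / M) powr p l\<close>,
            which follows from \<open>M powr (p l - 1) < 2\<close> and
            \<open>2 \<le> 2 powr p l\<close>.\<close>
          have "1 / M \<le> 1 / M * (2 / real M powr (p l - 1))"
          proof -
            have "1 \<le> 2 / real M powr (p l - 1)" using m[OF l] M by (simp add: le_divide_eq)
            then have "1 / M * 1 \<le> 1 / M * (2 / real M powr (p l - 1))" by (intro mult_left_mono) auto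
            then show ?thesis by simp
          qed
          also have "\<dots> \<le> 1 / M * (2 powr p l / real M powr (p l - 1))"
            using M p_ge1[of l] powr_mono[of 1 "p l" 2] by (intro mult_left_mono divide_right_mono) auto
          also have "\<dots> = (2 / M) powr p l" using M by (simp add: powr_divide powr_diff)
          finally have "(1 / M) * (\<bar>x n l\<bar> / \<delta>) powr p l \<le> (2 / M) powr p l * (\<bar>x n l\<bar> / \<delta>) powr p l"
            by (intro mult_right_mono) auto
          also have "\<dots> = (\<bar>x n l\<bar> / (\<delta> * M / 2)) powr p l"
            using M \<delta> by (simp flip: powr_mult add: field_simps)
          also have "\<dots> \<le> (z l / (\<delta> * M / 2)) powr p l"
          proof (intro powr_mono2 divide_right_mono)
            have "(x n l)\<^sup>2 \<le> (\<Sum>n\<in>B. (x n l)\<^sup>2)"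
              using n BW by (intro member_le_sum) auto
            then show "\<bar>x n l\<bar> \<le> z l" unfolding z_def by (metis real_sqrt_abs real_sqrt_le_iff)
          qed (use p_ge1[of l] \<delta> M in auto)
          finally show "(1 / M) * (\<bar>x n l\<bar> / \<delta>) powr p l \<le> (z l / (\<delta> * M / 2)) powr p l" .
        qed
        finally show "1 / M < (\<Sum>l\<in>W n. (z l / (\<delta> * M / 2)) powr p l)" .
      qed (use BW M in auto)
      finally show False using upper by simp
    qed
    then obtain A' where A': "\<delta> * M / 8 < N (\<Sum>n\<in>B. sg A' n *\<^sub>R x n)" by blast
    \<comment> \<open>Democracy holds for arbitrary signs, so the favourable signs can be kept on
      \<open>B\<close> while \<open>A\<close> receives the constant sign one.\<close>
    define s where "s = (\<lambda>n. if n \<in> B then sg A' n else 1)"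
    have AB: "A \<inter> B = {}" using n0 BW(2) by fastforce
    have "N (\<Sum>n\<in>B. s n *\<^sub>R x n) \<le> C * N (\<Sum>n\<in>A. s n *\<^sub>R x n)"
      using A BW AB by (intro democracy) (auto simp: M_def s_def)
    moreover have "(\<Sum>n\<in>B. s n *\<^sub>R x n) = (\<Sum>n\<in>B. sg A' n *\<^sub>R x n)" by (simp add: s_def)
    moreover have "(\<Sum>n\<in>A. s n *\<^sub>R x n) = (\<Sum>n\<in>A. x n)"
      using AB by (intro sum.cong) (auto simp: s_def)
    ultimately have "\<delta> * M / 8 \<le> C * N (\<Sum>n\<in>A. x n)" using A' by simp
    then show ?thesis using C by (simp add: M_def field_simps)
  qed
  then show ?thesis using that[of "\<delta> / (8 * C)"] \<delta> C by auto
qed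

end

section \<open>Orlicz functions that are almost linear at most scales\<close>

text \<open>Call \<open>n\<close> bad at level \<open>i\<close> if
  \<open>\<Phi> n T \<le> \<gamma> * T\<close> for \<open>T = 1 / 2 ^ i\<close>. The hypothesis on
  sets \<open>A\<close> allows fewer than \<open>2 ^ i\<close> bad indices. For the others,
  Cauchy-Schwarz passes from \<open>T\<close> to its square: \<open>\<Phi> n (T\<^sup>2)\<close> is
  at least \<open>\<gamma>\<^sup>2 * T\<^sup>2 / b\<close>. Coefficients \<open>c n\<close> of size
  about \<open>T\<^sup>2\<close> are thus either controlled by \<open>\<Phi> n (c n)\<close> or
  number fewer than \<open>2 ^ i\<close> with value at most \<open>(1/4) ^ i\<close>, which is
  summable.\<close>

lemma layered_sum_bound:
  fixes c :: "'i \<Rightarrow> real" and \<alpha> :: "'i \<Rightarrow> 'j \<Rightarrow> real" and p :: "'j \<Rightarrow> real"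
    and L :: "'i \<Rightarrow> 'j set"
  defines "\<Phi> \<equiv> \<lambda>n t. \<Sum>l\<in>L n. (t * \<alpha> n l) powr p l"
  assumes "finite G" and \<alpha>: "\<And>n l. 0 \<le> \<alpha> n l"
    and p: "\<And>n l. n \<in> G \<Longrightarrow> l \<in> L n \<Longrightarrow> 1 \<le> p l \<and> p l \<le> 2"
    and c: "\<And>n. n \<in> G \<Longrightarrow> 0 \<le> c n \<and> c n \<le> 1"
    and b: "0 < b" "\<And>n. n \<in> G \<Longrightarrow> \<Phi> n 1 \<le> b"
    and \<gamma>: "0 < \<gamma>" "\<And>A. A \<subseteq> G \<Longrightarrow> A \<noteq> {} \<Longrightarrow> \<gamma> < (\<Sum>n\<in>A. \<Phi> n (1 / card A))"
    and \<mu>: "(\<Sum>n\<in>G. \<Phi> n (c n)) \<le> \<mu>"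
  shows "(\<Sum>n\<in>G. c n) \<le> 2 + 16 * b / \<gamma>\<^sup>2 * \<mu>"
proof -
  define Bad where "Bad = (\<lambda>i::nat. {n\<in>G. 2 ^ i * \<Phi> n (1 / 2 ^ i) \<le> \<gamma>})"
  have Bad: "finite (Bad i)" "card (Bad i) < 2 ^ i" for i
  proof -
    show fin: "finite (Bad i)" using assms by (auto simp: Bad_def)
    show "card (Bad i) < 2 ^ i"
    proof (rule ccontr)
      assume "\<not> ?thesis"
      then have "2 ^ i \<le> card (Bad i)" by simp
      then obtain A where A: "A \<subseteq> Bad i" "card A = 2 ^ i"
        using obtain_subset_with_card_n by (metis fin)
      then have "A \<noteq> {}" by auto
      have "\<gamma> < (\<Sum>n\<in>A. \<Phi> n (1 / card A))"
        using A \<open>A \<noteq> {}\<close> by (intro \<gamma>) (auto simp: Bad_def)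
      also have "\<dots> \<le> (\<Sum>n\<in>A. \<gamma> / 2 ^ i)"
        using A by (intro sum_mono) (auto simp: Bad_def field_simps)
      also have "\<dots> = \<gamma>" using A by simp
      finally show False by simp
    qed
  qed
  have \<Phi>0: "0 \<le> \<Phi> n t" for n t by (auto simp: \<Phi>_def intro!: sum_nonneg)
  have good: "c n \<le> 16 * b / \<gamma>\<^sup>2 * \<Phi> n (c n)"
    if n: "n \<in> G" "n \<notin> Bad i" and i: "(1/4) ^ Suc i < c n" "c n \<le> (1/4) ^ i" for n i
  proof -
    define T :: real where "T = 1 / 2 ^ i"
    have T: "0 < T" "T\<^sup>2 = (1/4) ^ i" by (auto simp: T_def power2_eq_square power_divide simp flip: power_mult_distrib)
    have "\<gamma> * T < \<Phi> n T" using n by (auto simp: Bad_def T_def field_simps)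
    then have "(\<gamma> * T)\<^sup>2 \<le> (\<Phi> n T)\<^sup>2" using \<gamma> T by (intro power_mono) auto
    \<comment> \<open>Each term is split so that the squares of the two factors sum to
      \<open>\<Phi> n (T\<^sup>2)\<close> and \<open>\<Phi> n 1\<close>.\<close>
    also have "\<Phi> n T = (\<Sum>l\<in>L n. (T powr p l * \<alpha> n l powr (p l / 2)) * \<alpha> n l powr (p l / 2))"
      unfolding \<Phi>_def using T \<alpha> by (intro sum.cong refl) (simp add: powr_mult mult.assoc flip: powr_add)
    also have "\<dots>\<^sup>2 \<le> (\<Sum>l\<in>L n. (T powr p l * \<alpha> n l powr (p l / 2))\<^sup>2) * (\<Sum>l\<in>L n. (\<alpha> n l powr (p l / 2))\<^sup>2)"
      by (rule Cauchy_Schwarz_ineq_sum)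
    also have "(\<Sum>l\<in>L n. (T powr p l * \<alpha> n l powr (p l / 2))\<^sup>2) = \<Phi> n (T\<^sup>2)"
      unfolding \<Phi>_def using T(1) \<alpha>
      by (intro sum.cong refl) (simp add: powr_mult power2_eq_square mult_ac flip: powr_add)
    also have "(\<Sum>l\<in>L n. (\<alpha> n l powr (p l / 2))\<^sup>2) = \<Phi> n 1"
      unfolding \<Phi>_def by (intro sum.cong refl) (simp add: power2_eq_square flip: powr_add)
    also have "\<Phi> n (T\<^sup>2) * \<Phi> n 1 \<le> \<Phi> n (T\<^sup>2) * b" using b n \<Phi>0 by (intro mult_left_mono) auto
    also have "\<Phi> n (T\<^sup>2) \<le> 16 * \<Phi> n (c n)"
      unfolding \<Phi>_def sum_distrib_left
    proof (rule sum_mono)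
      fix l assume l: "l \<in> L n"
      have "(T\<^sup>2 * \<alpha> n l) powr p l \<le> (4 * (c n * \<alpha> n l)) powr p l"
        using i T(2) p[OF n(1) l] \<alpha>[of n l] by (intro powr_mono2) (auto simp: mult_right_mono simp flip: mult.assoc)
      also have "\<dots> = 4 powr p l * (c n * \<alpha> n l) powr p l"
        using \<alpha>[of n l] c[OF n(1)] by (simp add: powr_mult)
      also have "\<dots> \<le> 4 powr 2 * (c n * \<alpha> n l) powr p l"
        using p[OF n(1) l] by (intro mult_right_mono powr_mono) auto
      finally show "(T\<^sup>2 * \<alpha> n l) powr p l \<le> 16 * (c n * \<alpha> n l) powr p l" by simp
    qed
    finally have "T\<^sup>2 * \<gamma>\<^sup>2 \<le> 16 * \<Phi> n (c n) * b" using b by (simp add: power_mult_distrib mult.commute)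
    then have "T\<^sup>2 \<le> 16 * b / \<gamma>\<^sup>2 * \<Phi> n (c n)" using \<gamma> by (simp add: field_simps)
    then show ?thesis using i T by simp
  qed
  have "\<exists>i. (1/4) ^ Suc i < c n \<and> c n \<le> (1/4) ^ i" if n: "n \<in> G" "c n > 0" for n
  proof -
    obtain j where j: "(1/4::real) ^ j < c n" using real_arch_pow_inv[OF n(2), of "1/4"] by auto
    \<comment> \<open>The least power of 1/4 below \<open>c n\<close> determines its level;
      \<open>c n \<le> 1\<close> excludes \<open>k = 0\<close>.\<close>
    define k where "k = (LEAST j. (1/4::real) ^ j < c n)"
    have k: "(1/4::real) ^ k < c n" unfolding k_def using j by (rule LeastI)
    then have "k \<noteq> 0" using c[OF n(1)] by (intro notI) auto
    then obtain i where i: "k = Suc i" using not0_implies_Suc by blast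
    then have "\<not> (1/4::real) ^ i < c n" using not_less_Least[of i "\<lambda>j. (1/4::real) ^ j < c n"] by (auto simp: k_def)
    then show ?thesis using k i by (intro exI[of _ i]) auto
  qed
  then obtain lev where lev: "\<And>n. n \<in> G \<Longrightarrow> c n > 0 \<Longrightarrow> (1/4) ^ Suc (lev n) < c n \<and> c n \<le> (1/4) ^ lev n"
    by metis
  obtain I where I: "lev ` G \<subseteq> {..<I}" using assms(2) finite_nat_iff_bounded finite_imageI by metis
  have bound0: "0 \<le> 16 * b / \<gamma>\<^sup>2 * \<Phi> n (c n)" for n using b \<Phi>0 by auto
  have "c n \<le> 16 * b / \<gamma>\<^sup>2 * \<Phi> n (c n) + (\<Sum>i<I. (1/4) ^ i * (if n \<in> Bad i then 1 else 0))"
    if n: "n \<in> G" for n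
  proof -
    have S0: "0 \<le> (\<Sum>i<I. (1/4::real) ^ i * (if n \<in> Bad i then 1 else 0))" by (intro sum_nonneg) auto
    consider "c n = 0" | "c n > 0" "n \<notin> Bad (lev n)" | "c n > 0" "n \<in> Bad (lev n)"
      using c[OF n] by force
    then show ?thesis
    proof cases
      case 1 then show ?thesis using S0 bound0[of n] by simp
    next
      case 2 then show ?thesis using good[OF n 2(2)] lev[OF n 2(1)] S0 by simp
    next
      case 3
      have "(1/4::real) ^ lev n * (if n \<in> Bad (lev n) then 1 else 0)
          \<le> (\<Sum>i<I. (1/4) ^ i * (if n \<in> Bad i then 1 else 0))"
        using I n by (intro member_le_sum) auto
      then show ?thesis using 3 lev[OF n 3(1)] bound0[of n] by simp
    qed
  qed
  then have "(\<Sum>n\<in>G. c n) \<le> (\<Sum>n\<in>G. 16 * b / \<gamma>\<^sup>2 * \<Phi> n (c n) + (\<Sum>i<I. (1/4) ^ i * (if n \<in> Bad i then 1 else 0)))"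
    by (rule sum_mono)
  also have "\<dots> = 16 * b / \<gamma>\<^sup>2 * (\<Sum>n\<in>G. \<Phi> n (c n)) + (\<Sum>n\<in>G. \<Sum>i<I. (1/4) ^ i * (if n \<in> Bad i then 1 else 0))"
    by (simp only: sum.distrib sum_distrib_left)
  also have "(\<Sum>n\<in>G. \<Sum>i<I. (1/4::real) ^ i * (if n \<in> Bad i then 1 else 0)) = (\<Sum>i<I. (1/4) ^ i * card (Bad i))"
  proof -
    have "(\<Sum>n\<in>G. (1/4::real) ^ i * (if n \<in> Bad i then 1 else 0)) = (1/4) ^ i * card (Bad i)" for i
    proof -
      have "G \<inter> Bad i = Bad i" by (auto simp: Bad_def)
      then show ?thesis using assms(2)
        by (simp add: sum.If_cases Int_def[symmetric] Collect_mem_eq flip: sum_distrib_left)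
    qed
    then show ?thesis by (subst sum.swap) simp
  qed
  also have "\<dots> \<le> (\<Sum>i<I. (1/2) ^ i)"
  proof (rule sum_mono)
    fix i
    have "real (card (Bad i)) \<le> 2 ^ i" using Bad(2)[of i]
      by (metis less_imp_le of_nat_le_iff of_nat_numeral of_nat_power)
    then have "(1/4::real) ^ i * card (Bad i) \<le> (1/4) ^ i * 2 ^ i" by (intro mult_left_mono) auto
    also have "\<dots> = (1/2) ^ i" by (simp flip: power_mult_distrib)
    finally show "(1/4::real) ^ i * card (Bad i) \<le> (1/2) ^ i" .
  qed
  also have "\<dots> \<le> 2" using sum_gp_strict[of "1/2::real" I] by simp
  finally have "(\<Sum>n\<in>G. c n) \<le> 16 * b / \<gamma>\<^sup>2 * (\<Sum>n\<in>G. \<Phi> n (c n)) + 2" by simp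
  also have "\<dots> \<le> 16 * b / \<gamma>\<^sup>2 * \<mu> + 2" using \<mu> b by (intro add_mono mult_left_mono) auto
  finally show ?thesis by simp
qed

section \<open>The l1 estimate\<close>

lemma rad_scaleR_left: "rad G (\<lambda>A. f A *\<^sub>R z) = rad G f *\<^sub>R z"
  by (simp add: rad_def flip: scaleR_sum_left)

text \<open>The sum is at most \<open>s\<close> times its largest term, and
  \<open>s powr q \<le> s\<^sup>2\<close>.\<close>

lemma powr_sum_le:
  fixes y :: "'i \<Rightarrow> real"
  assumes "finite I" "real (card I) \<le> s" "1 \<le> s" "1 \<le> q" "q \<le> 2" "\<And>i. i \<in> I \<Longrightarrow> 0 \<le> y i"
  shows "(\<Sum>i\<in>I. y i) powr q \<le> s\<^sup>2 * (\<Sum>i\<in>I. y i powr q)"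
proof (cases "I = {}")
  case False
  obtain j where j: "j \<in> I" "\<And>i. i \<in> I \<Longrightarrow> y i \<le> y j"
    using obtains_MAX[OF assms(1) False, of y] assms(1) by (metis Max_ge finite_imageI imageI)
  have "(\<Sum>i\<in>I. y i) \<le> real (card I) * y j" using j by (intro sum_bounded_above) auto
  also have "\<dots> \<le> s * y j" using assms j by (intro mult_right_mono) auto
  finally have "(\<Sum>i\<in>I. y i) powr q \<le> (s * y j) powr q"
    using assms by (intro powr_mono2) (auto intro!: sum_nonneg)
  also have "\<dots> = s powr q * y j powr q" using assms j by (simp add: powr_mult)
  also have "\<dots> \<le> s\<^sup>2 * (\<Sum>i\<in>I. y i powr q)"
  proof (intro mult_mono)
    show "s powr q \<le> s\<^sup>2" using assms powr_mono[of q 2 s] by simp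
    show "y j powr q \<le> (\<Sum>i\<in>I. y i powr q)" using assms(1) j by (intro member_le_sum) auto
  qed auto
  finally show ?thesis .
qed simp

text \<open>One constant \<open>K\<close> dominates all structural constants of the basis;
  \<open>K_dem\<close> is the linear growth obtained from the gliding humps. The bound on
  \<open>N (x n)\<close> is strict so that the modular of \<open>x n / K\<close> is at most
  one.\<close>

locale nakano_greedy_const = nakano_greedy +
  fixes K :: real
  assumes K_ge1: "1 \<le> K" and K_unc: "4 * C \<le> K" and K_cf: "2 * C / \<kappa> \<le> K"
    and K_x: "\<And>n. N (x n) < K"
    and K_dem: "\<And>A. finite A \<Longrightarrow> card A \<le> K * N (\<Sum>n\<in>A. x n)"
begin

abbreviation b :: "nat \<Rightarrow> nat \<Rightarrow> real" where "b n l \<equiv> cf n (unit l)"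

lemma cf_le: "v \<in> X \<Longrightarrow> \<bar>cf n v\<bar> \<le> K * N v"
  using cf_bound[of v n] mult_right_mono[OF K_cf nrm_nonneg[of v]] by linarith

lemma unc_le:
  assumes "v \<in> X" "finite A" "\<And>n. n \<in> A \<Longrightarrow> s n = 1 \<or> s n = -1"
  shows "N (\<Sum>n\<in>A. (s n * cf n v) *\<^sub>R x n) \<le> K * N v"
proof -
  have "N (\<Sum>n\<in>A. (s n * cf n v) *\<^sub>R x n) \<le> 4 * C * N v"
    by (rule unconditional) (fact assms)+
  then show ?thesis using mult_right_mono[OF K_unc nrm_nonneg[OF assms(1)]] by linarith
qed

lemma sg_cases: "sg A n = 1 \<or> sg A n = -1"
  by (simp add: sg_def)

lemma cf_restr: "finite D \<Longrightarrow> cf n (restr D v) = (\<Sum>l\<in>D. v l * b n l)"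
  by (simp add: restr_eq_sum cf_sum cf_scale scale_in unit_in_X)

lemma abs_b_le: "\<bar>b n l\<bar> \<le> K"
  using cf_le[OF unit_in_X, of n l] mult_left_mono[OF N_unit_le, of K l] K_ge1 by linarith

text \<open>Taking coordinates of a signed sum and multiplying them by the same signs leaves, on
  average, only the diagonal terms \<open>cf n (f n)\<close>. Each individual \<open>u B\<close> is
  bounded by unconditionality, so the average is too.\<close>

lemma diagonal_bound:
  assumes "finite A" and f: "\<And>n. n \<in> A \<Longrightarrow> f n \<in> X"
    and t: "\<And>B. B \<subseteq> A \<Longrightarrow> N (\<Sum>n\<in>A. sg B n *\<^sub>R f n) \<le> t"
  shows "N (\<Sum>n\<in>A. cf n (f n) *\<^sub>R x n) \<le> K * t"
proof -
  define v where "v = (\<lambda>B. \<Sum>n\<in>A. sg B n *\<^sub>R f n)"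
  define u where "u = (\<lambda>B. \<Sum>n\<in>A. (sg B n * cf n (v B)) *\<^sub>R x n)"
  have v_in: "v B \<in> X" for B unfolding v_def using f by (intro sum_in scale_in) auto
  have cf_v: "cf n (v B) = (\<Sum>m\<in>A. sg B m * cf n (f m))" for n B
    unfolding v_def using f by (subst cf_sum) (auto simp: scale_in cf_scale)
  have "rad A (\<lambda>B. sg B n * cf n (v B)) = cf n (f n)" if "n \<in> A" for n
  proof -
    have "rad A (\<lambda>B. sg B n * cf n (v B)) = rad A (\<lambda>B. \<Sum>m\<in>A. cf n (f m) * (sg B n * sg B m))"
      by (simp add: cf_v sum_distrib_left mult_ac)
    also have "\<dots> = (\<Sum>m\<in>A. cf n (f m) * (if n = m then 1 else 0))"
      using assms(1) that by (simp add: rad_sum rad_cmult rad_sg_sg)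
    also have "\<dots> = cf n (f n)"
      using assms(1) that by (simp add: if_distrib[of "(*) _"] cong: if_cong)
    finally show ?thesis .
  qed
  then have "(\<Sum>n\<in>A. cf n (f n) *\<^sub>R x n) = rad A u"
    unfolding u_def by (simp add: rad_sum rad_scaleR_left)
  then have "N (\<Sum>n\<in>A. cf n (f n) *\<^sub>R x n) \<le> rad A (\<lambda>B. N (u B))"
    using nrm_rad[of A u] by (simp add: u_def combination_in)
  also have "\<dots> \<le> K * t"
  proof (rule rad_le_const[OF assms(1)])
    fix B assume "B \<subseteq> A"
    have "N (u B) \<le> K * N (v B)"
      unfolding u_def by (intro unc_le v_in assms sg_cases)
    also have "\<dots> \<le> K * t" using t[OF \<open>B \<subseteq> A\<close>] K_ge1 by (intro mult_left_mono) (auto simp: v_def)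
    finally show "N (u B) \<le> K * t" .
  qed
  finally show ?thesis .
qed

section \<open>Dual estimates from an l1 bound\<close>

text \<open>Only nonnegative coefficients are tested; unconditionality supplies the absolute values
  in \<open>sum_abs_cf_le\<close>.\<close>

definition l1_bound :: "nat set \<Rightarrow> real \<Rightarrow> bool"
  where "l1_bound G \<Lambda> \<longleftrightarrow> (\<forall>c. (\<forall>n\<in>G. 0 \<le> c n) \<longrightarrow> (\<Sum>n\<in>G. c n) \<le> \<Lambda> * N (\<Sum>n\<in>G. c n *\<^sub>R x n))"

lemma sum_abs_cf_le:
  assumes "finite G" "l1_bound G \<Lambda>" "0 \<le> \<Lambda>" "v \<in> X"
  shows "(\<Sum>n\<in>G. \<bar>cf n v\<bar>) \<le> \<Lambda> * K * N v"
proof -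
  define s where "s = (\<lambda>n. if 0 \<le> cf n v then 1 else - 1 :: real)"
  have s: "s n * cf n v = \<bar>cf n v\<bar>" for n by (simp add: s_def)
  have "(\<Sum>n\<in>G. \<bar>cf n v\<bar>) \<le> \<Lambda> * N (\<Sum>n\<in>G. \<bar>cf n v\<bar> *\<^sub>R x n)"
    using assms(2) by (auto simp: l1_bound_def)
  also have "N (\<Sum>n\<in>G. \<bar>cf n v\<bar> *\<^sub>R x n) \<le> K * N v"
    using unc_le[OF assms(4,1), of s] unfolding s by (auto simp: s_def)
  finally show ?thesis using assms(3) by (simp add: mult_left_mono mult.assoc)
qed

lemma sum_sg_cf_le:
  assumes "finite G" "l1_bound G \<Lambda>" "0 \<le> \<Lambda>" "v \<in> X"
  shows "(\<Sum>n\<in>G. sg A n * cf n v) \<le> \<Lambda> * K * N v"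
proof -
  have "(\<Sum>n\<in>G. sg A n * cf n v) \<le> (\<Sum>n\<in>G. \<bar>cf n v\<bar>)"
    by (intro sum_mono) (auto simp: sg_def)
  then show ?thesis using sum_abs_cf_le[OF assms] by linarith
qed

text \<open>For fixed signs, multiplying \<open>g\<close> by the signs of \<open>Y A l\<close> gives
  a vector of norm at most \<open>t\<close>, and the l1 bound on its coordinates controls the
  weighted sum of \<open>\<bar>Y A l\<bar>\<close>. Averaging over the signs and Khinchin's
  inequality give the square function.\<close>

lemma square_function_bound:
  assumes G: "finite G" "l1_bound G \<Lambda>" "0 \<le> \<Lambda>" and "finite D"
    and g: "\<And>l. 0 \<le> g l" "N (restr D g) \<le> t"
  shows "(\<Sum>l\<in>D. g l * sqrt (\<Sum>n\<in>G. (b n l)\<^sup>2)) \<le> 2 * (\<Lambda> * K * t)"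
proof -
  define Y where "Y = (\<lambda>A l. \<Sum>n\<in>G. sg A n * b n l)"
  have Y_le: "(\<Sum>l\<in>D. g l * \<bar>Y A l\<bar>) \<le> \<Lambda> * K * t" for A
  proof -
    define v where "v = restr D (\<lambda>l. g l * sgn (Y A l))"
    have v_in: "v \<in> X" unfolding v_def by (rule restr_in_X[OF assms(4)])
    have "(\<Sum>l\<in>D. g l * \<bar>Y A l\<bar>) = (\<Sum>l\<in>D. \<Sum>n\<in>G. sg A n * (g l * sgn (Y A l) * b n l))"
    proof (intro sum.cong refl)
      fix l
      have "g l * \<bar>Y A l\<bar> = g l * sgn (Y A l) * Y A l" by (simp add: abs_sgn mult_ac)
      also have "\<dots> = (\<Sum>n\<in>G. sg A n * (g l * sgn (Y A l) * b n l))"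
        by (subst (2) Y_def) (simp add: sum_distrib_left mult_ac)
      finally show "g l * \<bar>Y A l\<bar> = (\<Sum>n\<in>G. sg A n * (g l * sgn (Y A l) * b n l))" .
    qed
    also have "\<dots> = (\<Sum>n\<in>G. sg A n * cf n v)"
      unfolding v_def cf_restr[OF assms(4)] by (subst sum.swap) (simp add: sum_distrib_left)
    also have "\<dots> \<le> \<Lambda> * K * N v" by (rule sum_sg_cf_le[OF G v_in])
    also have "\<dots> \<le> \<Lambda> * K * t"
    proof (intro mult_left_mono)
      have "N v \<le> N (restr D g)" unfolding v_def
        by (intro N_mono restr_in_X assms) (auto simp: restr_def abs_mult sgn_if g)
      then show "N v \<le> t" using g by linarith
    qed (use assms K_ge1 in auto)
    finally show ?thesis .
  qed
  have "(\<Sum>l\<in>D. g l * sqrt (\<Sum>n\<in>G. (b n l)\<^sup>2)) \<le> (\<Sum>l\<in>D. g l * (2 * rad G (\<lambda>A. \<bar>Y A l\<bar>)))"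
    unfolding Y_def by (intro sum_mono mult_left_mono khinchin g G)
  also have "\<dots> = 2 * rad G (\<lambda>A. \<Sum>l\<in>D. g l * \<bar>Y A l\<bar>)"
    by (simp add: rad_sum rad_cmult sum_distrib_left mult_ac)
  also have "\<dots> \<le> 2 * (\<Lambda> * K * t)"
    using Y_le by (intro mult_left_mono rad_le_const G) auto
  finally show ?thesis .
qed

text \<open>The Riesz products are bounded in \<open>L\<^sub>q\<close> as soon as \<open>q - 1\<close> is small compared with
  \<open>1 / S\<close>, so for exponents close to \<open>1\<close> they can be inserted into each coordinate at the cost
  of a constant, while they gain the correlation \<open>\<Sum>\<^sub>n b n l * w n l\<close>.\<close>

lemma riesz_square_function_bound:
  assumes G: "finite G" "l1_bound G \<Lambda>" "0 \<le> \<Lambda>" and "finite D"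
    and g: "\<And>l. 0 \<le> g l" "0 < t" "(\<Sum>l\<in>D. (g l / t) powr p l) \<le> 1"
    and w: "\<And>n l. l \<in> D \<Longrightarrow> n \<in> G \<Longrightarrow> \<bar>w n l\<bar> \<le> 1" "\<And>l. l \<in> D \<Longrightarrow> (\<Sum>n\<in>G. (w n l)\<^sup>2) \<le> S"
    and small: "\<And>l. l \<in> D \<Longrightarrow> p l \<le> 2 \<and> exp S powr (p l - 1) \<le> 2"
  shows "(\<Sum>l\<in>D. g l * (\<Sum>n\<in>G. b n l * w n l)) \<le> 3 * (\<Lambda> * K * t)"
proof -
  define h where "h = (\<lambda>l A. \<Prod>n\<in>G. 1 + sg A n * w n l)"
  have h0: "0 \<le> h l A" if "l \<in> D" for l A
    unfolding h_def
  proof (rule prod_nonneg)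
    fix n assume "n \<in> G"
    then have "\<bar>sg A n * w n l\<bar> \<le> 1" using w(1)[OF that, of n] by (simp add: abs_mult)
    then show "0 \<le> 1 + sg A n * w n l" by linarith
  qed
  \<comment> \<open>The test vector uses the same random signs as the Rademacher sums of the
    \<open>b n l\<close>, with a separate Riesz product in every coordinate.\<close>
  define v where "v = (\<lambda>A. restr D (\<lambda>l. g l * h l A))"
  have v_in: "v A \<in> X" for A unfolding v_def by (rule restr_in_X[OF assms(4)])
  \<comment> \<open>\<open>\<mu> A\<close> is the modular of \<open>v A / t\<close>. As
    \<open>p l \<ge> 1\<close>, enlarging the scale by \<open>1 + \<mu> A\<close> divides the
    modular by at least that factor, so the norm is bounded linearly in \<open>\<mu> A\<close>,
    whose mean is at most two.\<close>
  define \<mu> where "\<mu> = (\<lambda>A. \<Sum>l\<in>D. (g l / t) powr p l * h l A powr p l)"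
  have \<mu>0: "0 \<le> \<mu> A" for A by (auto simp: \<mu>_def intro!: sum_nonneg)
  have N_v: "N (v A) \<le> t * (1 + \<mu> A)" for A
    unfolding v_def
  proof (rule N_restr_le[OF assms(4)])
    show "t * (1 + \<mu> A) > 0" using g \<mu>0[of A] by (intro mult_pos_pos) auto
    have "(\<bar>g l * h l A\<bar> / (t * (1 + \<mu> A))) powr p l
        \<le> (g l / t) powr p l * h l A powr p l / (1 + \<mu> A)" if l: "l \<in> D" for l
    proof -
      have "(\<bar>g l * h l A\<bar> / (t * (1 + \<mu> A))) powr p l
          = (g l / t) powr p l * h l A powr p l * (1 / (1 + \<mu> A)) powr p l"
        using g h0[OF l] \<mu>0[of A] by (simp flip: powr_mult)
      also have "\<dots> \<le> (g l / t) powr p l * h l A powr p l * (1 / (1 + \<mu> A)) powr 1"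
        using \<mu>0[of A] p_ge1[of l] by (intro mult_left_mono powr_mono') auto
      finally show ?thesis using \<mu>0[of A] by simp
    qed
    then have "(\<Sum>l\<in>D. (\<bar>g l * h l A\<bar> / (t * (1 + \<mu> A))) powr p l)
        \<le> (\<Sum>l\<in>D. (g l / t) powr p l * h l A powr p l / (1 + \<mu> A))" by (rule sum_mono)
    also have "\<dots> = \<mu> A / (1 + \<mu> A)" by (simp add: \<mu>_def sum_divide_distrib)
    also have "\<dots> \<le> 1" using \<mu>0[of A] by simp
    finally show "(\<Sum>l\<in>D. (\<bar>g l * h l A\<bar> / (t * (1 + \<mu> A))) powr p l) \<le> 1" .
  qed
  have "rad G \<mu> \<le> 2"
  proof -
    have "rad G \<mu> = (\<Sum>l\<in>D. (g l / t) powr p l * rad G (\<lambda>A. h l A powr p l))"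
      by (simp only: \<mu>_def rad_sum rad_cmult)
    also have "\<dots> \<le> (\<Sum>l\<in>D. (g l / t) powr p l * 2)"
      unfolding h_def using w small p_ge1 G
      by (intro sum_mono mult_left_mono rad_riesz_powr[where S=S]) auto
    also have "\<dots> \<le> 2" using g by (simp flip: sum_distrib_right)
    finally show ?thesis .
  qed
  have "(\<Sum>l\<in>D. g l * (\<Sum>n\<in>G. b n l * w n l))
      = (\<Sum>l\<in>D. g l * rad G (\<lambda>A. (\<Sum>n\<in>G. sg A n * b n l) * h l A))"
    using rad_sum_riesz[OF G(1), where ?'a = real] by (simp add: h_def)
  also have "\<dots> = rad G (\<lambda>A. \<Sum>l\<in>D. g l * ((\<Sum>n\<in>G. sg A n * b n l) * h l A))"
    by (simp only: rad_sum rad_cmult)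
  also have "(\<lambda>A. \<Sum>l\<in>D. g l * ((\<Sum>n\<in>G. sg A n * b n l) * h l A)) = (\<lambda>A. \<Sum>n\<in>G. sg A n * cf n (v A))"
  proof
    fix A
    have "(\<Sum>l\<in>D. g l * ((\<Sum>n\<in>G. sg A n * b n l) * h l A))
        = (\<Sum>l\<in>D. \<Sum>n\<in>G. sg A n * (g l * h l A * b n l))"
      by (simp add: sum_distrib_left sum_distrib_right mult_ac)
    also have "\<dots> = (\<Sum>n\<in>G. \<Sum>l\<in>D. sg A n * (g l * h l A * b n l))" by (rule sum.swap)
    finally show "(\<Sum>l\<in>D. g l * ((\<Sum>n\<in>G. sg A n * b n l) * h l A)) = (\<Sum>n\<in>G. sg A n * cf n (v A))"
      unfolding v_def cf_restr[OF assms(4)] by (simp add: sum_distrib_left)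
  qed
  also have "rad G \<dots> \<le> rad G (\<lambda>A. \<Lambda> * K * t * (1 + \<mu> A))"
  proof (rule rad_mono)
    fix A
    have "(\<Sum>n\<in>G. sg A n * cf n (v A)) \<le> \<Lambda> * K * N (v A)" by (rule sum_sg_cf_le[OF G v_in])
    also have "\<dots> \<le> \<Lambda> * K * (t * (1 + \<mu> A))" using N_v G K_ge1 by (intro mult_left_mono) auto
    finally show "(\<Sum>n\<in>G. sg A n * cf n (v A)) \<le> \<Lambda> * K * t * (1 + \<mu> A)" by (simp add: mult.assoc)
  qed
  also have "\<dots> = \<Lambda> * K * t * (1 + rad G \<mu>)" by (simp only: rad_cmult rad_add rad_const[OF G(1)])
  also have "\<dots> \<le> \<Lambda> * K * t * (1 + 2)"
    using \<open>rad G \<mu> \<le> 2\<close> G K_ge1 g by (intro mult_left_mono add_left_mono) auto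
  finally show ?thesis by simp
qed

section \<open>Splitting the pairing into flat and spiky parts\<close>

text \<open>On the flat indices Cauchy-Schwarz gives \<open>g G l * \<tau>'\<close>, where
  \<open>\<tau>'\<close> is the flat part of the square function. Since the Riesz weights
  \<open>w\<close> have correlation \<open>H * \<tau>'\<^sup>2 / \<tau> G l\<close>, a weighted
  arithmetic-geometric mean bounds \<open>\<tau>'\<close> by a small multiple of this correlation
  plus a small multiple of \<open>\<tau> G l\<close>. With \<open>H = 768 * K ^ 4\<close> each of
  the two contributes \<open>\<Lambda> / 8\<close>.\<close>

lemma flat_part_bound:
  fixes D :: "nat set" and c :: "nat \<Rightarrow> real"
  defines "H \<equiv> 768 * K ^ 4"
    and "g \<equiv> \<lambda>G l. sqrt (\<Sum>n\<in>G. (c n * x n l)\<^sup>2)"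
    and "\<tau> \<equiv> \<lambda>G l. sqrt (\<Sum>n\<in>G. (b n l)\<^sup>2)"
  assumes G: "finite G" "l1_bound G \<Lambda>" "0 \<le> \<Lambda>" and D: "finite D" and g: "N (restr D (g G)) \<le> 2 * K"
    and small: "\<And>l. l \<in> D \<Longrightarrow> p l \<le> 2 \<and> exp (H\<^sup>2) powr (p l - 1) \<le> 2"
  shows "(\<Sum>l\<in>D. \<Sum>n\<in>{n\<in>G. \<bar>b n l\<bar> \<le> \<tau> G l / H}. \<bar>c n * x n l * b n l\<bar>) \<le> \<Lambda> / 4"
proof -
  have H: "H > 0" using K_ge1 by (simp add: H_def)
  define F where "F = (\<lambda>l. {n\<in>G. \<bar>b n l\<bar> \<le> \<tau> G l / H})"
  have F: "finite (F l)" "F l \<subseteq> G" for l using G by (auto simp: F_def)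
  have g0: "0 \<le> g G l" and \<tau>0: "0 \<le> \<tau> G l" for l by (auto simp: g_def \<tau>_def sum_nonneg)
  have \<tau>2: "(\<tau> G l)\<^sup>2 = (\<Sum>n\<in>G. (b n l)\<^sup>2)" for l by (simp add: \<tau>_def sum_nonneg)
  \<comment> \<open>Flatness of \<open>n\<close> is exactly what makes
    \<open>\<bar>w n l\<bar> \<le> 1\<close> possible at amplification \<open>H\<close>; the sum of
    squares grows only to \<open>H\<^sup>2\<close>, which is the quantity limited by
    \<open>small\<close>.\<close>
  define w where "w = (\<lambda>n l. if n \<in> F l \<and> \<tau> G l > 0 then H * b n l / \<tau> G l else 0)"
  have w1: "\<bar>w n l\<bar> \<le> 1" for n l
    using H by (auto simp: w_def F_def abs_mult field_simps)
  have w2: "(\<Sum>n\<in>G. (w n l)\<^sup>2) \<le> H\<^sup>2" for l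
  proof (cases "\<tau> G l > 0")
    case True
    have "(\<Sum>n\<in>G. (w n l)\<^sup>2) \<le> (\<Sum>n\<in>G. H\<^sup>2 / (\<tau> G l)\<^sup>2 * (b n l)\<^sup>2)"
      by (intro sum_mono) (auto simp: w_def power_mult_distrib power_divide)
    also have "\<dots> = H\<^sup>2" unfolding sum_distrib_left[symmetric] \<tau>2[symmetric] using True by simp
    finally show ?thesis .
  qed (simp add: w_def)
  \<comment> \<open>The scale is doubled from \<open>2 * K\<close> because the modular bound asks
    for a norm strictly below the scale.\<close>
  have t: "(\<Sum>l\<in>D. (g G l / (4 * K)) powr p l) \<le> 1"
  proof -
    have "(\<Sum>l\<in>D. (\<bar>restr D (g G) l\<bar> / (4 * K)) powr p l) \<le> 1"
      using g K_ge1 by (intro finite_modular_le_1 restr_in_X D) auto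
    then show ?thesis using g0 by (simp add: restr_def)
  qed
  have riesz: "(\<Sum>l\<in>D. g G l * (\<Sum>n\<in>G. b n l * w n l)) \<le> 3 * (\<Lambda> * K * (4 * K))"
    using K_ge1 by (intro riesz_square_function_bound[OF G D g0 _ t w1 w2 small]) auto
  have square: "(\<Sum>l\<in>D. g G l * \<tau> G l) \<le> 2 * (\<Lambda> * K * (2 * K))"
    unfolding \<tau>_def by (rule square_function_bound[OF G D g0 g])
  have "(\<Sum>n\<in>F l. \<bar>c n * x n l * b n l\<bar>)
      \<le> g G l * (1 / (96 * K\<^sup>2) * (\<Sum>n\<in>G. b n l * w n l) + \<tau> G l / (32 * K\<^sup>2))" for l
  proof -
    define \<tau>' where "\<tau>' = sqrt (\<Sum>n\<in>F l. (b n l)\<^sup>2)"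
    have \<tau>'2: "\<tau>'\<^sup>2 = (\<Sum>n\<in>F l. (b n l)\<^sup>2)" and \<tau>'0: "0 \<le> \<tau>'" by (auto simp: \<tau>'_def sum_nonneg)
    have "\<tau>' \<le> 1 / (96 * K\<^sup>2) * (\<Sum>n\<in>G. b n l * w n l) + \<tau> G l / (32 * K\<^sup>2)"
    proof (cases "\<tau> G l > 0")
      case True
      have "(\<Sum>n\<in>G. b n l * w n l) = (\<Sum>n\<in>F l. H / \<tau> G l * (b n l)\<^sup>2)"
        using F[of l] G True by (intro sum.mono_neutral_cong_right) (auto simp: w_def power2_eq_square)
      also have "\<dots> = H / \<tau> G l * \<tau>'\<^sup>2" by (simp add: \<tau>'2 sum_distrib_left)
      finally have eq: "1 / (96 * K\<^sup>2) * (\<Sum>n\<in>G. b n l * w n l) = 8 * K\<^sup>2 * \<tau>'\<^sup>2 / \<tau> G l"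
        using K_ge1 by (simp add: H_def power2_eq_square power4_eq_xxxx field_simps)
      \<comment> \<open>This square encodes \<open>\<tau>' \<le> 8 * K\<^sup>2 * \<tau>'\<^sup>2 /
        \<tau> G l + \<tau> G l / (32 * K\<^sup>2)\<close>.\<close>
      have "0 \<le> (16 * K\<^sup>2 * \<tau>' - \<tau> G l)\<^sup>2" by simp
      then have "\<tau>' * (32 * K\<^sup>2 * \<tau> G l) \<le> 256 * K ^ 4 * \<tau>'\<^sup>2 + (\<tau> G l)\<^sup>2"
        by (simp add: power2_eq_square power4_eq_xxxx algebra_simps)
      then show ?thesis using True K_ge1 unfolding eq
        by (simp add: field_simps power2_eq_square power4_eq_xxxx)
    next
      case False
      then have "(\<Sum>n\<in>G. (b n l)\<^sup>2) = 0" using \<tau>0[of l] \<tau>2[of l] by auto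
      then have "b n l = 0" if "n \<in> G" for n using G that by (simp add: sum_nonneg_eq_0_iff)
      then have "\<tau>' = 0" using F(2)[of l] by (auto simp: \<tau>'_def intro!: sum.neutral)
      then show ?thesis using False by (simp add: w_def \<tau>0)
    qed
    moreover have "(\<Sum>n\<in>F l. \<bar>c n * x n l * b n l\<bar>) \<le> g G l * \<tau>'"
    proof -
      have "(\<Sum>n\<in>F l. \<bar>c n * x n l * b n l\<bar>) = (\<Sum>n\<in>F l. \<bar>c n * x n l\<bar> * \<bar>b n l\<bar>)"
        by (simp add: abs_mult)
      also have "\<dots> \<le> L2_set (\<lambda>n. c n * x n l) (F l) * L2_set (\<lambda>n. b n l) (F l)"
        by (rule L2_set_mult_ineq)
      also have "\<dots> \<le> g G l * \<tau>'"
        unfolding L2_set_def g_def \<tau>'_def using F[of l] G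
        by (intro mult_right_mono real_sqrt_le_mono sum_mono2) (auto simp: sum_nonneg)
      finally show ?thesis .
    qed
    ultimately show ?thesis using mult_left_mono[OF _ g0[of l]] by (meson order_trans)
  qed
  then have "(\<Sum>l\<in>D. \<Sum>n\<in>F l. \<bar>c n * x n l * b n l\<bar>)
      \<le> (\<Sum>l\<in>D. g G l * (1 / (96 * K\<^sup>2) * (\<Sum>n\<in>G. b n l * w n l) + \<tau> G l / (32 * K\<^sup>2)))"
    by (rule sum_mono)
  also have "\<dots> = 1 / (96 * K\<^sup>2) * (\<Sum>l\<in>D. g G l * (\<Sum>n\<in>G. b n l * w n l))
      + 1 / (32 * K\<^sup>2) * (\<Sum>l\<in>D. g G l * \<tau> G l)"
  proof -
    have "(\<Sum>l\<in>D. u l * (\<alpha> * y l + z l / d)) = \<alpha> * (\<Sum>l\<in>D. u l * y l) + 1 / d * (\<Sum>l\<in>D. u l * z l)"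
      for u y z :: "nat \<Rightarrow> real" and \<alpha> d
      by (simp add: sum.distrib sum_distrib_left sum_divide_distrib algebra_simps)
    then show ?thesis .
  qed
  also have "\<dots> \<le> 1 / (96 * K\<^sup>2) * (3 * (\<Lambda> * K * (4 * K))) + 1 / (32 * K\<^sup>2) * (2 * (\<Lambda> * K * (2 * K)))"
    by (intro add_mono mult_left_mono riesz square) auto
  also have "\<dots> = \<Lambda> / 4" using K_ge1 by (simp add: field_simps power2_eq_square)
  finally show ?thesis by (simp add: F_def)
qed

text \<open>Chebyshev counting: each index in the set uses up at least a fraction
  \<open>1 / H\<^sup>2\<close> of the sum of squares. If that sum vanishes, the set is
  empty.\<close>

lemma overlap_card_bound:
  assumes "finite G" "H > 0"
  shows "real (card {n\<in>G. sqrt (\<Sum>n\<in>G. (b n l)\<^sup>2) / H < \<bar>b n l\<bar>}) \<le> H\<^sup>2"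
proof -
  define \<tau> where "\<tau> = sqrt (\<Sum>n\<in>G. (b n l)\<^sup>2)"
  have \<tau>: "0 \<le> \<tau>" "\<tau>\<^sup>2 = (\<Sum>n\<in>G. (b n l)\<^sup>2)" by (auto simp: \<tau>_def sum_nonneg)
  define E where "E = {n\<in>G. \<tau> / H < \<bar>b n l\<bar>}"
  show ?thesis
  proof (cases "\<tau> = 0")
    case True
    then have "b n l = 0" if "n \<in> G" for n
      using \<tau>(2) that assms by (simp add: sum_nonneg_eq_0_iff)
    then have "E = {}" using True by (auto simp: E_def)
    then have "real (card E) \<le> H\<^sup>2" by simp
    then show ?thesis by (simp only: E_def \<tau>_def)
  next
    case False
    have "card E * (\<tau> / H)\<^sup>2 = (\<Sum>n\<in>E. (\<tau> / H)\<^sup>2)" by simp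
    also have "\<dots> \<le> (\<Sum>n\<in>E. (b n l)\<^sup>2)"
      using \<tau> assms by (intro sum_mono) (auto simp: E_def abs_le_square_iff[symmetric])
    also have "\<dots> \<le> \<tau>\<^sup>2" unfolding \<tau> using assms by (intro sum_mono2) (auto simp: E_def)
    finally have "real (card E) \<le> H\<^sup>2" using False assms by (simp add: power_divide field_simps)
    then show ?thesis by (simp only: E_def \<tau>_def)
  qed
qed

text \<open>The sum is the \<open>n\<close>-th coordinate of \<open>restr D (x n)\<close>, whose
  norm does not exceed that of \<open>x n\<close>.\<close>

lemma abs_sum_x_b_le:
  assumes "finite D"
  shows "\<bar>\<Sum>l\<in>D. x n l * b n l\<bar> \<le> K\<^sup>2"
proof -
  have "\<bar>\<Sum>l\<in>D. x n l * b n l\<bar> \<le> K * N (restr D (x n))"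
    using cf_le[OF restr_in_X[OF assms], of n "x n"] cf_restr[OF assms] by simp
  also have "\<dots> \<le> K * K"
  proof (intro mult_left_mono)
    have "N (restr D (x n)) \<le> N (x n)" by (intro N_mono x_in) (auto simp: restr_def)
    then show "N (restr D (x n)) \<le> K" using K_x[of n] by linarith
  qed (use K_ge1 in auto)
  finally show ?thesis by (simp add: power2_eq_square)
qed

text \<open>On pieces of bounded overlap the norm is comparable with a Musielak-Orlicz norm; there
  democracy forces the Orlicz functions to be almost linear.\<close>

lemma spiky_part_bound:
  fixes c :: "nat \<Rightarrow> real" and s :: real
  assumes s: "1 \<le> s" and G: "finite G" and D: "finite D" and p2: "\<And>l. l \<in> D \<Longrightarrow> p l \<le> 2"
    and c: "\<And>n. n \<in> G \<Longrightarrow> 0 \<le> c n \<and> c n \<le> K"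
    and g: "N (restr D (\<lambda>l. sqrt (\<Sum>n\<in>G. (c n * x n l)\<^sup>2))) \<le> 2 * K"
    and E: "\<And>l. E l \<subseteq> G" "\<And>l. card (E l) \<le> s"
    and \<rho>: "\<And>n. n \<in> G' \<Longrightarrow> 1 / 4 \<le> (\<Sum>l\<in>{l\<in>D. n \<in> E l}. x n l * b n l)" and G': "G' \<subseteq> G"
  shows "(\<Sum>n\<in>G'. c n) \<le> K * (2 + 16 * K\<^sup>2 / (1 / (s\<^sup>2 * (8 * K\<^sup>2)\<^sup>2))\<^sup>2 * (s * (4 * K)\<^sup>2))"
proof -
  define g where "g = (\<lambda>l. sqrt (\<Sum>n\<in>G. (c n * x n l)\<^sup>2))"
  have g0: "0 \<le> g l" for l by (auto simp: g_def sum_nonneg)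
  define L where "L = (\<lambda>n. {l\<in>D. n \<in> E l})"
  have L: "finite (L n)" "L n \<subseteq> D" for n using D by (auto simp: L_def)
  define \<Phi> where "\<Phi> = (\<lambda>n t. \<Sum>l\<in>L n. (t * \<bar>x n l\<bar>) powr p l)"
  have fE: "finite (E l)" for l using E(1) G finite_subset by blast
  have fG': "finite G'" using G G' finite_subset by blast
  have K0: "K > 0" using K_ge1 by simp
  have swap: "(\<Sum>n\<in>A. \<Sum>l\<in>L n. F n l) = (\<Sum>l\<in>D. \<Sum>n\<in>A \<inter> E l. F n l)"
    if "finite A" for A and F :: "nat \<Rightarrow> nat \<Rightarrow> real"
  proof -
    have "(\<Sum>n\<in>A. \<Sum>l\<in>L n. F n l) = (\<Sum>n\<in>A. \<Sum>l | l \<in> D \<and> n \<in> E l. F n l)" by (simp add: L_def)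
    also have "\<dots> = (\<Sum>l\<in>D. \<Sum>n | n \<in> A \<and> n \<in> E l. F n l)"
      by (rule sum.swap_restrict[OF that D])
    finally show ?thesis by (simp add: Int_def)
  qed
  have "(\<Sum>n\<in>G'. c n / K) \<le> 2 + 16 * K\<^sup>2 / (1 / (s\<^sup>2 * (8 * K\<^sup>2)\<^sup>2))\<^sup>2 * (s * (4 * K)\<^sup>2)"
  \<comment> \<open>The coefficients are divided by \<open>K\<close> to lie in [0, 1];
    \<open>\<Phi> n\<close> is the modular of multiples of the piece of \<open>x n\<close> on
    \<open>L n\<close>.\<close>
  proof (rule layered_sum_bound[where p = p and \<alpha> = "\<lambda>n l. \<bar>x n l\<bar>" and L = L, folded \<Phi>_def])
    show "0 \<le> c n / K \<and> c n / K \<le> 1" if "n \<in> G'" for n using c that G' K0 by auto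
    show "1 \<le> p l \<and> p l \<le> 2" if "n \<in> G'" "l \<in> L n" for n l using p_ge1[of l] p2[of l] that L(2)[of n] by auto
    show "(\<Sum>l\<in>L n. (1 * \<bar>x n l\<bar>) powr p l) \<le> K\<^sup>2" for n
    proof -
      have "(\<Sum>l\<in>L n. (1 * \<bar>x n l\<bar>) powr p l) \<le> (\<Sum>l\<in>L n. K\<^sup>2 * (\<bar>x n l\<bar> / K) powr p l)"
      proof (rule sum_mono)
        fix l assume "l \<in> L n"
        then have "l \<in> D" using L by auto
        have "(1 * \<bar>x n l\<bar>) powr p l = K powr p l * (\<bar>x n l\<bar> / K) powr p l"
          using K0 by (simp flip: powr_mult)
        also have "\<dots> \<le> K powr 2 * (\<bar>x n l\<bar> / K) powr p l"
          using p2[OF \<open>l \<in> D\<close>] K_ge1 by (intro mult_right_mono powr_mono) auto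
        finally show "(1 * \<bar>x n l\<bar>) powr p l \<le> K\<^sup>2 * (\<bar>x n l\<bar> / K) powr p l" using K0 by simp
      qed
      also have "\<dots> = K\<^sup>2 * (\<Sum>l\<in>L n. (\<bar>x n l\<bar> / K) powr p l)" by (simp add: sum_distrib_left)
      also have "\<dots> \<le> K\<^sup>2 * 1" by (intro mult_left_mono finite_modular_le_1 x_in K_x L) auto
      finally show ?thesis by simp
    qed
    show "1 / (s\<^sup>2 * (8 * K\<^sup>2)\<^sup>2) < (\<Sum>n\<in>A. \<Sum>l\<in>L n. (1 / real (card A) * \<bar>x n l\<bar>) powr p l)"
      if A: "A \<subseteq> G'" "A \<noteq> {}" for A
    proof -
      define M where "M = real (card A)"
      have fA: "finite A" using A fG' finite_subset by blast
      then have M: "M \<ge> 1" using A card_gt_0_iff[of A] by (auto simp: M_def)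
      define \<sigma> where "\<sigma> = (\<lambda>n. \<Sum>l\<in>L n. x n l * b n l)"
      have \<sigma>: "1 / 4 \<le> \<sigma> n" if "n \<in> A" for n using \<rho> that A by (auto simp: \<sigma>_def L_def)
      \<comment> \<open>The piece of \<open>x n\<close> is normalised to have \<open>n\<close>-th
        coordinate one. By \<open>\<rho>\<close> this enlarges it by at most a factor four.\<close>
      define f where "f = (\<lambda>n. restr (L n) (\<lambda>l. x n l / \<sigma> n))"
      have f_in: "f n \<in> X" for n unfolding f_def by (intro restr_in_X L)
      have cf_f: "cf n (f n) = 1" if "n \<in> A" for n
      proof -
        have "(\<Sum>l\<in>L n. x n l / y * b n l) = \<sigma> n / y" for y
          by (simp add: \<sigma>_def sum_divide_distrib)
        then have "cf n (f n) = \<sigma> n / \<sigma> n" unfolding f_def cf_restr[OF L(1)] .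
        then show ?thesis using \<sigma>[OF that] by simp
      qed
      \<comment> \<open>If all signed sums of the pieces had norm at most \<open>t\<close>,
        \<open>diagonal_bound\<close> and democracy would give
        \<open>M \<le> K * (K * t) = M / 2\<close>.\<close>
      define t where "t = M / (2 * K\<^sup>2)"
      have t: "t > 0" using M K0 by (simp add: t_def)
      have "\<exists>B\<subseteq>A. t < N (\<Sum>n\<in>A. sg B n *\<^sub>R f n)"
      proof (rule ccontr)
        assume "\<not> ?thesis"
        then have "N (\<Sum>n\<in>A. cf n (f n) *\<^sub>R x n) \<le> K * t"
          by (intro diagonal_bound fA f_in) (meson not_le)
        then have "K * N (\<Sum>n\<in>A. x n) \<le> K * (K * t)"
          using cf_f K0 by (intro mult_left_mono) auto
        then have "M \<le> K * (K * t)" using K_dem[OF fA] by (simp add: M_def)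
        then show False using M K0 by (simp add: t_def power2_eq_square)
      qed
      then obtain B where B: "t < N (\<Sum>n\<in>A. sg B n *\<^sub>R f n)" by blast
      define v where "v = (\<Sum>n\<in>A. sg B n *\<^sub>R f n)"
      have "restr D v = v"
        by (auto simp: fun_eq_iff restr_def v_def fun_vector_apply f_def L_def intro!: sum.neutral)
      have v_le: "\<bar>v l\<bar> / t \<le> (\<Sum>n\<in>A \<inter> E l. 8 * K\<^sup>2 * (1 / M * \<bar>x n l\<bar>))" if l: "l \<in> D" for l
      proof -
        have "\<bar>v l\<bar> \<le> (\<Sum>n\<in>A. \<bar>f n l\<bar>)"
          unfolding v_def fun_vector_apply by (rule order_trans[OF sum_abs]) (simp add: abs_mult)
        also have "\<dots> = (\<Sum>n\<in>A \<inter> E l. \<bar>f n l\<bar>)"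
          using fA l by (intro sum.mono_neutral_cong_right) (auto simp: f_def restr_def L_def)
        also have "\<dots> \<le> (\<Sum>n\<in>A \<inter> E l. 4 * \<bar>x n l\<bar>)"
        proof (rule sum_mono)
          fix n assume "n \<in> A \<inter> E l"
          then have "\<bar>f n l\<bar> = \<bar>x n l\<bar> / \<sigma> n" and "1 / 4 \<le> \<sigma> n"
            using \<sigma>[of n] l by (auto simp: f_def restr_def L_def)
          then show "\<bar>f n l\<bar> \<le> 4 * \<bar>x n l\<bar>"
            using mult_left_mono[of "1 / 4" "\<sigma> n" "4 * \<bar>x n l\<bar>"] by (simp add: divide_le_eq)
        qed
        finally have "\<bar>v l\<bar> / t \<le> (\<Sum>n\<in>A \<inter> E l. 4 * \<bar>x n l\<bar>) / t" using t by (intro divide_right_mono) auto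
        also have "\<dots> = (\<Sum>n\<in>A \<inter> E l. 8 * K\<^sup>2 * (1 / M * \<bar>x n l\<bar>))"
          unfolding sum_divide_distrib using M K0 by (intro sum.cong refl) (simp add: t_def field_simps)
        finally show ?thesis .
      qed
      have "1 < (\<Sum>l\<in>D. (\<bar>v l\<bar> / t) powr p l)"
        using N_restr_le[OF D t, of v] B \<open>restr D v = v\<close> by (simp add: v_def) (meson not_le)
      also have "\<dots> \<le> (\<Sum>l\<in>D. s\<^sup>2 * (8 * K\<^sup>2)\<^sup>2 * (\<Sum>n\<in>A \<inter> E l. (1 / M * \<bar>x n l\<bar>) powr p l))"
      proof (rule sum_mono)
        fix l assume l: "l \<in> D"
        \<comment> \<open>At most \<open>s\<close> pieces meet at the coordinate \<open>l\<close>,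
          so the power of the sum is comparable with the sum of the powers.\<close>
        have "(\<bar>v l\<bar> / t) powr p l \<le> (\<Sum>n\<in>A \<inter> E l. 8 * K\<^sup>2 * (1 / M * \<bar>x n l\<bar>)) powr p l"
          using v_le[OF l] t p_ge1[of l] by (intro powr_mono2) auto
        also have "\<dots> \<le> s\<^sup>2 * (\<Sum>n\<in>A \<inter> E l. (8 * K\<^sup>2 * (1 / M * \<bar>x n l\<bar>)) powr p l)"
        proof (rule powr_sum_le)
          show "real (card (A \<inter> E l)) \<le> s"
            using E(2)[of l] card_mono[OF fE[of l], of "A \<inter> E l"] by (auto intro: order_trans[OF of_nat_mono])
        qed (use fA s p_ge1 p2[OF l] M K0 in auto)
        also have "\<dots> \<le> s\<^sup>2 * (\<Sum>n\<in>A \<inter> E l. (8 * K\<^sup>2)\<^sup>2 * (1 / M * \<bar>x n l\<bar>) powr p l)"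
        proof (intro mult_left_mono sum_mono)
          fix n
          have "(8 * K\<^sup>2 * (1 / M * \<bar>x n l\<bar>)) powr p l = (8 * K\<^sup>2) powr p l * (1 / M * \<bar>x n l\<bar>) powr p l"
            by (rule powr_mult)
          also have "\<dots> \<le> (8 * K\<^sup>2) powr 2 * (1 / M * \<bar>x n l\<bar>) powr p l"
            using p2[OF l] one_le_power[OF K_ge1, of 2] by (intro mult_right_mono powr_mono) auto
          finally show "(8 * K\<^sup>2 * (1 / M * \<bar>x n l\<bar>)) powr p l \<le> (8 * K\<^sup>2)\<^sup>2 * (1 / M * \<bar>x n l\<bar>) powr p l"
            using K0 by simp
        qed simp
        finally show "(\<bar>v l\<bar> / t) powr p l
          \<le> s\<^sup>2 * (8 * K\<^sup>2)\<^sup>2 * (\<Sum>n\<in>A \<inter> E l. (1 / M * \<bar>x n l\<bar>) powr p l)"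
          by (simp only: sum_distrib_left mult.assoc)
      qed
      also have "\<dots> = s\<^sup>2 * (8 * K\<^sup>2)\<^sup>2 * (\<Sum>n\<in>A. \<Sum>l\<in>L n. (1 / M * \<bar>x n l\<bar>) powr p l)"
        by (simp only: swap[OF fA] sum_distrib_left)
      finally have "1 < s\<^sup>2 * (8 * K\<^sup>2)\<^sup>2 * (\<Sum>n\<in>A. \<Sum>l\<in>L n. (1 / M * \<bar>x n l\<bar>) powr p l)" .
      moreover have "0 < s\<^sup>2 * (8 * K\<^sup>2)\<^sup>2" using s K0 by simp
      ultimately show ?thesis by (simp only: M_def divide_less_eq mult.commute if_True)
    qed
    have "(\<Sum>n\<in>G'. \<Sum>l\<in>L n. (c n / K * \<bar>x n l\<bar>) powr p l)
        = (\<Sum>l\<in>D. \<Sum>n\<in>G' \<inter> E l. (c n / K * \<bar>x n l\<bar>) powr p l)" by (rule swap[OF fG'])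
    also have "\<dots> \<le> (\<Sum>l\<in>D. s * (4 * K)\<^sup>2 * (g l / (4 * K)) powr p l)"
    proof (rule sum_mono)
      fix l assume l: "l \<in> D"
      have gK: "g l powr p l \<le> (4 * K)\<^sup>2 * (g l / (4 * K)) powr p l"
      proof -
        have "g l powr p l = (4 * K) powr p l * (g l / (4 * K)) powr p l"
          using K0 g0[of l] by (simp flip: powr_mult)
        also have "\<dots> \<le> (4 * K) powr 2 * (g l / (4 * K)) powr p l"
          using p2[OF l] K_ge1 by (intro mult_right_mono powr_mono) auto
        finally show ?thesis using K0 by simp
      qed
      \<comment> \<open>Every single term is dominated by the square function, so bounded overlap
        costs only the factor \<open>s\<close>.\<close>
      have "(c n / K * \<bar>x n l\<bar>) powr p l \<le> g l powr p l" if n: "n \<in> G' \<inter> E l" for n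
      proof (rule powr_mono2)
        have cn: "0 \<le> c n" "n \<in> G" using c n G' by auto
        have "c n / K * \<bar>x n l\<bar> \<le> c n * \<bar>x n l\<bar>"
          using cn K_ge1 mult_left_mono[OF K_ge1 cn(1)] by (intro mult_right_mono) (auto simp: divide_le_eq)
        also have "\<dots> = sqrt ((c n * x n l)\<^sup>2)" using cn by (simp add: abs_mult)
        also have "\<dots> \<le> g l" unfolding g_def using G cn
          by (intro real_sqrt_le_mono member_le_sum) auto
        finally show "c n / K * \<bar>x n l\<bar> \<le> g l" .
        show "0 \<le> c n / K * \<bar>x n l\<bar>" using cn K0 by simp
      qed (use p_ge1[of l] in auto)
      then have "(\<Sum>n\<in>G' \<inter> E l. (c n / K * \<bar>x n l\<bar>) powr p l) \<le> (\<Sum>n\<in>G' \<inter> E l. g l powr p l)"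
        by (rule sum_mono)
      also have "\<dots> = card (G' \<inter> E l) * g l powr p l" by simp
      also have "\<dots> \<le> s * g l powr p l"
        using E(2)[of l] card_mono[OF fE[of l], of "G' \<inter> E l"]
        by (intro mult_right_mono) (auto intro: order_trans[OF of_nat_mono])
      also have "\<dots> \<le> s * ((4 * K)\<^sup>2 * (g l / (4 * K)) powr p l)"
        using gK s by (intro mult_left_mono) auto
      finally show "(\<Sum>n\<in>G' \<inter> E l. (c n / K * \<bar>x n l\<bar>) powr p l) \<le> s * (4 * K)\<^sup>2 * (g l / (4 * K)) powr p l"
        by (simp only: mult.assoc)
    qed
    also have "\<dots> = s * (4 * K)\<^sup>2 * (\<Sum>l\<in>D. (g l / (4 * K)) powr p l)" by (simp only: sum_distrib_left)
    also have "\<dots> \<le> s * (4 * K)\<^sup>2 * 1"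
    proof (intro mult_left_mono)
      have "(\<Sum>l\<in>D. (\<bar>restr D g l\<bar> / (4 * K)) powr p l) \<le> 1"
        using assms(6) K0 unfolding g_def by (intro finite_modular_le_1 restr_in_X D) auto
      then show "(\<Sum>l\<in>D. (g l / (4 * K)) powr p l) \<le> 1" using g0 by (simp add: restr_def)
    qed (use s in auto)
    finally show "(\<Sum>n\<in>G'. \<Sum>l\<in>L n. (c n / K * \<bar>x n l\<bar>) powr p l) \<le> s * (4 * K)\<^sup>2" by simp
  qed (use fG' K0 s in auto)
  then show ?thesis using K0 by (simp add: field_simps flip: sum_divide_distrib)
qed

section \<open>Self-improvement of the l1 bound\<close>

text \<open>The partial sums are the \<open>n\<close>-th coordinates of the truncations of
  \<open>x n\<close>, which converge to \<open>x n\<close> because the tails are small and the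
  coordinate functional is continuous.\<close>

lemma biorthogonal_pairing_tendsto: "(\<lambda>L. \<Sum>l<L. x n l * b n l) \<longlonglongrightarrow> 1"
proof (rule LIMSEQ_I)
  fix r :: real assume r: "r > 0"
  have bdd: "bdd_above (range p)"
    using p_lim by (intro bounded_imp_bdd_above convergent_imp_bounded)
  obtain L0 where L0: "\<And>L. L \<ge> L0 \<Longrightarrow> N (x n - restr {..<L} (x n)) \<le> r / (2 * K)"
    using tail_small[OF x_in bdd, of "r / (2 * K)" n] r K_ge1 by auto
  show "\<exists>L0. \<forall>L\<ge>L0. norm ((\<Sum>l<L. x n l * b n l) - 1) < r"
  proof (intro exI allI impI)
    fix L assume "L \<ge> L0"
    have r_in: "restr {..<L} (x n) \<in> X" by (intro restr_in_X) simp
    have "cf n (x n) = cf n ((x n - restr {..<L} (x n)) + restr {..<L} (x n))" by simp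
    also have "\<dots> = cf n (x n - restr {..<L} (x n)) + cf n (restr {..<L} (x n))"
      by (intro cf_add diff_in x_in r_in)
    finally have "1 = cf n (x n - restr {..<L} (x n)) + (\<Sum>l<L. x n l * b n l)"
      by (simp add: cf_x cf_restr)
    moreover have "\<bar>cf n (x n - restr {..<L} (x n))\<bar> \<le> K * (r / (2 * K))"
      using cf_le[OF diff_in[OF x_in r_in], of n n] mult_left_mono[OF L0[OF \<open>L \<ge> L0\<close>], of K] K_ge1
      by linarith
    moreover have "K * (r / (2 * K)) < r" using r K_ge1 by simp
    ultimately show "norm ((\<Sum>l<L. x n l * b n l) - 1) < r" by (simp add: real_norm_def)
  qed
qed

text \<open>With \<open>S\<close> the coefficient sum of a vector of norm below one, the pairing
  gives \<open>3 / 4 * S\<close> at most the head (coordinates below \<open>m\<close>) plus the flat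
  part plus the spiky part. The head is at most \<open>m * K\<^sup>2\<close>, the flat part at most
  \<open>\<Lambda> / 4\<close>, and the spiky part at most \<open>K\<^sup>2 * Q + S / 4\<close>.
  Solving for \<open>S\<close> yields \<open>\<Lambda> / 2 + C0\<close>. It is essential that
  \<open>m\<close>, \<open>Q\<close> and \<open>C0\<close> depend neither on \<open>G\<close> nor on
  \<open>\<Lambda>\<close>.\<close>

lemma coefficient_sum_step:
  obtains C0 where "0 \<le> C0"
    "\<And>G \<Lambda>. finite G \<Longrightarrow> 0 \<le> \<Lambda> \<Longrightarrow> l1_bound G \<Lambda> \<Longrightarrow> l1_bound G (\<Lambda> / 2 + C0)"
proof -
  define H where "H = 768 * K ^ 4"
  have K0: "K > 0" using K_ge1 by simp
  have H1: "1 \<le> H" using one_le_power[OF K_ge1, of 4] by (simp add: H_def)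
  have "\<forall>\<^sub>F l in sequentially. p l < 2" using p_lim by (rule order_tendstoD) simp
  moreover have "(\<lambda>l. exp (H\<^sup>2) powr (p l - 1)) \<longlonglongrightarrow> exp (H\<^sup>2) powr (1 - 1)"
    by (intro tendsto_intros p_lim) auto
  then have "\<forall>\<^sub>F l in sequentially. exp (H\<^sup>2) powr (p l - 1) < 2"
    by (rule order_tendstoD) auto
  ultimately have "\<forall>\<^sub>F l in sequentially. p l < 2 \<and> exp (H\<^sup>2) powr (p l - 1) < 2" by eventually_elim simp
  then obtain m where m: "\<And>l. l \<ge> m \<Longrightarrow> p l \<le> 2 \<and> exp (H\<^sup>2) powr (p l - 1) \<le> 2"
    unfolding eventually_sequentially by (meson less_imp_le)
  define s where "s = H\<^sup>2"
  have s: "1 \<le> s" using H1 by (simp add: s_def one_le_power)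
  define Q where "Q = K * (2 + 16 * K\<^sup>2 / (1 / (s\<^sup>2 * (8 * K\<^sup>2)\<^sup>2))\<^sup>2 * (s * (4 * K)\<^sup>2))"
  have Q: "0 \<le> Q" using K0 s by (simp add: Q_def)
  define C0 where "C0 = 2 * (m * K\<^sup>2 + K\<^sup>2 * Q)"
  have C0: "0 \<le> C0" using Q by (simp add: C0_def)
  have normalised: "(\<Sum>n\<in>G. c n) \<le> \<Lambda> / 2 + C0"
    if G: "finite G" "l1_bound G \<Lambda>" "0 \<le> \<Lambda>" and c: "\<And>n. n \<in> G \<Longrightarrow> 0 \<le> c n"
      and small: "N (\<Sum>n\<in>G. c n *\<^sub>R x n) < 1" for G \<Lambda> c
  proof -
    define y where "y = (\<Sum>n\<in>G. c n *\<^sub>R x n)"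
    have y_in: "y \<in> X" unfolding y_def by (rule combination_in)
    have cf_y: "cf n y = c n" if "n \<in> G" for n
      using cf_combination[OF G(1), of n c] that by (simp add: y_def)
    have signs: "N (\<Sum>n\<in>G. (\<sigma> n * c n) *\<^sub>R x n) \<le> K" if "\<And>n. \<sigma> n = 1 \<or> \<sigma> n = -1" for \<sigma>
    proof -
      have "(\<Sum>n\<in>G. (\<sigma> n * c n) *\<^sub>R x n) = (\<Sum>n\<in>G. (\<sigma> n * cf n y) *\<^sub>R x n)"
        by (intro sum.cong) (auto simp: cf_y)
      moreover have "N (\<Sum>n\<in>G. (\<sigma> n * cf n y) *\<^sub>R x n) \<le> K * N y" by (intro unc_le y_in G that)
      moreover have "K * N y \<le> K" using small K0 by (simp add: y_def)
      ultimately show ?thesis by simp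
    qed
    have cK: "0 \<le> c n \<and> c n \<le> K" if "n \<in> G" for n
    proof -
      have "\<bar>cf n y\<bar> \<le> K * N y" by (rule cf_le[OF y_in])
      also have "\<dots> \<le> K" using small K0 by (simp add: y_def)
      finally show ?thesis using cf_y[OF that] c[OF that] by simp
    qed
    have "\<forall>\<^sub>F L in sequentially. 3 / 4 < (\<Sum>l<L. x n l * b n l)" for n
      by (rule order_tendstoD[OF biorthogonal_pairing_tendsto]) simp
    then have "\<forall>\<^sub>F L in sequentially. (\<forall>n\<in>G. 3 / 4 < (\<Sum>l<L. x n l * b n l)) \<and> m \<le> L"
      using G by (intro eventually_conj eventually_ball_finite eventually_ge_at_top) auto
    then obtain L where L: "\<And>n. n \<in> G \<Longrightarrow> 3 / 4 < (\<Sum>l<L. x n l * b n l)" "m \<le> L"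
      unfolding eventually_sequentially by blast
    define D where "D = {m..<L}"
    have D: "finite D" "\<And>l. l \<in> D \<Longrightarrow> m \<le> l" by (auto simp: D_def)
    define \<tau> where "\<tau> = (\<lambda>l. sqrt (\<Sum>n\<in>G. (b n l)\<^sup>2))"
    define E where "E = (\<lambda>l. {n\<in>G. \<tau> l / H < \<bar>b n l\<bar>})"
    have E_card: "card (E l) \<le> s" for l
      unfolding E_def \<tau>_def s_def using H1 by (intro overlap_card_bound G) auto
    have square: "N (restr D (\<lambda>l. sqrt (\<Sum>n\<in>G. (c n * x n l)\<^sup>2))) \<le> 2 * K"
    proof -
      have "N (restr D (\<lambda>l. sqrt (\<Sum>n\<in>G. ((c n *\<^sub>R x n) l)\<^sup>2))) \<le> 2 * K"
        using signs[OF sg_cases]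
        by (intro lattice_khinchin G D scale_in x_in) (simp add: mult.commute)
      then show ?thesis by (simp add: fun_vector_apply)
    qed
    define head where "head = (\<Sum>l<m. \<Sum>n\<in>G. c n * (x n l * b n l))"
    define flat where "flat = (\<Sum>l\<in>D. \<Sum>n\<in>G - E l. c n * (x n l * b n l))"
    define \<rho> where "\<rho> = (\<lambda>n. \<Sum>l\<in>{l\<in>D. n \<in> E l}. x n l * b n l)"
    have head_le: "head \<le> m * K\<^sup>2"
    proof -
      have "(\<Sum>n\<in>G. c n * (x n l * b n l)) \<le> K\<^sup>2" for l
      proof -
        \<comment> \<open>With these signs nothing cancels at the coordinate \<open>l\<close>, so
          the sum of absolute values there is an entry of a vector of norm at most
          \<open>K\<close>.\<close>
        define \<sigma> where "\<sigma> = (\<lambda>n. if 0 \<le> x n l then 1 else -1 :: real)"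
        have "(\<Sum>n\<in>G. c n * (x n l * b n l)) \<le> (\<Sum>n\<in>G. c n * \<bar>x n l\<bar> * K)"
        proof (rule sum_mono)
          fix n assume "n \<in> G"
          have "x n l * b n l \<le> \<bar>x n l\<bar> * K"
            using abs_b_le[of n l] by (metis abs_ge_self abs_ge_zero abs_mult mult_left_mono order_trans)
          then show "c n * (x n l * b n l) \<le> c n * \<bar>x n l\<bar> * K"
            using c[OF \<open>n \<in> G\<close>] by (simp add: mult_left_mono mult.assoc)
        qed
        also have "\<dots> = K * (\<Sum>n\<in>G. (\<sigma> n * c n) *\<^sub>R x n) l"
          unfolding fun_vector_apply sum_distrib_left by (intro sum.cong) (auto simp: \<sigma>_def)
        also have "\<dots> \<le> K * N (\<Sum>n\<in>G. (\<sigma> n * c n) *\<^sub>R x n)"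
          using K0 by (intro mult_left_mono order_trans[OF abs_ge_self abs_le_N] combination_in) auto
        also have "\<dots> \<le> K * K" using K0 by (intro mult_left_mono signs) (auto simp: \<sigma>_def)
        finally show ?thesis by (simp add: power2_eq_square)
      qed
      then have "head \<le> (\<Sum>l<m. K\<^sup>2)" unfolding head_def by (intro sum_mono)
      then show ?thesis by simp
    qed
    have flat_le: "flat \<le> \<Lambda> / 4"
    proof -
      have "flat \<le> (\<Sum>l\<in>D. \<Sum>n\<in>{n\<in>G. \<bar>b n l\<bar> \<le> \<tau> l / H}. \<bar>c n * x n l * b n l\<bar>)"
        unfolding flat_def
      proof (rule sum_mono)
        fix l
        have "G - E l = {n\<in>G. \<bar>b n l\<bar> \<le> \<tau> l / H}" by (auto simp: E_def)
        then show "(\<Sum>n\<in>G - E l. c n * (x n l * b n l))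
            \<le> (\<Sum>n\<in>{n\<in>G. \<bar>b n l\<bar> \<le> \<tau> l / H}. \<bar>c n * x n l * b n l\<bar>)"
          by (auto intro!: sum_mono simp: mult.assoc)
      qed
      also have "\<dots> \<le> \<Lambda> / 4"
        unfolding \<tau>_def H_def
        using m D square unfolding H_def by (intro flat_part_bound G D) auto
      finally show ?thesis .
    qed
    define G' where "G' = {n\<in>G. 1 / 4 \<le> \<rho> n}"
    have spiky: "(\<Sum>n\<in>G'. c n) \<le> Q"
      unfolding Q_def
    proof (rule spiky_part_bound[OF s G(1) D(1) _ cK square _ E_card])
      show "1 / 4 \<le> (\<Sum>l\<in>{l \<in> D. n \<in> E l}. x n l * b n l)" if "n \<in> G'" for n
        using that by (simp add: G'_def \<rho>_def)
    qed (use m D in \<open>auto simp: E_def G'_def\<close>)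
    \<comment> \<open>Indices with substantial spiky mass are handled by \<open>spiky\<close>; the
      remaining ones cost at most a quarter of the coefficient sum, which the left-hand side
      \<open>3 / 4\<close> absorbs.\<close>
    have "(\<Sum>n\<in>G. c n * \<rho> n) \<le> (\<Sum>n\<in>G. (if n \<in> G' then K\<^sup>2 * c n else 0) + 1 / 4 * c n)"
    proof (rule sum_mono)
      fix n assume n: "n \<in> G"
      show "c n * \<rho> n \<le> (if n \<in> G' then K\<^sup>2 * c n else 0) + 1 / 4 * c n"
      proof (cases "n \<in> G'")
        case True
        have "\<rho> n \<le> K\<^sup>2"
          using abs_sum_x_b_le[of "{l\<in>D. n \<in> E l}" n] D by (auto simp: \<rho>_def)
        then have "c n * \<rho> n \<le> c n * K\<^sup>2" using c[OF n] by (rule mult_left_mono)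
        then show ?thesis using True c[OF n] by (simp add: mult.commute)
      next
        case False
        then have "\<rho> n \<le> 1 / 4" using n by (simp add: G'_def)
        then show ?thesis using mult_left_mono[OF _ c[OF n]] False by fastforce
      qed
    qed
    also have "\<dots> = K\<^sup>2 * (\<Sum>n\<in>G'. c n) + 1 / 4 * (\<Sum>n\<in>G. c n)"
    proof -
      have "(\<Sum>n\<in>G. if n \<in> G' then K\<^sup>2 * c n else 0) = (\<Sum>n\<in>G'. K\<^sup>2 * c n)"
        using G(1) by (intro sum.mono_neutral_cong_right) (auto simp: G'_def)
      then show ?thesis by (simp add: sum.distrib sum_distrib_left)
    qed
    finally have \<rho>_le: "(\<Sum>n\<in>G. c n * \<rho> n) \<le> K\<^sup>2 * Q + 1 / 4 * (\<Sum>n\<in>G. c n)"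
      using mult_left_mono[OF spiky, of "K\<^sup>2"] by simp
    have "3 / 4 * (\<Sum>n\<in>G. c n) \<le> (\<Sum>n\<in>G. c n * (\<Sum>l<L. x n l * b n l))"
      unfolding sum_distrib_left
    proof (subst sum_distrib_left[symmetric], rule sum_mono)
      fix n assume n: "n \<in> G"
      show "3 / 4 * c n \<le> c n * (\<Sum>l<L. x n l * b n l)"
        using mult_left_mono[OF less_imp_le[OF L(1)[OF n]] c[OF n]] by (simp add: mult.commute)
    qed
    also have "\<dots> = (\<Sum>l<L. \<Sum>n\<in>G. c n * (x n l * b n l))"
      by (simp only: sum_distrib_left) (rule sum.swap)
    also have "\<dots> = head + (\<Sum>l\<in>D. \<Sum>n\<in>G. c n * (x n l * b n l))"
    proof -
      have eq: "{..<L} = {..<m} \<union> D" using L by (auto simp: D_def)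
      have "(\<Sum>l\<in>{..<m} \<union> D. F l) = (\<Sum>l<m. F l) + (\<Sum>l\<in>D. F l)" for F :: "nat \<Rightarrow> real"
        by (rule sum.union_disjoint) (auto simp: D_def)
      then show ?thesis unfolding head_def eq .
    qed
    also have "(\<Sum>l\<in>D. \<Sum>n\<in>G. c n * (x n l * b n l)) = flat + (\<Sum>l\<in>D. \<Sum>n\<in>E l. c n * (x n l * b n l))"
      unfolding flat_def sum.distrib[symmetric]
      by (intro sum.cong refl sum.subset_diff G) (auto simp: E_def)
    also have "(\<Sum>l\<in>D. \<Sum>n\<in>E l. c n * (x n l * b n l)) = (\<Sum>n\<in>G. c n * \<rho> n)"
    proof -
      have "(\<Sum>l\<in>D. \<Sum>n\<in>E l. c n * (x n l * b n l)) = (\<Sum>l\<in>D. \<Sum>n | n \<in> G \<and> n \<in> E l. c n * (x n l * b n l))"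
        by (intro sum.cong) (auto simp: E_def)
      also have "\<dots> = (\<Sum>n\<in>G. \<Sum>l | l \<in> D \<and> n \<in> E l. c n * (x n l * b n l))"
        by (rule sum.swap_restrict[OF D(1) G(1)])
      finally show ?thesis by (simp add: \<rho>_def sum_distrib_left)
    qed
    finally show ?thesis using head_le flat_le \<rho>_le by (simp add: C0_def)
  qed
  have "l1_bound G (\<Lambda> / 2 + C0)" if G: "finite G" "0 \<le> \<Lambda>" "l1_bound G \<Lambda>" for G \<Lambda>
    unfolding l1_bound_def
  proof (intro allI impI)
    fix c :: "nat \<Rightarrow> real" assume c: "\<forall>n\<in>G. 0 \<le> c n"
    define r where "r = N (\<Sum>n\<in>G. c n *\<^sub>R x n)"
    have r: "0 \<le> r" unfolding r_def by (intro nrm_nonneg combination_in)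
    define M where "M = \<Lambda> / 2 + C0"
    have M: "0 \<le> M" using G C0 by (simp add: M_def)
    \<comment> \<open>Dividing by some \<open>t > r\<close> makes the norm strictly less than one
      and also covers \<open>r = 0\<close>; afterwards \<open>t\<close> tends to
      \<open>r\<close>.\<close>
    have le: "(\<Sum>n\<in>G. c n) \<le> M * t" if t: "r < t" for t
    proof -
      have "(\<Sum>n\<in>G. (c n / t) *\<^sub>R x n) = (1 / t) *\<^sub>R (\<Sum>n\<in>G. c n *\<^sub>R x n)"
        by (simp add: scaleR_sum_right)
      then have "N (\<Sum>n\<in>G. (c n / t) *\<^sub>R x n) = r / t"
        using r t by (simp add: nrm_scale combination_in r_def)
      then have "(\<Sum>n\<in>G. c n / t) \<le> M" unfolding M_def
        using c r t G by (intro normalised) auto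
      then show ?thesis using r t by (simp add: divide_le_eq flip: sum_divide_distrib)
    qed
    have "(\<Sum>n\<in>G. c n) \<le> M * r"
    proof (rule field_le_epsilon)
      fix e :: real assume e: "e > 0"
      have "(\<Sum>n\<in>G. c n) \<le> M * (r + e / (M + 1))" using M e by (intro le) simp
      also have "\<dots> \<le> M * r + e"
        using M e by (simp add: distrib_left field_simps)
      finally show "(\<Sum>n\<in>G. c n) \<le> M * r + e" .
    qed
    then show "(\<Sum>n\<in>G. c n) \<le> (\<Lambda> / 2 + C0) * N (\<Sum>n\<in>G. c n *\<^sub>R x n)" by (simp add: M_def r_def)
  qed
  then show ?thesis using that C0 by blast
qed

text \<open>For each finite \<open>G\<close> the coordinate bound gives some l1 bound, depending on
  \<open>card G\<close>. Iterating the map \<open>\<Lambda> \<mapsto> \<Lambda> / 2 + C0\<close>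
  drives it to the fixed point \<open>2 * C0\<close>, which is independent of
  \<open>G\<close>.\<close>

lemma l1_bound_uniform:
  obtains \<Lambda> where "0 \<le> \<Lambda>" "\<And>G. finite G \<Longrightarrow> l1_bound G \<Lambda>"
proof -
  obtain C0 where C0: "0 \<le> C0"
    "\<And>G \<Lambda>. finite G \<Longrightarrow> 0 \<le> \<Lambda> \<Longrightarrow> l1_bound G \<Lambda> \<Longrightarrow> l1_bound G (\<Lambda> / 2 + C0)"
    using coefficient_sum_step by metis
  have "l1_bound G (2 * C0)" if G: "finite G" for G
    unfolding l1_bound_def
  proof (intro allI impI)
    fix c :: "nat \<Rightarrow> real" assume c: "\<forall>n\<in>G. 0 \<le> c n"
    define \<Lambda>0 where "\<Lambda>0 = card G * K"
    have \<Lambda>0: "0 \<le> \<Lambda>0" using K_ge1 by (simp add: \<Lambda>0_def)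
    have start: "l1_bound G \<Lambda>0"
      unfolding l1_bound_def
    proof (intro allI impI)
      fix c :: "nat \<Rightarrow> real"
      let ?y = "\<Sum>n\<in>G. c n *\<^sub>R x n"
      have "(\<Sum>n\<in>G. c n) \<le> (\<Sum>n\<in>G. K * N ?y)"
      proof (rule sum_mono)
        fix n assume "n \<in> G"
        then show "c n \<le> K * N ?y"
          using cf_le[OF combination_in, of n c G] cf_combination[OF G, of n c] by simp
      qed
      then show "(\<Sum>n\<in>G. c n) \<le> \<Lambda>0 * N ?y" by (simp add: \<Lambda>0_def)
    qed
    have iter: "l1_bound G (2 * C0 + \<Lambda>0 * (1/2) ^ k)" for k
    proof (induction k)
      case 0
      have "\<Lambda>0 * N (\<Sum>n\<in>G. c n *\<^sub>R x n) \<le> (2 * C0 + \<Lambda>0) * N (\<Sum>n\<in>G. c n *\<^sub>R x n)" for c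
        using C0 by (intro mult_right_mono nrm_nonneg combination_in) auto
      then show ?case using start unfolding l1_bound_def by (auto intro: order_trans)
    next
      case (Suc k)
      have "l1_bound G ((2 * C0 + \<Lambda>0 * (1/2) ^ k) / 2 + C0)"
        using C0 \<Lambda>0 by (intro C0(2) G Suc) auto
      then show ?case by (simp add: field_simps)
    qed
    have "(\<lambda>k. (2 * C0 + \<Lambda>0 * (1/2) ^ k) * N (\<Sum>n\<in>G. c n *\<^sub>R x n))
        \<longlonglongrightarrow> (2 * C0 + \<Lambda>0 * 0) * N (\<Sum>n\<in>G. c n *\<^sub>R x n)"
      by (intro tendsto_intros LIMSEQ_power_zero) auto
    then have "(\<Sum>n\<in>G. c n) \<le> (2 * C0 + \<Lambda>0 * 0) * N (\<Sum>n\<in>G. c n *\<^sub>R x n)"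
      by (rule LIMSEQ_le_const) (use iter c in \<open>auto simp: l1_bound_def\<close>)
    then show "(\<Sum>n\<in>G. c n) \<le> 2 * C0 * N (\<Sum>n\<in>G. c n *\<^sub>R x n)" by simp
  qed
  then show ?thesis using that[of "2 * C0"] C0 by simp
qed

section \<open>Transfer to the unit vectors\<close>

text \<open>Biorthogonality in the other order, summed over \<open>n\<close>: the expansion of
  \<open>unit l\<close> is evaluated at \<open>l\<close>, and evaluation is bounded by the
  norm.\<close>

lemma basis_coordinates_tendsto: "(\<lambda>M. \<Sum>n<M. b n l * x n l) \<longlonglongrightarrow> 1"
proof -
  have r_in: "unit l - (\<Sum>n<M. b n l *\<^sub>R x n) \<in> X" for M
    by (intro diff_in unit_in_X combination_in)
  have "(\<lambda>M. N (unit l - (\<Sum>n<M. b n l *\<^sub>R x n))) \<longlonglongrightarrow> 0"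
    using expansion_cf[OF unit_in_X] unfolding expansion_def .
  then have "(\<lambda>M. (unit l - (\<Sum>n<M. b n l *\<^sub>R x n)) l) \<longlonglongrightarrow> 0"
    by (rule Lim_null_comparison[rotated]) (use abs_le_N[OF r_in] in auto)
  then have "(\<lambda>M. 1 - (\<Sum>n<M. b n l * x n l)) \<longlonglongrightarrow> 0"
    by (simp add: fun_vector_apply unit_def)
  from tendsto_diff[OF tendsto_const[of 1] this] show ?thesis by simp
qed

text \<open>Grothendieck's averaging: half of \<open>card D\<close> is at most the sum of
  \<open>b n l * x n l\<close> over \<open>l\<close> in \<open>D\<close> and \<open>n < M\<close>.
  Cauchy-Schwarz in \<open>l\<close> separates the factors. The l2 norm of \<open>x n\<close> on
  \<open>D\<close> is at most \<open>K\<close> since the exponents there are below two; Khinchin's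
  inequality turns the l2 norm of \<open>b n\<close> into a mean of
  \<open>\<bar>cf n (z A)\<bar>\<close>, and the uniform l1 bound sums these over
  \<open>n\<close>.\<close>

lemma unit_vectors_l1:
  obtains C1 m where "0 \<le> C1"
    "\<And>D. finite D \<Longrightarrow> D \<subseteq> {m..} \<Longrightarrow> card D \<le> C1 * N (restr D (\<lambda>_. 1))"
proof -
  obtain \<Lambda> where \<Lambda>: "0 \<le> \<Lambda>" "\<And>G. finite G \<Longrightarrow> l1_bound G \<Lambda>" using l1_bound_uniform by metis
  have K0: "K > 0" using K_ge1 by simp
  have "\<forall>\<^sub>F l in sequentially. p l < 2" using p_lim by (rule order_tendstoD) simp
  then obtain m where m: "\<And>l. l \<ge> m \<Longrightarrow> p l < 2" by (auto simp: eventually_sequentially)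
  have "card D \<le> 4 * K * (\<Lambda> * K) * N (restr D (\<lambda>_. 1))" if D: "finite D" "D \<subseteq> {m..}" for D
  proof -
    define e where "e = restr D (\<lambda>_. 1)"
    have "\<forall>\<^sub>F M in sequentially. 1 / 2 < (\<Sum>n<M. b n l * x n l)" for l
      by (rule order_tendstoD[OF basis_coordinates_tendsto]) simp
    then have "\<forall>\<^sub>F M in sequentially. \<forall>l\<in>D. 1 / 2 < (\<Sum>n<M. b n l * x n l)"
      using D by (intro eventually_ball_finite) auto
    then obtain M where M: "\<And>l. l \<in> D \<Longrightarrow> 1 / 2 < (\<Sum>n<M. b n l * x n l)"
      unfolding eventually_sequentially by blast
    have x2: "L2_set (\<lambda>l. x n l) D \<le> K" for n
    proof -
      \<comment> \<open>Entries of \<open>x n / K\<close> are at most one in modulus, so lowering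
        the exponent from two to \<open>p l\<close> only increases them.\<close>
      have "(\<Sum>l\<in>D. (x n l / K)\<^sup>2) \<le> (\<Sum>l\<in>D. (\<bar>x n l\<bar> / K) powr p l)"
      proof (rule sum_mono)
        fix l assume "l \<in> D"
        have "\<bar>x n l\<bar> / K \<le> 1" using abs_le_N[OF x_in, of n l] K_x[of n] K0 by simp
        then have "(\<bar>x n l\<bar> / K) powr 2 \<le> (\<bar>x n l\<bar> / K) powr p l"
          using m[of l] D \<open>l \<in> D\<close> K0 by (intro powr_mono') auto
        then show "(x n l / K)\<^sup>2 \<le> (\<bar>x n l\<bar> / K) powr p l"
          using K0 by (simp add: power_divide)
      qed
      also have "\<dots> \<le> 1" by (intro finite_modular_le_1 x_in K_x D)
      finally have "(\<Sum>l\<in>D. (x n l)\<^sup>2) \<le> K\<^sup>2"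
        using K0 by (simp add: power_divide flip: sum_divide_distrib)
      then show ?thesis unfolding L2_set_def using K0 by (simp add: real_le_lsqrt sum_nonneg)
    qed
    define z where "z = (\<lambda>A. restr D (sg A))"
    have z_in: "z A \<in> X" for A unfolding z_def by (rule restr_in_X[OF D(1)])
    have N_z: "N (z A) \<le> N e" for A
      unfolding e_def by (intro N_mono restr_in_X D) (auto simp: z_def restr_def)
    have cf_z: "cf n (z A) = (\<Sum>l\<in>D. sg A l * b n l)" for n A
      unfolding z_def by (rule cf_restr[OF D(1)])
    have "1 / 2 * card D = (\<Sum>l\<in>D. 1 / 2)" by simp
    also have "\<dots> \<le> (\<Sum>l\<in>D. \<Sum>n<M. b n l * x n l)" using M by (intro sum_mono) (auto intro: less_imp_le)
    also have "\<dots> = (\<Sum>n<M. \<Sum>l\<in>D. b n l * x n l)" by (rule sum.swap)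
    also have "\<dots> \<le> (\<Sum>n<M. 2 * rad D (\<lambda>A. \<bar>cf n (z A)\<bar>) * K)"
    proof (rule sum_mono)
      fix n
      have "(\<Sum>l\<in>D. b n l * x n l) \<le> (\<Sum>l\<in>D. \<bar>b n l\<bar> * \<bar>x n l\<bar>)"
        by (intro sum_mono) (metis abs_ge_self abs_mult)
      also have "\<dots> \<le> L2_set (\<lambda>l. b n l) D * L2_set (\<lambda>l. x n l) D" by (rule L2_set_mult_ineq)
      also have "\<dots> \<le> (2 * rad D (\<lambda>A. \<bar>cf n (z A)\<bar>)) * K"
        unfolding cf_z using khinchin[OF D(1), of "\<lambda>l. b n l"] x2[of n]
        by (intro mult_mono) (auto simp: L2_set_def sum_nonneg rad_def)
      finally show "(\<Sum>l\<in>D. b n l * x n l) \<le> 2 * rad D (\<lambda>A. \<bar>cf n (z A)\<bar>) * K" .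
    qed
    also have "\<dots> = 2 * K * rad D (\<lambda>A. \<Sum>n<M. \<bar>cf n (z A)\<bar>)"
      by (simp add: rad_sum sum_distrib_left mult_ac)
    also have "\<dots> \<le> 2 * K * (\<Lambda> * K * N e)"
    proof (intro mult_left_mono rad_le_const D)
      fix A
      have "(\<Sum>n<M. \<bar>cf n (z A)\<bar>) \<le> \<Lambda> * K * N (z A)"
        by (intro sum_abs_cf_le \<Lambda> z_in) auto
      also have "\<dots> \<le> \<Lambda> * K * N e" using N_z \<Lambda> K0 by (intro mult_left_mono) auto
      finally show "(\<Sum>n<M. \<bar>cf n (z A)\<bar>) \<le> \<Lambda> * K * N e" .
    qed (use K0 in auto)
    finally show ?thesis by (simp add: e_def)
  qed
  then show ?thesis using that[of "4 * K * (\<Lambda> * K)" m] \<Lambda> K0 by simp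
qed

end

section \<open>Unit vectors and the exponents\<close>

context nakano
begin

text \<open>If \<open>2 ^ i\<close> exponents were so far from one that
  \<open>(1 / 2 ^ i) powr (p k - 1) \<le> 1 / a\<close>, the indicator of their indices would have
  norm too small for the l1 estimate. Hence fewer than \<open>2 ^ i\<close> indices lie in
  \<open>Bad i\<close>, and \<open>r\<close> is chosen so that every \<open>k\<close> with
  \<open>p k \<noteq> 1\<close> lies in a level where its term is of order \<open>4 ^ (-i)\<close>;
  the sum over levels then converges.\<close>

lemma sum_finite_of_unit_vectors_l1:
  assumes p2: "\<And>l. l \<ge> m \<Longrightarrow> p l \<le> 2" and C1: "1 \<le> C1"
    and l1: "\<And>D. finite D \<Longrightarrow> D \<subseteq> {m..} \<Longrightarrow> card D \<le> C1 * N (restr D (\<lambda>_. 1))"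
  obtains r :: real where "0 < r" "r < 1"
    "(\<Sum>n. ennreal (if p n = 1 then 0 else r powr (1 / \<bar>p n - 1\<bar>))) < \<infinity>"
proof -
  define a where "a = (2 * C1)\<^sup>2"
  have a: "4 \<le> a" using C1 power_mono[of 2 "2 * C1" 2] by (simp add: a_def)
  define Bad where "Bad = (\<lambda>i::nat. {k\<in>{m..}. (1 / 2 ^ i) powr (p k - 1) \<le> 1 / a})"
  have few: "card D < 2 ^ i" if D: "finite D" "D \<subseteq> Bad i" for D i
  proof (rule ccontr)
    assume "\<not> ?thesis"
    then have "2 ^ i \<le> card D" by simp
    then obtain E where E: "E \<subseteq> D" "card E = 2 ^ i" "finite E"
      using obtain_subset_with_card_n by metis
    define T :: real where "T = 2 ^ i"
    have T: "1 \<le> T" by (simp add: T_def)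
    have Em: "E \<subseteq> {m..}" using E D by (auto simp: Bad_def)
    have "T \<le> C1 * N (restr E (\<lambda>_. 1))" using l1[OF E(3) Em] E by (simp add: T_def)
    \<comment> \<open>The factor two makes the inequality strict, so the modular at this scale must
      exceed one.\<close>
    then have "T / (2 * C1) < N (restr E (\<lambda>_. 1))" using C1 T by (simp add: field_simps)
    then have "1 < (\<Sum>k\<in>E. (\<bar>1\<bar> / (T / (2 * C1))) powr p k)"
      using N_restr_le[OF E(3), of "T / (2 * C1)" "\<lambda>_. 1"] C1 T by (meson divide_pos_pos less_le_trans mult_pos_pos not_le zero_less_numeral zero_less_one)
    also have "\<dots> \<le> (\<Sum>k\<in>E. 1 / T)"
    proof (rule sum_mono)
      fix k assume k: "k \<in> E"
      have "(\<bar>1\<bar> / (T / (2 * C1))) powr p k = (2 * C1) powr p k * (1 / T) powr p k"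
        using C1 T by (simp flip: powr_mult)
      also have "\<dots> \<le> (2 * C1) powr 2 * (1 / T) powr p k"
        using p2[of k] Em k C1 by (intro mult_right_mono powr_mono) auto
      also have "\<dots> = a * ((1 / T) powr (p k - 1) * (1 / T))"
        using C1 T by (simp add: a_def powr_diff)
      also have "\<dots> \<le> a * (1 / a * (1 / T))"
        using k E D a T by (intro mult_left_mono mult_right_mono) (auto simp: Bad_def T_def)
      finally show "(\<bar>1\<bar> / (T / (2 * C1))) powr p k \<le> 1 / T" using a by simp
    qed
    also have "\<dots> = 1" using E by (simp add: T_def)
    finally show False by simp
  qed
  \<comment> \<open>For \<open>k \<ge> m\<close> with \<open>p k > 1\<close>, membership in
    \<open>Bad i\<close> amounts to \<open>1 / (p k - 1) \<le> i * \<theta>\<close>. With the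
    \<open>r\<close> below, the term with \<open>q = 1 / (p k - 1)\<close> becomes
    \<open>(1 / 4) powr (q / \<theta>)\<close>.\<close>
  define \<theta> where "\<theta> = ln 2 / ln a"
  have \<theta>: "\<theta> > 0" using a by (simp add: \<theta>_def)
  define r where "r = (1 / 4) powr (1 / \<theta>)"
  have r: "0 < r" "r < 1"
    using \<theta> powr_less_mono2[of "1 / \<theta>" "1 / 4" 1] by (auto simp: r_def)
  define f where "f = (\<lambda>k. if p k = 1 then 0 else r powr (1 / \<bar>p k - 1\<bar>))"
  have f0: "0 \<le> f k" and f1: "f k \<le> 1" for k using r by (auto simp: f_def powr_le1)
  have "\<exists>i. k \<in> Bad i \<and> f k \<le> 4 * (1 / 4) ^ i" if k: "k \<ge> m" "p k \<noteq> 1" for k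
  proof -
    have pk: "p k > 1" using k(2) p_ge1[of k] by simp
    define q where "q = 1 / (p k - 1)"
    have q: "q > 0" using pk by (simp add: q_def)
    \<comment> \<open>The first admissible level; rounding up loses less than one level, hence the
      factor four in the bound on \<open>f k\<close>.\<close>
    define i where "i = nat \<lceil>q / \<theta>\<rceil>"
    have "0 < q / \<theta>" using q \<theta> by simp
    then have i: "q / \<theta> \<le> i" "i < q / \<theta> + 1" unfolding i_def by linarith+
    have "ln a \<le> i * ln 2 * (p k - 1)"
    proof -
      have "ln a = q / \<theta> * ln 2 * (p k - 1)" using pk a by (simp add: q_def \<theta>_def)
      also have "\<dots> \<le> i * ln 2 * (p k - 1)" using i pk by (intro mult_right_mono) auto
      finally show ?thesis .
    qed
    then have "exp (- (i * ln 2 * (p k - 1))) \<le> exp (- ln a)" by simp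
    moreover have "(1 / 2 ^ i) powr (p k - 1) = exp (- (i * ln 2 * (p k - 1)))"
      by (simp add: powr_def ln_div ln_realpow)
    ultimately have "k \<in> Bad i" using k a by (simp add: Bad_def exp_minus inverse_eq_divide)
    moreover have "f k \<le> 4 * (1 / 4) ^ i"
    proof -
      have "f k = (1 / 4) powr (q / \<theta>)" using pk by (simp add: f_def r_def powr_powr q_def mult.commute)
      also have "\<dots> \<le> (1 / 4) powr (real i - 1)" using i by (intro powr_mono') auto
      also have "\<dots> = 4 * (1 / 4) ^ i" by (simp add: powr_diff powr_realpow)
      finally show ?thesis .
    qed
    ultimately show ?thesis by blast
  qed
  then obtain lev where lev: "\<And>k. k \<ge> m \<Longrightarrow> p k \<noteq> 1 \<Longrightarrow> k \<in> Bad (lev k) \<and> f k \<le> 4 * (1 / 4) ^ lev k"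
    by metis
  have partial: "(\<Sum>k<n. f k) \<le> m + 8" for n
  proof -
    define D where "D = {k. m \<le> k \<and> k < n}"
    have D: "finite D" by (simp add: D_def)
    obtain I where I: "lev ` D \<subseteq> {..<I}" using D finite_nat_iff_bounded finite_imageI by metis
    have "(\<Sum>k<n. f k) \<le> (\<Sum>k\<in>{..<m} \<union> D. f k)"
      using f0 by (intro sum_mono2) (auto simp: D_def)
    also have "\<dots> = (\<Sum>k<m. f k) + (\<Sum>k\<in>D. f k)"
      by (rule sum.union_disjoint) (auto simp: D_def)
    also have "(\<Sum>k<m. f k) \<le> (\<Sum>k<m. 1)" using f1 by (intro sum_mono)
    also have "(\<Sum>k\<in>D. f k) \<le> (\<Sum>k\<in>D. \<Sum>i<I. 4 * (1 / 4) ^ i * (if k \<in> Bad i then 1 else 0))"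
    proof (rule sum_mono)
      fix k assume k: "k \<in> D"
      show "f k \<le> (\<Sum>i<I. 4 * (1 / 4) ^ i * (if k \<in> Bad i then 1 else 0))"
      proof (cases "p k = 1")
        case True
        then show ?thesis by (auto simp: f_def intro!: sum_nonneg)
      next
        case False
        then have l: "k \<in> Bad (lev k)" "f k \<le> 4 * (1 / 4) ^ lev k"
          using lev[of k] k by (auto simp: D_def)
        have "4 * (1 / 4) ^ lev k * (if k \<in> Bad (lev k) then 1 else 0)
            \<le> (\<Sum>i<I. 4 * (1 / 4 :: real) ^ i * (if k \<in> Bad i then 1 else 0))"
          using I k by (intro member_le_sum) auto
        then show ?thesis using l by simp
      qed
    qed
    also have "\<dots> = (\<Sum>i<I. \<Sum>k\<in>D. 4 * (1 / 4) ^ i * (if k \<in> Bad i then 1 else 0))" by (rule sum.swap)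
    also have "\<dots> \<le> (\<Sum>i<I. 4 * (1 / 2) ^ i)"
    proof (rule sum_mono)
      fix i
      have "(\<Sum>k\<in>D. 4 * (1 / 4 :: real) ^ i * (if k \<in> Bad i then 1 else 0)) = 4 * (1 / 4) ^ i * card (D \<inter> Bad i)"
        using D by (simp add: sum.If_cases Int_def flip: sum_distrib_left)
      also have "\<dots> \<le> 4 * (1 / 4) ^ i * 2 ^ i"
      proof (intro mult_left_mono)
        have "card (D \<inter> Bad i) < 2 ^ i" using D by (intro few) auto
        then show "real (card (D \<inter> Bad i)) \<le> 2 ^ i"
          by (metis less_imp_le of_nat_le_iff of_nat_numeral of_nat_power)
      qed auto
      also have "\<dots> = 4 * (1 / 2) ^ i" by (simp flip: power_mult_distrib)
      finally show "(\<Sum>k\<in>D. 4 * (1 / 4 :: real) ^ i * (if k \<in> Bad i then 1 else 0)) \<le> 4 * (1 / 2) ^ i" .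
    qed
    also have "\<dots> = 4 * (\<Sum>i<I. (1 / 2) ^ i)" by (simp only: sum_distrib_left)
    also have "\<dots> \<le> 4 * 2" using sum_gp_strict[of "1/2::real" I] by simp
    finally show ?thesis by simp
  qed
  have "(\<Sum>k. ennreal (f k)) \<le> ennreal (m + 8)"
  proof (rule suminf_le_const)
    fix n
    have "(\<Sum>k<n. ennreal (f k)) = ennreal (\<Sum>k<n. f k)" using f0 by simp
    also have "\<dots> \<le> ennreal (m + 8)" using partial by (intro ennreal_leI)
    finally show "(\<Sum>k<n. ennreal (f k)) \<le> ennreal (m + 8)" .
  qed simp
  then have "(\<Sum>k. ennreal (f k)) < \<infinity>" by (rule order_le_less_trans) simp
  then show ?thesis using that[OF r] by (simp add: f_def)
qed

end

text \<open>Nonnegativity allows the greedy constant to be enlarged, in particular to one that is at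
  least 1.\<close>

lemma best_approx_error_nonneg:
  assumes "\<And>A \<alpha>. finite A \<Longrightarrow> 0 \<le> nrm (v - (\<Sum>n\<in>A. \<alpha> n *\<^sub>R x n))"
  shows "0 \<le> best_approx_error nrm x N v"
  unfolding best_approx_error_def
proof (rule cInf_greatest)
  have "finite {..<N} \<and> card {..<N} = N" by simp
  then show "{nrm (v - (\<Sum>n\<in>A. \<alpha> n *\<^sub>R x n)) | A \<alpha>. finite A \<and> card A = N} \<noteq> {}" by blast
qed (use assms in auto)

section \<open>Contradiction with the divergence of the series\<close>

theorem corollary3p13:
  fixes p :: "nat \<Rightarrow> real"
  assumes "\<And>n. 1 \<le> p n"
    and "p \<longlonglongrightarrow> 1"
    and "\<And>r::real. 0 < r \<Longrightarrow> r < 1 \<Longrightarrow>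
      (\<Sum>n. ennreal (if p n = 1 then 0 else r powr (1 / \<bar>p n - 1\<bar>))) = \<infinity>"
  shows "\<not> (\<exists>x. greedy_basis (nakano_space p) (nakano_norm p) x)"
proof
  assume "\<exists>x. greedy_basis (nakano_space p) (nakano_norm p) x"
  then obtain x where x: "greedy_basis (nakano_space p) (nakano_norm p) x" by blast
  interpret nakano p by unfold_locales (rule assms(1))
  have schauder: "schauder_basis X N x" and sn: "semi_normalized N x"
    using x by (auto simp: greedy_basis_def)
  from x obtain C' where C': "\<And>v \<Lambda>. v \<in> X \<Longrightarrow> finite \<Lambda> \<Longrightarrow> greedy_set N x v \<Lambda> \<Longrightarrow>
      N (v - (\<Sum>n\<in>\<Lambda>. coord N x n v *\<^sub>R x n)) \<le> C' * best_approx_error N x (card \<Lambda>) v"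
    unfolding greedy_basis_def by blast
  have x_in: "x n \<in> X" for n using schauder by (auto simp: schauder_basis_def)
  define \<kappa> where "\<kappa> = (INF n. N (x n))"
  have \<kappa>: "0 < \<kappa>" "\<kappa> \<le> N (x n)" for n
    using sn x_in unfolding semi_normalized_def \<kappa>_def
    by (auto intro!: cINF_lower bdd_belowI[of _ 0] nrm_nonneg)
  obtain \<beta> where \<beta>: "N (x n) \<le> \<beta>" for n
    using sn unfolding semi_normalized_def bdd_above_def by auto
  define C where "C = max 1 C'"
  have greedy: "N (v - (\<Sum>n\<in>\<Lambda>. coord N x n v *\<^sub>R x n)) \<le> C * best_approx_error N x (card \<Lambda>) v"
    if v: "v \<in> X" "finite \<Lambda>" "greedy_set N x v \<Lambda>" for v \<Lambda>
  proof -
    have "0 \<le> best_approx_error N x (card \<Lambda>) v"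
      using v x_in by (intro best_approx_error_nonneg nrm_nonneg diff_in sum_in scale_in)
    then have "C' * best_approx_error N x (card \<Lambda>) v \<le> C * best_approx_error N x (card \<Lambda>) v"
      by (intro mult_right_mono) (auto simp: C_def)
    then show ?thesis using C'[OF v] by linarith
  qed
  interpret nakano_greedy p x C \<kappa> \<beta>
    by unfold_locales (use schauder \<kappa> greedy assms(2) \<beta> in \<open>auto simp: C_def\<close>)
  obtain c :: real where c: "c > 0" "\<And>A. finite A \<Longrightarrow> c * card A \<le> N (\<Sum>n\<in>A. x n)"
    using hump_lower_bound by blast
  \<comment> \<open>The entry \<open>\<beta> + 1\<close> makes \<open>N (x n) < K\<close> strict,
    and \<open>1 / c\<close> converts the hump bound into the democracy constant.\<close>
  define K where "K = Max {1, 4 * C, 2 * C / \<kappa>, \<beta> + 1, 1 / c}"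
  have K: "1 \<le> K" "4 * C \<le> K" "2 * C / \<kappa> \<le> K" "\<beta> + 1 \<le> K" "1 / c \<le> K"
    unfolding K_def by (auto intro: Max_ge)
  have "card A \<le> K * N (\<Sum>n\<in>A. x n)" if "finite A" for A
  proof -
    have "card A = 1 / c * (c * card A)" using c by simp
    also have "\<dots> \<le> K * N (\<Sum>n\<in>A. x n)"
      using c that K by (intro mult_mono) (auto intro: c)
    finally show ?thesis .
  qed
  moreover have "N (x n) < K" for n using \<beta>[of n] K by linarith
  ultimately interpret nakano_greedy_const p x C \<kappa> \<beta> K
    using K by unfold_locales auto
  obtain C1 m where C1: "0 \<le> C1"
    "\<And>D. finite D \<Longrightarrow> D \<subseteq> {m..} \<Longrightarrow> card D \<le> C1 * N (restr D (\<lambda>_. 1))"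
    using unit_vectors_l1 by blast
  have "\<forall>\<^sub>F l in sequentially. p l < 2" using assms(2) by (rule order_tendstoD) simp
  then obtain m' where m': "\<And>l. l \<ge> m' \<Longrightarrow> p l < 2" by (auto simp: eventually_sequentially)
  \<comment> \<open>The constant is raised to at least one and the starting index moved up, so that
    the exponents are also at most two.\<close>
  have "card D \<le> (C1 + 1) * N (restr D (\<lambda>_. 1))" if "finite D" "D \<subseteq> {max m m'..}" for D
  proof -
    have "card D \<le> C1 * N (restr D (\<lambda>_. 1))" using that by (intro C1) auto
    also have "\<dots> \<le> (C1 + 1) * N (restr D (\<lambda>_. 1))"
      using that by (intro mult_right_mono nrm_nonneg restr_in_X) auto
    finally show ?thesis .
  qed
  then have l1: "\<And>D. finite D \<Longrightarrow> D \<subseteq> {max m m'..} \<Longrightarrow> card D \<le> (C1 + 1) * N (restr D (\<lambda>_. 1))" .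
  have p2: "p l \<le> 2" if "l \<ge> max m m'" for l using m'[of l] that by simp
  obtain r :: real where r: "0 < r" "r < 1"
    and fin: "(\<Sum>n. ennreal (if p n = 1 then 0 else r powr (1 / \<bar>p n - 1\<bar>))) < \<infinity>"
    by (rule sum_finite_of_unit_vectors_l1[OF p2 _ l1]) (use C1(1) in auto)
  show False using fin unfolding assms(3)[OF r] by simp
qed

end
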